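(* Let $S$ be an Ore semigroup and let $G=S^{-1}S$ be its enveloping group. Then: (1) Every multiplier on $S$ extends to a multiplier on $G$. (2) Restriction of multipliers on $G$ to multipliers on $S$ gives an isomorphism of $H^2(G,\mathbb T)$ onto $H^2(S,\mathbb T)$. (3) Suppose $\lambda$ is a multiplier on $S$, let $V$ be a $\lambda$-representation of $S$ by isometries on a Hilbert space $H$, and let $\mu$ be a multiplier on $G$ extending $\lambda$. Then there exists a unitary $\mu$-representation $U$ of $G$ on a Hilbert space $\mathcal H$ containing a copy of $H$ such that $U_s|_H=V_s$ for all $s\in S$ and $\bigcup_{s\in S}U_s^*H$ is dense in $\mathcal H$. Moreover, $U$ and $\mathcal H$ are unique up to canonical isomorphism.
   Context: An Ore semigroup is a (discrete) cancellative semigroup $S$ such that $Ss\cap St\neq\emptyset$ for all $s,t\in S$. Such an $S$ embeds in a group $G$, unique up to canonical isomorphism, with $G=S^{-1}S=\{s^{-1}t:s,t\in S\}$ (the enveloping group). For a semigroup or group $T$, a multiplier on $T$ is a function $\lambda:T\times T\to\mathbb T$ (the circle) with $\lambda(r,s)\lambda(rs,t)=\lambda(r,st)\lambda(s,t)$ for all $r,s,t\in T$. Multipliers form an abelian group under pointwise multiplication; the coboundaries are the multipliers of the form $(s,t)\mapsto f(s)f(t)\overline{f(st)}$ for a function $f:T\to\mathbb T$, and $H^2(T,\mathbb T)$ is the quotient of the group of multipliers by the subgroup of coboundaries. A $\lambda$-representation of $S$ by isometries on $H$ is a family $\{V_s:s\in S\}$ of isometries on $H$ with $V_sV_t=\lambda(s,t)V_{st}$;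 a unitary $\mu$-representation of $G$ on $\mathcal H$ is a family $\{U_g:g\in G\}$ of unitaries on $\mathcal H$ with $U_gU_h=\mu(g,h)U_{gh}$. "Containing a copy of $H$" means $H$ is identified with a closed subspace of $\mathcal H$ via an isometric linear embedding. Uniqueness up to canonical isomorphism in (3) means: if $(U',\mathcal H')$ is another pair with the stated properties, then there is a unitary operator $W:\mathcal H\to\mathcal H'$ with $W(U_s^*h)={U'_s}^*h$ for all $s\in S$, $h\in H$, and $WU_g=U'_gW$ for all $g\in G$. *)

theory Defs
  imports "HOL-Analysis.Analysis" "HOL-Algebra.Coset" "HOL-Algebra.Module"
    "HOL-Algebra.Algebraic_Closure_Type"
begin

section \<open>Ore semigroups and their enveloping groups\<close>

text \<open>A semigroup is given by a \<open>monoid\<close> record whose \<open>one\<close> field is ignored: no unit is assumed.\<close>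

locale ore_semigroup =
  fixes S :: "('s, 'x) monoid_scheme" (structure)
  assumes m_closed: "\<lbrakk>s \<in> carrier S; t \<in> carrier S\<rbrakk> \<Longrightarrow> s \<otimes> t \<in> carrier S"
    and m_assoc: "\<lbrakk>r \<in> carrier S; s \<in> carrier S; t \<in> carrier S\<rbrakk>
      \<Longrightarrow> (r \<otimes> s) \<otimes> t = r \<otimes> (s \<otimes> t)"
    and l_cancel: "\<lbrakk>r \<in> carrier S; s \<in> carrier S; t \<in> carrier S; r \<otimes> s = r \<otimes> t\<rbrakk> \<Longrightarrow> s = t"
    and r_cancel: "\<lbrakk>r \<in> carrier S; s \<in> carrier S; t \<in> carrier S; s \<otimes> r = t \<otimes> r\<rbrakk> \<Longrightarrow> s = t"
    and ore: "\<lbrakk>s \<in> carrier S; t \<in> carrier S\<rbrakk>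
      \<Longrightarrow> (\<lambda>r. r \<otimes> s) ` carrier S \<inter> (\<lambda>r. r \<otimes> t) ` carrier S \<noteq> {}"

locale enveloping_group = group G
  for S :: "('s, 'x) monoid_scheme" and G :: "('g, 'y) monoid_scheme" and \<iota> :: "'s \<Rightarrow> 'g" +
  assumes embedding_hom: "\<iota> \<in> hom S G"
    and embedding_inj: "inj_on \<iota> (carrier S)"
    and carrier_fractions:
      "carrier G = {inv\<^bsub>G\<^esub> \<iota> s \<otimes>\<^bsub>G\<^esub> \<iota> t | s t. s \<in> carrier S \<and> t \<in> carrier S}"


section \<open>Multipliers and second cohomology\<close>

text \<open>Multipliers are extensional functions (\<open>undefined\<close> off \<open>carrier T \<times> carrier T\<close>), so that
  HOL equality of multipliers is equality on the semigroup.\<close>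

definition multipliers :: "('a, 'x) monoid_scheme \<Rightarrow> ('a \<times> 'a \<Rightarrow> complex) set" where
  "multipliers T = {\<sigma> \<in> carrier T \<times> carrier T \<rightarrow>\<^sub>E sphere 0 1.
     \<forall>r\<in>carrier T. \<forall>s\<in>carrier T. \<forall>t\<in>carrier T.
       \<sigma> (r, s) * \<sigma> (r \<otimes>\<^bsub>T\<^esub> s, t) = \<sigma> (r, s \<otimes>\<^bsub>T\<^esub> t) * \<sigma> (s, t)}"

definition multiplier_group :: "('a, 'x) monoid_scheme \<Rightarrow> ('a \<times> 'a \<Rightarrow> complex) monoid" where
  "multiplier_group T =
    \<lparr>carrier = multipliers T,
     mult = (\<lambda>\<sigma> \<tau>. \<lambda>p\<in>carrier T \<times> carrier T. \<sigma> p * \<tau> p),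
     one = (\<lambda>p\<in>carrier T \<times> carrier T. 1)\<rparr>"

definition coboundaries :: "('a, 'x) monoid_scheme \<Rightarrow> ('a \<times> 'a \<Rightarrow> complex) set" where
  "coboundaries T = {\<sigma> \<in> multipliers T. \<exists>f \<in> carrier T \<rightarrow> sphere 0 1.
     \<forall>s\<in>carrier T. \<forall>t\<in>carrier T. \<sigma> (s, t) = f s * f t * cnj (f (s \<otimes>\<^bsub>T\<^esub> t))}"

definition H2 :: "('a, 'x) monoid_scheme \<Rightarrow> ('a \<times> 'a \<Rightarrow> complex) set monoid" where
  "H2 T = multiplier_group T Mod coboundaries T"

definition H2_class ::
    "('a, 'x) monoid_scheme \<Rightarrow> ('a \<times> 'a \<Rightarrow> complex) \<Rightarrow> ('a \<times> 'a \<Rightarrow> complex) set" where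
  "H2_class T \<sigma> = coboundaries T #>\<^bsub>multiplier_group T\<^esub> \<sigma>"

definition restrict_multiplier ::
    "('s, 'x) monoid_scheme \<Rightarrow> ('s \<Rightarrow> 'g) \<Rightarrow> ('g \<times> 'g \<Rightarrow> complex) \<Rightarrow> 's \<times> 's \<Rightarrow> complex" where
  "restrict_multiplier S \<iota> \<mu> = (\<lambda>(s, t)\<in>carrier S \<times> carrier S. \<mu> (\<iota> s, \<iota> t))"

text \<open>For any semigroup \<open>T\<close>, \<open>H2 T\<close> is the quotient of an abelian group by a subgroup.\<close>

lemma cnj_unit: "norm (z::complex) = 1 \<Longrightarrow> z * cnj z = 1"
  by (metis complex_norm_square mult.commute of_real_1 one_power2)

lemma
  assumes closed: "\<And>s t. \<lbrakk>s \<in> carrier T; t \<in> carrier T\<rbrakk> \<Longrightarrow> s \<otimes>\<^bsub>T\<^esub> t \<in> carrier T"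
  shows multiplier_group_comm_group: "comm_group (multiplier_group T)"
    and coboundaries_subgroup: "subgroup (coboundaries T) (multiplier_group T)"
proof -
  let ?M = "multiplier_group T" and ?C = "carrier T \<times> carrier T"
  have mult_cl: "(\<lambda>p\<in>?C. \<sigma> p * \<tau> p) \<in> multipliers T"
    if "\<sigma> \<in> multipliers T" "\<tau> \<in> multipliers T" for \<sigma> \<tau>
  proof -
    have "\<And>r s t. \<lbrakk>r \<in> carrier T; s \<in> carrier T; t \<in> carrier T\<rbrakk> \<Longrightarrow>
        (\<sigma> (r, s) * \<sigma> (r \<otimes>\<^bsub>T\<^esub> s, t)) * (\<tau> (r, s) * \<tau> (r \<otimes>\<^bsub>T\<^esub> s, t)) =
        (\<sigma> (r, s \<otimes>\<^bsub>T\<^esub> t) * \<sigma> (s, t)) * (\<tau> (r, s \<otimes>\<^bsub>T\<^esub> t) * \<tau> (s, t))"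
      using that by (simp add: multipliers_def)
    then show ?thesis
      using that by (fastforce simp: multipliers_def closed PiE_iff norm_mult mult_ac)
  qed
  have inv_cl: "(\<lambda>p\<in>?C. cnj (\<sigma> p)) \<in> multipliers T" if "\<sigma> \<in> multipliers T" for \<sigma>
    using that by (auto simp: multipliers_def closed PiE_iff simp flip: complex_cnj_mult)
  have one_cl: "(\<lambda>p\<in>?C. 1) \<in> multipliers T"
    by (auto simp: multipliers_def closed)
  have inv_eq: "(\<lambda>p\<in>?C. cnj (\<sigma> p) * \<sigma> p) = (\<lambda>p\<in>?C. 1)" if "\<sigma> \<in> multipliers T" for \<sigma>
    using that by (intro restrict_ext) (auto simp: multipliers_def PiE_iff cnj_unit mult.commute)
  show cg: "comm_group ?M"
  proof (rule comm_groupI)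
    fix \<sigma> assume s: "\<sigma> \<in> carrier ?M"
    then have "\<sigma> \<in> extensional ?C"
      by (auto simp: multiplier_group_def multipliers_def PiE_iff)
    then show "\<one>\<^bsub>?M\<^esub> \<otimes>\<^bsub>?M\<^esub> \<sigma> = \<sigma>"
      by (auto simp: multiplier_group_def fun_eq_iff extensional_def)
    show "\<exists>\<tau>\<in>carrier ?M. \<tau> \<otimes>\<^bsub>?M\<^esub> \<sigma> = \<one>\<^bsub>?M\<^esub>"
    proof
      show "(\<lambda>p\<in>?C. cnj (\<sigma> p)) \<in> carrier ?M"
        using s inv_cl by (simp add: multiplier_group_def)
      have "(\<lambda>p\<in>?C. (\<lambda>p\<in>?C. cnj (\<sigma> p)) p * \<sigma> p) = (\<lambda>p\<in>?C. cnj (\<sigma> p) * \<sigma> p)"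
        by (intro restrict_ext) simp
      then show "(\<lambda>p\<in>?C. cnj (\<sigma> p)) \<otimes>\<^bsub>?M\<^esub> \<sigma> = \<one>\<^bsub>?M\<^esub>"
        using s inv_eq by (simp add: multiplier_group_def)
    qed
  qed (auto simp: multiplier_group_def mult_cl one_cl mult_ac intro!: restrict_ext)
  interpret comm_group ?M by (rule cg)
  have inv: "inv\<^bsub>?M\<^esub> \<sigma> = (\<lambda>p\<in>?C. cnj (\<sigma> p))" if "\<sigma> \<in> multipliers T" for \<sigma>
  proof (rule inv_equality)
    have "(\<lambda>p\<in>?C. (\<lambda>p\<in>?C. cnj (\<sigma> p)) p * \<sigma> p) = (\<lambda>p\<in>?C. cnj (\<sigma> p) * \<sigma> p)"
      by (intro restrict_ext) simp
    then show "(\<lambda>p\<in>?C. cnj (\<sigma> p)) \<otimes>\<^bsub>?M\<^esub> \<sigma> = \<one>\<^bsub>?M\<^esub>"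
      using that inv_eq by (simp add: multiplier_group_def)
  qed (use that inv_cl in \<open>auto simp: multiplier_group_def\<close>)
  show "subgroup (coboundaries T) ?M"
  proof (rule subgroupI)
    show "coboundaries T \<subseteq> carrier ?M"
      by (auto simp: coboundaries_def multiplier_group_def)
    have "(\<lambda>p\<in>?C. 1) \<in> coboundaries T"
      using one_cl by (auto simp: coboundaries_def intro!: bexI[of _ "\<lambda>_. 1"])
    then show "coboundaries T \<noteq> {}" by blast
  next
    fix \<sigma> assume "\<sigma> \<in> coboundaries T"
    then obtain f where s: "\<sigma> \<in> multipliers T" and f: "f \<in> carrier T \<rightarrow> sphere 0 1"
      and e: "\<forall>s\<in>carrier T. \<forall>t\<in>carrier T. \<sigma> (s, t) = f s * f t * cnj (f (s \<otimes>\<^bsub>T\<^esub> t))"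
      by (auto simp: coboundaries_def)
    show "inv\<^bsub>?M\<^esub> \<sigma> \<in> coboundaries T"
      unfolding inv[OF s] coboundaries_def
      using inv_cl[OF s] f e by (auto intro!: bexI[of _ "\<lambda>x. cnj (f x)"])
  next
    fix \<sigma> \<tau> assume "\<sigma> \<in> coboundaries T" "\<tau> \<in> coboundaries T"
    then obtain f g where s: "\<sigma> \<in> multipliers T" "\<tau> \<in> multipliers T"
      and f: "f \<in> carrier T \<rightarrow> sphere 0 1" "g \<in> carrier T \<rightarrow> sphere 0 1"
      and e: "\<forall>s\<in>carrier T. \<forall>t\<in>carrier T. \<sigma> (s, t) = f s * f t * cnj (f (s \<otimes>\<^bsub>T\<^esub> t))"
        "\<forall>s\<in>carrier T. \<forall>t\<in>carrier T. \<tau> (s, t) = g s * g t * cnj (g (s \<otimes>\<^bsub>T\<^esub> t))"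
      by (auto simp: coboundaries_def)
    have fg: "(\<lambda>x. f x * g x) \<in> carrier T \<rightarrow> sphere 0 1"
      using f by (auto simp: Pi_iff norm_mult)
    show "\<sigma> \<otimes>\<^bsub>?M\<^esub> \<tau> \<in> coboundaries T"
      using mult_cl[OF s] e
      by (auto simp: multiplier_group_def coboundaries_def mult_ac intro!: bexI[OF _ fg])
  qed
qed


section \<open>Complex Hilbert spaces\<close>

text \<open>Hilbert spaces are carried by sets, because part of the assertion is the existence of a
  Hilbert space. The multiplicative fields \<open>mult\<close> and \<open>one\<close> that a \<open>module\<close> record inherits from
  \<open>ring\<close> play no role. The inner product is linear in its first argument.\<close>

record 'h hilbert = "(complex, 'h) module" +
  cinner :: "'h \<Rightarrow> 'h \<Rightarrow> complex"

definition hnorm :: "('h, 'x) hilbert_scheme \<Rightarrow> 'h \<Rightarrow> real" where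
  "hnorm H x = sqrt (Re (cinner H x x))"

text \<open>The library's \<open>Metric_space\<close> requires a distance that is symmetric and nonnegative on the
  whole type, hence the value 0 off the carrier.\<close>

definition hdist :: "('h, 'x) hilbert_scheme \<Rightarrow> 'h \<Rightarrow> 'h \<Rightarrow> real" where
  "hdist H x y = (if x \<in> carrier H \<and> y \<in> carrier H then hnorm H (x \<ominus>\<^bsub>H\<^esub> y) else 0)"

abbreviation htopology :: "('h, 'x) hilbert_scheme \<Rightarrow> 'h topology" where
  "htopology H \<equiv> Metric_space.mtopology (carrier H) (hdist H)"

locale complex_inner_space = Module.module "ring_of_type_algebra :: complex ring" H
  for H :: "('h, 'x) hilbert_scheme" (structure) +
  assumes cinner_add: "\<lbrakk>x \<in> carrier H; y \<in> carrier H; z \<in> carrier H\<rbrakk>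
      \<Longrightarrow> cinner H (x \<oplus> y) z = cinner H x z + cinner H y z"
    and cinner_smult: "\<lbrakk>x \<in> carrier H; y \<in> carrier H\<rbrakk>
      \<Longrightarrow> cinner H (a \<odot> x) y = a * cinner H x y"
    and cinner_commute: "\<lbrakk>x \<in> carrier H; y \<in> carrier H\<rbrakk>
      \<Longrightarrow> cinner H y x = cnj (cinner H x y)"
    and cinner_nonneg: "x \<in> carrier H \<Longrightarrow> 0 \<le> Re (cinner H x x)"
    and cinner_definite: "\<lbrakk>x \<in> carrier H; cinner H x x = 0\<rbrakk> \<Longrightarrow> x = \<zero>"

context complex_inner_space
begin

lemma smult_in [simp]: "x \<in> carrier H \<Longrightarrow> a \<odot> x \<in> carrier H"
  using smult_closed[of a x] by (simp add: ring_of_type_algebra_def)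

lemma cinner_add_right:
  assumes "x \<in> carrier H" "y \<in> carrier H" "z \<in> carrier H"
  shows "cinner H z (x \<oplus> y) = cinner H z x + cinner H z y"
  using assms cinner_commute[of "x \<oplus> y" z] cinner_commute[of x z] cinner_commute[of y z]
  by (simp add: cinner_add)

lemma cinner_smult_right:
  assumes "x \<in> carrier H" "y \<in> carrier H"
  shows "cinner H y (a \<odot> x) = cnj a * cinner H y x"
  using assms cinner_commute[of "a \<odot> x" y] cinner_commute[of x y] by (simp add: cinner_smult)

lemma cinner_self_real: "x \<in> carrier H \<Longrightarrow> cinner H x x = of_real (Re (cinner H x x))"
  using cinner_commute[of x x] by (simp add: complex_eq_iff)

lemma cinner_zero [simp]: "cinner H \<zero> \<zero> = 0"
  using cinner_add[of \<zero> \<zero> \<zero>] by simp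

lemma Re_cinner_sum:
  assumes "x \<in> carrier H" "y \<in> carrier H"
  shows "Re (cinner H (x \<oplus> complex_of_real r \<odot> y) (x \<oplus> complex_of_real r \<odot> y)) =
    Re (cinner H x x) + 2 * r * Re (cinner H x y) + r\<^sup>2 * Re (cinner H y y)"
  using assms cinner_commute[of x y]
  by (simp add: cinner_add cinner_add_right cinner_smult cinner_smult_right
      algebra_simps power2_eq_square)

lemma Re_cinner_le:
  assumes "x \<in> carrier H" "y \<in> carrier H"
  shows "Re (cinner H x y) \<le> hnorm H x * hnorm H y"
proof -
  define A B C where "A = Re (cinner H x x)" and "B = Re (cinner H x y)" and "C = Re (cinner H y y)"
  have ge: "0 \<le> A + 2 * r * B + r\<^sup>2 * C" for r
    using cinner_nonneg[of "x \<oplus> complex_of_real r \<odot> y"] Re_cinner_sum[OF assms, of r] assms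
    by (simp add: A_def B_def C_def)
  have AC: "0 \<le> A" "0 \<le> C" using assms cinner_nonneg by (auto simp: A_def C_def)
  have "B\<^sup>2 \<le> A * C"
  proof (cases "C = 0")
    case True
    have "B = 0"
    proof (rule ccontr)
      assume "B \<noteq> 0"
      with ge[of "- (A + 1) / (2 * B)"] True show False by simp
    qed
    with True show ?thesis by simp
  next
    case False
    with AC have "C > 0" by simp
    with ge[of "- B / C"] show ?thesis by (simp add: field_simps power2_eq_square)
  qed
  then have "B \<le> sqrt (A * C)" by (rule real_le_rsqrt)
  then show ?thesis by (simp add: hnorm_def A_def B_def C_def real_sqrt_mult)
qed

lemma hnorm_triangle:
  assumes "x \<in> carrier H" "y \<in> carrier H"
  shows "hnorm H (x \<oplus> y) \<le> hnorm H x + hnorm H y"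
proof -
  have sq: "(hnorm H z)\<^sup>2 = Re (cinner H z z)" if "z \<in> carrier H" for z
    using cinner_nonneg[OF that] by (simp add: hnorm_def)
  have "Re (cinner H (x \<oplus> y) (x \<oplus> y)) =
      Re (cinner H x x) + 2 * Re (cinner H x y) + Re (cinner H y y)"
    using assms cinner_commute[of x y] by (simp add: cinner_add cinner_add_right)
  also have "\<dots> \<le> (hnorm H x + hnorm H y)\<^sup>2"
    using Re_cinner_le[OF assms] assms by (simp add: sq power2_sum)
  finally have "hnorm H (x \<oplus> y) \<le> sqrt ((hnorm H x + hnorm H y)\<^sup>2)"
    unfolding hnorm_def[of H "x \<oplus> y"] by (rule real_sqrt_le_mono)
  then show ?thesis
    using assms cinner_nonneg by (simp add: hnorm_def)
qed

lemma hnorm_eq_0_iff: "x \<in> carrier H \<Longrightarrow> hnorm H x = 0 \<longleftrightarrow> x = \<zero>"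
  using cinner_definite[of x] cinner_self_real[of x] by (auto simp: hnorm_def)

lemma hnorm_uminus: "x \<in> carrier H \<Longrightarrow> hnorm H (\<ominus> x) = hnorm H x"
  using cinner_add[of x "\<ominus> x" x] cinner_add[of x "\<ominus> x" "\<ominus> x"]
    cinner_add[of \<zero> \<zero> x] cinner_add[of \<zero> \<zero> "\<ominus> x"] cinner_commute[of x "\<ominus> x"]
  by (simp add: hnorm_def M.r_neg complex_eq_iff)

sublocale Metric_space "carrier H" "hdist H"
proof
  show "0 \<le> hdist H x y" for x y
    using cinner_nonneg[of "x \<ominus> y"] by (simp add: hdist_def hnorm_def)
  show "hdist H x y = hdist H y x" for x y
    using hnorm_uminus[of "x \<ominus> y"] by (auto simp: hdist_def M.minus_eq M.minus_add M.a_comm)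
  show "hdist H x y = 0 \<longleftrightarrow> x = y" if "x \<in> carrier H" "y \<in> carrier H" for x y
    using that hnorm_eq_0_iff[of "x \<ominus> y"] M.minus_equality[of x "\<ominus> y"]
    by (auto simp: hdist_def M.minus_eq M.r_neg)
  show "hdist H x z \<le> hdist H x y + hdist H y z"
    if "x \<in> carrier H" "y \<in> carrier H" "z \<in> carrier H" for x y z
  proof -
    have "(\<ominus> y) \<oplus> (y \<oplus> (\<ominus> z)) = \<ominus> z"
      using that by (simp add: M.r_neg1)
    then have "x \<ominus> z = (x \<ominus> y) \<oplus> (y \<ominus> z)"
      using that by (simp add: M.minus_eq M.a_assoc)
    then show ?thesis
      using that hnorm_triangle[of "x \<ominus> y" "y \<ominus> z"] by (simp add: hdist_def)
  qed
qed

end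

locale complex_hilbert_space = complex_inner_space +
  assumes complete: "mcomplete"

definition linear_isometry ::
    "('h, 'x) hilbert_scheme \<Rightarrow> ('k, 'y) hilbert_scheme \<Rightarrow> ('h \<Rightarrow> 'k) \<Rightarrow> bool" where
  "linear_isometry H K T \<longleftrightarrow>
     T \<in> carrier H \<rightarrow> carrier K \<and>
     (\<forall>x\<in>carrier H. \<forall>y\<in>carrier H. T (x \<oplus>\<^bsub>H\<^esub> y) = T x \<oplus>\<^bsub>K\<^esub> T y) \<and>
     (\<forall>a. \<forall>x\<in>carrier H. T (a \<odot>\<^bsub>H\<^esub> x) = a \<odot>\<^bsub>K\<^esub> T x) \<and>
     (\<forall>x\<in>carrier H. hnorm K (T x) = hnorm H x)"

definition unitary_operator ::
    "('h, 'x) hilbert_scheme \<Rightarrow> ('k, 'y) hilbert_scheme \<Rightarrow> ('h \<Rightarrow> 'k) \<Rightarrow> bool" where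
  "unitary_operator H K T \<longleftrightarrow> linear_isometry H K T \<and> T ` carrier H = carrier K"

definition hadjoint ::
    "('h, 'x) hilbert_scheme \<Rightarrow> ('k, 'y) hilbert_scheme \<Rightarrow> ('h \<Rightarrow> 'k) \<Rightarrow> 'k \<Rightarrow> 'h" where
  "hadjoint H K T = (SOME T'. T' \<in> carrier K \<rightarrow> carrier H \<and>
     (\<forall>x\<in>carrier H. \<forall>y\<in>carrier K. cinner K (T x) y = cinner H x (T' y)))"


section \<open>Projective representations and dilations\<close>

definition isometric_rep ::
    "('s, 'x) monoid_scheme \<Rightarrow> ('s \<times> 's \<Rightarrow> complex) \<Rightarrow> ('h, 'y) hilbert_scheme
      \<Rightarrow> ('s \<Rightarrow> 'h \<Rightarrow> 'h) \<Rightarrow> bool" where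
  "isometric_rep S \<sigma> H V \<longleftrightarrow>
     (\<forall>s\<in>carrier S. linear_isometry H H (V s)) \<and>
     (\<forall>s\<in>carrier S. \<forall>t\<in>carrier S. \<forall>x\<in>carrier H.
        V s (V t x) = \<sigma> (s, t) \<odot>\<^bsub>H\<^esub> V (s \<otimes>\<^bsub>S\<^esub> t) x)"

definition unitary_rep ::
    "('g, 'x) monoid_scheme \<Rightarrow> ('g \<times> 'g \<Rightarrow> complex) \<Rightarrow> ('h, 'y) hilbert_scheme
      \<Rightarrow> ('g \<Rightarrow> 'h \<Rightarrow> 'h) \<Rightarrow> bool" where
  "unitary_rep G \<mu> H U \<longleftrightarrow>
     (\<forall>g\<in>carrier G. unitary_operator H H (U g)) \<and>
     (\<forall>g\<in>carrier G. \<forall>h\<in>carrier G. \<forall>x\<in>carrier H.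
        U g (U h x) = \<mu> (g, h) \<odot>\<^bsub>H\<^esub> U (g \<otimes>\<^bsub>G\<^esub> h) x)"

text \<open>\<open>J\<close> identifies \<open>H\<close> with a subspace of \<open>K\<close>, which is closed because \<open>H\<close> is complete.\<close>

definition minimal_unitary_dilation ::
    "('s, 'x) monoid_scheme \<Rightarrow> ('g, 'y) monoid_scheme \<Rightarrow> ('s \<Rightarrow> 'g) \<Rightarrow> ('g \<times> 'g \<Rightarrow> complex)
      \<Rightarrow> ('h, 'z) hilbert_scheme \<Rightarrow> ('s \<Rightarrow> 'h \<Rightarrow> 'h)
      \<Rightarrow> ('k, 'w) hilbert_scheme \<Rightarrow> ('g \<Rightarrow> 'k \<Rightarrow> 'k) \<Rightarrow> ('h \<Rightarrow> 'k) \<Rightarrow> bool" where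
  "minimal_unitary_dilation S G \<iota> \<mu> H V K U J \<longleftrightarrow>
     complex_hilbert_space K \<and>
     unitary_rep G \<mu> K U \<and>
     linear_isometry H K J \<and>
     (\<forall>s\<in>carrier S. \<forall>x\<in>carrier H. U (\<iota> s) (J x) = J (V s x)) \<and>
     htopology K closure_of (\<Union>s\<in>carrier S. hadjoint K K (U (\<iota> s)) ` J ` carrier H) = carrier K"

end

theory Submission
  imports Defs
begin

text \<open>Every element of \<open>G\<close> is carried into \<open>S\<close> by left multiplication by some \<open>s \<in> S\<close>, and any two
  elements of \<open>S\<close> have a common left multiple. Hence data attached to \<open>g \<in> G\<close> can be computed at any
  \<open>s\<close> with \<open>s, s g \<in> S\<close>, provided that replacing \<open>s\<close> by \<open>t s\<close> does not change them. A multiplier \<open>\<lambda>\<close> extends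
  because for each \<open>g\<close> there is a function \<open>\<phi>\<^sub>g\<close> with \<open>\<lambda> (t, s) \<phi>\<^sub>g (t s) = \<lambda> (t, s g) \<phi>\<^sub>g s\<close>, and then
  \<open>\<mu> (g, h) = \<phi>\<^sub>g s \<phi>\<^sub>h (s g) / \<phi>\<^bsub>g h\<^esub> s\<close> does not depend on \<open>s\<close>. A cochain \<open>f\<close> on \<open>S\<close> whose coboundary
  is the restriction of \<open>\<mu>\<close> extends by \<open>f g = f (s g) \<mu> (s, g) / f s\<close>.

  A dilation is determined by the functions \<open>g \<mapsto> J\<^sup>* U\<^sub>g \<xi>\<close>. They are exactly the bounded functions
  \<open>f : G \<rightarrow> H\<close> with \<open>f g = \<mu> (t, g) V\<^sub>t\<^sup>* f (t g)\<close> for \<open>t \<in> S\<close>. Along \<open>g \<le> t g\<close> the norms \<open>\<parallel>f g\<parallel>\<close> increase to \<open>\<parallel>\<xi>\<parallel>\<close>,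
  and \<open>G\<close> acts by \<open>(U\<^sub>x f) g = \<mu> (g, x) f (g x)\<close>. So these functions form a concrete complete model, with no
  quotient or completion, to which every minimal dilation is canonically unitarily equivalent.\<close>

section \<open>Hilbert spaces\<close>

text \<open>The functions \<open>\<phi> g\<close> exist because the ratio of
  \<open>\<lambda> (t, s g)\<close> to \<open>\<lambda> (t, s)\<close> is a 1-cocycle for the order
  in which \<open>s\<close> lies below \<open>t s\<close>. This order is directed and, by
  cancellation, has at most one arrow between two points, so a 1-cocycle is determined by one value
  and is trivial. For \<open>g\<close> in \<open>S\<close> the choice
  \<open>\<phi> g s = \<lambda> (s, g)\<close> makes the extension exact, not merely exact up to a
  coboundary.

  The usual dilation is a direct limit of copies of \<open>H\<close>. The model is its dual, an
  inverse limit along the adjoints of the \<open>V t\<close>, so it lives on an explicit function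
  type. The price is a proof that the copy of \<open>H\<close> generates it: \<open>J (f s)\<close>
  is the projection of \<open>U s f\<close> onto that copy, and the squared distance is the squared
  norm of \<open>f\<close> minus that of \<open>f s\<close>, which tends to 0.

  Nothing is normalised. \<open>S\<close> may have no unit, so \<open>J x\<close> is described
  through all denominators of \<open>g\<close> at once, and the unit of \<open>G\<close> acts by the
  scalar \<open>\<mu> (1, 1)\<close>. In the comparison with the model, density in the given
  dilation yields an isometry, and density in the model yields surjectivity.\<close>

context complex_inner_space
begin

lemma smult_add_left: "x \<in> carrier H \<Longrightarrow> (a + b) \<odot> x = a \<odot> x \<oplus> b \<odot> x"
  using smult_l_distr[of a b x] by (simp add: ring_of_type_algebra_def)

lemma smult_add_right: "x \<in> carrier H \<Longrightarrow> y \<in> carrier H \<Longrightarrow> a \<odot> (x \<oplus> y) = a \<odot> x \<oplus> a \<odot> y"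
  using smult_r_distr[of a x y] by (simp add: ring_of_type_algebra_def)

lemma smult_smult: "x \<in> carrier H \<Longrightarrow> a \<odot> (b \<odot> x) = (a * b) \<odot> x"
  using smult_assoc1[of a b x] by (simp add: ring_of_type_algebra_def)

lemma smult_1 [simp]: "x \<in> carrier H \<Longrightarrow> 1 \<odot> x = x"
  using smult_one[of x] by (simp add: ring_of_type_algebra_def)

lemma smult_0 [simp]: "x \<in> carrier H \<Longrightarrow> 0 \<odot> x = \<zero>"
  using smult_l_null[of x] by (simp add: ring_of_type_algebra_def)

lemma smult_minus_one: assumes "x \<in> carrier H" shows "(-1) \<odot> x = \<ominus> x"
proof -
  have "(-1) \<odot> x \<oplus> x = \<zero>"
    using smult_add_left[OF assms, of "-1" 1] assms by simp
  then show ?thesis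
    using assms by (metis M.minus_equality smult_in)
qed

lemma minus_eq_smult: "x \<in> carrier H \<Longrightarrow> y \<in> carrier H \<Longrightarrow> x \<ominus> y = x \<oplus> (-1) \<odot> y"
  by (simp add: smult_minus_one M.minus_eq)

lemma cinner_zero_left [simp]: "x \<in> carrier H \<Longrightarrow> cinner H \<zero> x = 0"
  using cinner_smult[of \<zero> x 0] by simp

lemma cinner_diff:
  "\<lbrakk>x \<in> carrier H; y \<in> carrier H; z \<in> carrier H\<rbrakk> \<Longrightarrow> cinner H (x \<ominus> y) z = cinner H x z - cinner H y z"
  by (simp add: minus_eq_smult cinner_add cinner_smult)

lemma cinner_diff_right:
  "\<lbrakk>x \<in> carrier H; y \<in> carrier H; z \<in> carrier H\<rbrakk> \<Longrightarrow> cinner H z (x \<ominus> y) = cinner H z x - cinner H z y"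
  by (simp add: minus_eq_smult cinner_add_right cinner_smult_right)

lemma hnorm_nonneg [simp]: "x \<in> carrier H \<Longrightarrow> 0 \<le> hnorm H x"
  by (simp add: hnorm_def cinner_nonneg)

lemma hnorm_sq: "x \<in> carrier H \<Longrightarrow> (hnorm H x)\<^sup>2 = Re (cinner H x x)"
  by (simp add: hnorm_def cinner_nonneg)

lemma cinner_self: "x \<in> carrier H \<Longrightarrow> cinner H x x = of_real ((hnorm H x)\<^sup>2)"
  by (rule trans[OF cinner_self_real]) (simp_all add: hnorm_sq)

lemma hnorm_zero [simp]: "hnorm H \<zero> = 0"
  by (simp add: hnorm_def)

lemma hnorm_smult: assumes "x \<in> carrier H" shows "hnorm H (a \<odot> x) = norm a * hnorm H x"
proof (rule power2_eq_imp_eq)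
  have "cinner H (a \<odot> x) (a \<odot> x) = (a * cnj a) * cinner H x x"
    using assms by (simp add: cinner_smult cinner_smult_right)
  also have "\<dots> = of_real ((norm a * hnorm H x)\<^sup>2)"
    using assms by (simp add: cinner_self power_mult_distrib flip: complex_norm_square)
  finally show "(hnorm H (a \<odot> x))\<^sup>2 = (norm a * hnorm H x)\<^sup>2"
    using assms by (simp add: hnorm_sq)
qed (use assms in auto)

lemma hnorm_diff_commute: "\<lbrakk>x \<in> carrier H; y \<in> carrier H\<rbrakk> \<Longrightarrow> hnorm H (x \<ominus> y) = hnorm H (y \<ominus> x)"
  using commute[of x y] by (simp add: hdist_def)

lemma hnorm_diff_triangle:
  "\<lbrakk>x \<in> carrier H; y \<in> carrier H; z \<in> carrier H\<rbrakk> \<Longrightarrow> hnorm H (x \<ominus> z) \<le> hnorm H (x \<ominus> y) + hnorm H (y \<ominus> z)"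
  using triangle[of x y z] by (simp add: hdist_def)

lemma minus_zero: "x \<in> carrier H \<Longrightarrow> x \<ominus> \<zero> = x"
  by (simp add: M.minus_eq)

lemma hnorm_reverse_triangle:
  assumes "x \<in> carrier H" "y \<in> carrier H"
  shows "\<bar>hnorm H x - hnorm H y\<bar> \<le> hnorm H (x \<ominus> y)"
proof -
  have "hnorm H x \<le> hnorm H (x \<ominus> y) + hnorm H y" "hnorm H y \<le> hnorm H (y \<ominus> x) + hnorm H x"
    using hnorm_diff_triangle[of x y \<zero>] hnorm_diff_triangle[of y x \<zero>] assms
    by (simp_all add: minus_zero)
  then show ?thesis using hnorm_diff_commute[OF assms] by linarith
qed

lemma hnorm_diff_eq_0: "\<lbrakk>x \<in> carrier H; y \<in> carrier H\<rbrakk> \<Longrightarrow> hnorm H (x \<ominus> y) = 0 \<longleftrightarrow> x = y"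
  using zero[of x y] by (simp add: hdist_def)

lemma norm_cinner_le:
  assumes "x \<in> carrier H" "y \<in> carrier H"
  shows "norm (cinner H x y) \<le> hnorm H x * hnorm H y"
proof -
  define z where "z = cinner H x y"
  \<comment> \<open>A phase that rotates \<open>z\<close> onto the nonnegative reals, so that the
    bound for real parts applies. Since \<open>sgn 0 = 0\<close>, only \<open>norm u \<le> 1\<close>
    holds in general.\<close>
  define u where "u = cnj (sgn z)"
  have "cnj z * z = of_real (norm z) * of_real (norm z)"
    using complex_norm_square[of z] by (simp add: power2_eq_square mult.commute)
  then have uz: "u * z = of_real (norm z)"
    by (cases "z = 0") (simp_all add: u_def sgn_eq)
  have "norm z = Re (cinner H (u \<odot> x) y)"
    using assms uz by (simp add: cinner_smult z_def)
  also have "\<dots> \<le> norm u * hnorm H x * hnorm H y"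
    using Re_cinner_le[of "u \<odot> x" y] assms by (simp add: hnorm_smult)
  also have "\<dots> \<le> 1 * hnorm H x * hnorm H y"
    using assms by (intro mult_right_mono) (auto simp: u_def norm_sgn)
  finally show ?thesis by (simp add: z_def)
qed

lemma cinner_eqI:
  assumes "x \<in> carrier H" "y \<in> carrier H" "\<And>z. z \<in> carrier H \<Longrightarrow> cinner H x z = cinner H y z"
  shows "x = y"
proof -
  have "cinner H (x \<ominus> y) (x \<ominus> y) = cinner H x (x \<ominus> y) - cinner H y (x \<ominus> y)"
    using assms(1,2) by (simp add: cinner_diff)
  also have "\<dots> = 0" using assms(3)[of "x \<ominus> y"] assms(1,2) by simp
  finally have "x \<ominus> y = \<zero>" using assms(1,2) by (intro cinner_definite) auto
  then show ?thesis
    using assms(1,2) hnorm_diff_eq_0[of x y] by simp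
qed

text \<open>Norms determine inner products: this is why norm-preserving linear maps preserve them,
  and why inner products converge in the model once norms do.\<close>

lemma polarization_Re:
  assumes "x \<in> carrier H" "y \<in> carrier H"
  shows "Re (cinner H x y) = ((hnorm H (x \<oplus> y))\<^sup>2 - (hnorm H (x \<ominus> y))\<^sup>2) / 4"
  using assms cinner_commute[of x y]
  by (simp add: hnorm_sq cinner_diff cinner_diff_right cinner_add cinner_add_right)

lemma polarization_Im:
  assumes "x \<in> carrier H" "y \<in> carrier H"
  shows "Im (cinner H x y) = Re (cinner H x (\<i> \<odot> y))"
  using assms by (simp add: cinner_smult_right)

lemma hnorm_add_sq:
  "\<lbrakk>x \<in> carrier H; y \<in> carrier H\<rbrakk> \<Longrightarrow>
    (hnorm H (x \<oplus> y))\<^sup>2 = (hnorm H x)\<^sup>2 + 2 * Re (cinner H x y) + (hnorm H y)\<^sup>2"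
  using cinner_commute[of x y] by (simp add: hnorm_sq cinner_add cinner_add_right)

lemma hnorm_diff_sq:
  "\<lbrakk>x \<in> carrier H; y \<in> carrier H\<rbrakk> \<Longrightarrow>
    (hnorm H (x \<ominus> y))\<^sup>2 = (hnorm H x)\<^sup>2 - 2 * Re (cinner H x y) + (hnorm H y)\<^sup>2"
  using cinner_commute[of x y] by (simp add: hnorm_sq cinner_diff cinner_diff_right)

lemma limitin_hnorm:
  "limitin mtopology w x F \<longleftrightarrow>
     x \<in> carrier H \<and> (\<forall>\<^sub>F n in F. w n \<in> carrier H) \<and> ((\<lambda>n. hnorm H (w n \<ominus> x)) \<longlongrightarrow> 0) F"
proof -
  have "((\<lambda>n. hdist H (w n) x) \<longlongrightarrow> 0) F \<longleftrightarrow> ((\<lambda>n. hnorm H (w n \<ominus> x)) \<longlongrightarrow> 0) F"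
    if "x \<in> carrier H" "\<forall>\<^sub>F n in F. w n \<in> carrier H"
    by (rule tendsto_cong, rule eventually_mono[OF that(2)]) (use that(1) in \<open>auto simp: hdist_def\<close>)
  then show ?thesis
    by (auto simp: limitin_metric_dist_null)
qed

lemma tendsto_cinner:
  assumes "limitin mtopology w x F" and y: "y \<in> carrier H"
  shows "((\<lambda>n. cinner H (w n) y) \<longlongrightarrow> cinner H x y) F"
proof -
  have x: "x \<in> carrier H" and ev: "\<forall>\<^sub>F n in F. w n \<in> carrier H"
    and lim: "((\<lambda>n. hnorm H (w n \<ominus> x)) \<longlongrightarrow> 0) F"
    using assms by (auto simp: limitin_hnorm)
  have "((\<lambda>n. hnorm H (w n \<ominus> x) * hnorm H y) \<longlongrightarrow> 0) F"
    using tendsto_mult_right[OF lim, of "hnorm H y"] by simp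
  moreover have "\<forall>\<^sub>F n in F. norm (cinner H (w n) y - cinner H x y) \<le> hnorm H (w n \<ominus> x) * hnorm H y"
    using ev norm_cinner_le[OF _ y] x y
    by (auto elim!: eventually_mono simp flip: cinner_diff)
  ultimately have "((\<lambda>n. cinner H (w n) y - cinner H x y) \<longlongrightarrow> 0) F"
    by (rule Lim_null_comparison[rotated])
  then show ?thesis by (simp add: LIM_zero_iff)
qed

lemma MCauchy_hnorm:
  "MCauchy w \<longleftrightarrow> range w \<subseteq> carrier H \<and>
     (\<forall>\<epsilon>>0. \<exists>N. \<forall>n\<ge>N. \<forall>m\<ge>N. hnorm H (w n \<ominus> w m) < \<epsilon>)"
  unfolding MCauchy_def hdist_def by (auto simp: image_subset_iff)

lemma hnorm_closure_of:
  assumes "D \<subseteq> carrier H"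
  shows "mtopology closure_of D = carrier H \<longleftrightarrow>
     (\<forall>x\<in>carrier H. \<forall>r>0. \<exists>y\<in>D. hnorm H (x \<ominus> y) < r)"
proof -
  have "mtopology closure_of D = {x \<in> carrier H. \<forall>r>0. \<exists>y\<in>D. hnorm H (x \<ominus> y) < r}"
    unfolding metric_closure_of in_mball hdist_def using assms
    by (intro Collect_cong conj_cong refl all_cong bex_cong) auto
  then show ?thesis by blast
qed

text \<open>The representing vector minimises \<open>\<parallel>x\<parallel>\<^sup>2 - 2 Re \<phi> x\<close>; by the parallelogram law every minimising
  sequence is Cauchy.\<close>

lemma riesz_representation:
  assumes complete: "mcomplete"
    and add: "\<And>x y. \<lbrakk>x \<in> carrier H; y \<in> carrier H\<rbrakk> \<Longrightarrow> \<phi> (x \<oplus> y) = \<phi> x + \<phi> y"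
    and smult: "\<And>a x. x \<in> carrier H \<Longrightarrow> \<phi> (a \<odot> x) = a * \<phi> x"
    and bounded: "\<And>x. x \<in> carrier H \<Longrightarrow> norm (\<phi> x) \<le> C * hnorm H x"
  obtains z where "z \<in> carrier H" "\<And>x. x \<in> carrier H \<Longrightarrow> \<phi> x = cinner H x z"
proof -
  define Q where "Q x = (hnorm H x)\<^sup>2 - 2 * Re (\<phi> x)" for x
  define d where "d = Inf (Q ` carrier H)"
  have "- C\<^sup>2 \<le> Q x" if "x \<in> carrier H" for x
  proof -
    have "Re (\<phi> x) \<le> C * hnorm H x"
      using bounded[OF that] complex_Re_le_cmod[of "\<phi> x"] by linarith
    \<comment> \<open>Completing the square: \<open>r\<^sup>2 - 2 * C * r\<close> is smallest at
      \<open>r = C\<close>.\<close>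
    then show ?thesis
      using zero_le_power2[of "hnorm H x - C"] by (simp add: Q_def power2_diff algebra_simps)
  qed
  then have bdd: "bdd_below (Q ` carrier H)" by (auto simp: bdd_below_def)
  have ge: "d \<le> Q x" if "x \<in> carrier H" for x
    unfolding d_def using bdd that by (intro cInf_lower) auto
  have "\<exists>x\<in>carrier H. Q x < d + 1 / Suc n" for n
  proof -
    have "Q ` carrier H \<noteq> {}" using M.zero_closed by blast
    then show ?thesis
      using cInf_less_iff[of "Q ` carrier H" "d + 1 / Suc n"] bdd by (auto simp: d_def)
  qed
  then obtain w where w: "\<And>n. w n \<in> carrier H" "\<And>n. Q (w n) < d + 1 / Suc n" by metis
  \<comment> \<open>The midpoint of \<open>x\<close> and \<open>y\<close> also has value at least
    \<open>d\<close>; near-minimisers are therefore close to each other.\<close>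
  have parallelogram: "(hnorm H (x \<ominus> y))\<^sup>2 \<le> 2 * (Q x - d) + 2 * (Q y - d)"
    if "x \<in> carrier H" "y \<in> carrier H" for x y
  proof -
    have "4 * Q ((1/2) \<odot> (x \<oplus> y)) = (hnorm H (x \<oplus> y))\<^sup>2 - 4 * Re (\<phi> x + \<phi> y)"
      using that by (simp add: Q_def hnorm_smult smult add power_mult_distrib power2_eq_square)
    moreover have "d \<le> Q ((1/2) \<odot> (x \<oplus> y))" using that by (intro ge) auto
    ultimately show ?thesis
      using that by (simp add: Q_def hnorm_add_sq hnorm_diff_sq)
  qed
  have "MCauchy w"
    unfolding MCauchy_hnorm
  proof (intro conjI allI impI)
    fix \<epsilon> :: real assume "\<epsilon> > 0"
    obtain N where N: "inverse (real (Suc N)) < \<epsilon>\<^sup>2 / 4"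
      using reals_Archimedean[of "\<epsilon>\<^sup>2 / 4"] \<open>\<epsilon> > 0\<close> by auto
    have "hnorm H (w n \<ominus> w m) < \<epsilon>" if nm: "n \<ge> N" "m \<ge> N" for n m
    proof (rule power2_less_imp_less)
      have "Q (w k) - d < \<epsilon>\<^sup>2 / 4" if "k \<ge> N" for k
      proof -
        have "1 / real (Suc k) \<le> inverse (real (Suc N))"
          using that by (simp add: divide_simps)
        then show ?thesis using w(2)[of k] N by linarith
      qed
      note small = this[OF nm(1)] this[OF nm(2)]
      have "(hnorm H (w n \<ominus> w m))\<^sup>2 \<le> 2 * (Q (w n) - d) + 2 * (Q (w m) - d)"
        by (rule parallelogram) (rule w(1))+
      also have "\<dots> < 2 * (\<epsilon>\<^sup>2 / 4) + 2 * (\<epsilon>\<^sup>2 / 4)"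
        by (intro add_strict_mono mult_strict_left_mono small) auto
      finally show "(hnorm H (w n \<ominus> w m))\<^sup>2 < \<epsilon>\<^sup>2" by simp
    qed (use \<open>\<epsilon> > 0\<close> in simp)
    then show "\<exists>N. \<forall>n\<ge>N. \<forall>m\<ge>N. hnorm H (w n \<ominus> w m) < \<epsilon>" by blast
  qed (use w in auto)
  with complete obtain z where z: "limitin mtopology w z sequentially"
    by (auto simp: mcomplete_def)
  then have zc: "z \<in> carrier H" by (simp add: limitin_hnorm)
  have Re_eq: "Re (cinner H x z) = Re (\<phi> x)" if x: "x \<in> carrier H" for x
  proof -
    define b where "b = Re (cinner H z x) - Re (\<phi> x)"
    \<comment> \<open>First variation at the minimum: \<open>w n\<close> is perturbed by
      \<open>r \<odot> x\<close>, which cannot bring the value below \<open>d\<close>. The defect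
      \<open>1 / Suc n\<close> of \<open>w n\<close> disappears in the limit.\<close>
    have quad: "0 \<le> 2 * r * b + r\<^sup>2 * (hnorm H x)\<^sup>2" for r
    proof (rule LIMSEQ_le)
      show "(\<lambda>n. - (1 / real (Suc n))) \<longlonglongrightarrow> 0"
        using tendsto_minus[OF lim_1_over_n[THEN LIMSEQ_Suc]] by simp
      show "(\<lambda>n. 2 * r * (Re (cinner H (w n) x) - Re (\<phi> x)) + r\<^sup>2 * (hnorm H x)\<^sup>2)
          \<longlonglongrightarrow> 2 * r * b + r\<^sup>2 * (hnorm H x)\<^sup>2"
        unfolding b_def by (intro tendsto_intros tendsto_cinner z x)
      have "- (1 / real (Suc n)) \<le> 2 * r * (Re (cinner H (w n) x) - Re (\<phi> x)) + r\<^sup>2 * (hnorm H x)\<^sup>2" for n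
      proof -
        have "d \<le> Q (w n \<oplus> complex_of_real r \<odot> x)" using x w by (intro ge) auto
        then show ?thesis
          using x w(1)[of n] w(2)[of n]
          by (simp add: Q_def hnorm_add_sq hnorm_smult cinner_smult_right add smult algebra_simps
              power_mult_distrib)
      qed
      then show "\<exists>N. \<forall>n\<ge>N. - (1 / real (Suc n)) \<le>
          2 * r * (Re (cinner H (w n) x) - Re (\<phi> x)) + r\<^sup>2 * (hnorm H x)\<^sup>2" by blast
    qed
    have "b = 0"
    proof (cases "hnorm H x = 0")
      case True
      with quad[of "1"] quad[of "-1"] show ?thesis by simp
    next
      case False
      \<comment> \<open>The quadratic polynomial of \<open>quad\<close> at its vertex.\<close>
      then have "2 * (- b / (hnorm H x)\<^sup>2) * b + (- b / (hnorm H x)\<^sup>2)\<^sup>2 * (hnorm H x)\<^sup>2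
          = - (b\<^sup>2 / (hnorm H x)\<^sup>2)"
        by (simp add: power2_eq_square field_simps)
      with quad[of "- b / (hnorm H x)\<^sup>2"] have "b\<^sup>2 / (hnorm H x)\<^sup>2 \<le> 0" by linarith
      with False have "b\<^sup>2 \<le> 0" by (simp add: divide_le_0_iff)
      then show ?thesis by simp
    qed
    then show ?thesis using cinner_commute[OF x zc] by (simp add: b_def)
  qed
  show thesis
  proof (rule that[OF zc])
    fix x assume x: "x \<in> carrier H"
    show "\<phi> x = cinner H x z"
      using Re_eq[OF x] Re_eq[of "\<i> \<odot> x"] x zc smult[of x \<i>] cinner_smult[of x z \<i>]
      by (simp add: complex_eq_iff)
  qed
qed

end

section \<open>Isometries, adjoints and unitary operators\<close>

lemma linear_isometryD:
  assumes "linear_isometry H K T"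
  shows "x \<in> carrier H \<Longrightarrow> T x \<in> carrier K"
    and "\<lbrakk>x \<in> carrier H; y \<in> carrier H\<rbrakk> \<Longrightarrow> T (x \<oplus>\<^bsub>H\<^esub> y) = T x \<oplus>\<^bsub>K\<^esub> T y"
    and "x \<in> carrier H \<Longrightarrow> T (a \<odot>\<^bsub>H\<^esub> x) = a \<odot>\<^bsub>K\<^esub> T x"
    and "x \<in> carrier H \<Longrightarrow> hnorm K (T x) = hnorm H x"
  using assms by (auto simp: linear_isometry_def)

lemma linear_isometry_diff:
  assumes "complex_inner_space H" "complex_inner_space K" "linear_isometry H K T"
    and "x \<in> carrier H" "y \<in> carrier H"
  shows "T (x \<ominus>\<^bsub>H\<^esub> y) = T x \<ominus>\<^bsub>K\<^esub> T y"
proof -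
  interpret H: complex_inner_space H by fact
  interpret K: complex_inner_space K by fact
  show ?thesis
    using assms(4,5) linear_isometryD[OF assms(3)]
    by (simp add: H.minus_eq_smult K.minus_eq_smult)
qed

lemma linear_isometry_cinner:
  assumes "complex_inner_space H" "complex_inner_space K" "linear_isometry H K T"
    and "x \<in> carrier H" "y \<in> carrier H"
  shows "cinner K (T x) (T y) = cinner H x y"
proof -
  interpret H: complex_inner_space H by fact
  interpret K: complex_inner_space K by fact
  note T = linear_isometryD[OF assms(3)]
  have Re: "Re (cinner K (T x) (T y)) = Re (cinner H x y)" if "x \<in> carrier H" "y \<in> carrier H" for x y
    using that by (simp add: H.polarization_Re K.polarization_Re T
        flip: linear_isometry_diff[OF assms(1-3)] T(2))
  have "Im (cinner K (T x) (T y)) = Im (cinner H x y)"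
    using assms(4,5) Re[of x "\<i> \<odot>\<^bsub>H\<^esub> y"] by (simp add: H.polarization_Im K.polarization_Im T)
  then show ?thesis using Re assms by (simp add: complex_eq_iff)
qed

text \<open>\<open>hadjoint\<close> is a choice by \<open>SOME\<close>, so existence comes first:
  pairing \<open>T x\<close> with \<open>y\<close> is a functional of \<open>x\<close> bounded by
  \<open>hnorm K y\<close>, and Riesz applies on the complete space \<open>H\<close>. Contractivity
  is Cauchy-Schwarz for \<open>T\<close> of the adjoint vector, and the left inverse property is
  preservation of inner products.\<close>

lemma hadjoint_isometry:
  assumes H: "complex_hilbert_space H" and K: "complex_inner_space K" and T: "linear_isometry H K T"
  shows "y \<in> carrier K \<Longrightarrow> hadjoint H K T y \<in> carrier H"
    and "\<lbrakk>x \<in> carrier H; y \<in> carrier K\<rbrakk> \<Longrightarrow> cinner K (T x) y = cinner H x (hadjoint H K T y)"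
    and "\<lbrakk>x \<in> carrier H; y \<in> carrier K\<rbrakk> \<Longrightarrow> cinner K y (T x) = cinner H (hadjoint H K T y) x"
    and "y \<in> carrier K \<Longrightarrow> hnorm H (hadjoint H K T y) \<le> hnorm K y"
    and "x \<in> carrier H \<Longrightarrow> hadjoint H K T (T x) = x"
proof -
  interpret H: complex_hilbert_space H by fact
  interpret K: complex_inner_space K by fact
  note T' = linear_isometryD[OF T]
  have "\<exists>z\<in>carrier H. \<forall>x\<in>carrier H. cinner K (T x) y = cinner H x z" if y: "y \<in> carrier K" for y
  proof (rule H.riesz_representation[OF H.complete])
    fix x assume x: "x \<in> carrier H"
    then show "cmod (cinner K (T x) y) \<le> hnorm K y * hnorm H x"
      using K.norm_cinner_le[of "T x" y] y T' by (simp add: mult.commute)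
  qed (use y T' in \<open>auto simp: K.cinner_add K.cinner_smult\<close>)
  then obtain T\<^sub>0 where "\<And>y. y \<in> carrier K \<Longrightarrow> T\<^sub>0 y \<in> carrier H"
    "\<And>x y. \<lbrakk>x \<in> carrier H; y \<in> carrier K\<rbrakk> \<Longrightarrow> cinner K (T x) y = cinner H x (T\<^sub>0 y)" by metis
  then have "\<exists>T'. T' \<in> carrier K \<rightarrow> carrier H \<and>
     (\<forall>x\<in>carrier H. \<forall>y\<in>carrier K. cinner K (T x) y = cinner H x (T' y))"
    by (intro exI[of _ T\<^sub>0]) auto
  then have spec: "hadjoint H K T \<in> carrier K \<rightarrow> carrier H \<and>
     (\<forall>x\<in>carrier H. \<forall>y\<in>carrier K. cinner K (T x) y = cinner H x (hadjoint H K T y))"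
    unfolding hadjoint_def by (rule someI_ex)
  then show closed: "hadjoint H K T y \<in> carrier H" if "y \<in> carrier K" for y
    using that by auto
  show adj: "cinner K (T x) y = cinner H x (hadjoint H K T y)" if "x \<in> carrier H" "y \<in> carrier K" for x y
    using that spec by auto
  show adj': "cinner K y (T x) = cinner H (hadjoint H K T y) x" if "x \<in> carrier H" "y \<in> carrier K" for x y
    using that adj[OF that] closed T'(1) K.cinner_commute[of "T x" y] H.cinner_commute[of x "hadjoint H K T y"]
    by simp
  show "hnorm H (hadjoint H K T y) \<le> hnorm K y" if y: "y \<in> carrier K" for y
  proof -
    define z where "z = hadjoint H K T y"
    have z: "z \<in> carrier H" using closed y by (simp add: z_def)
    have "(hnorm H z)\<^sup>2 = Re (cinner K (T z) y)"
      using adj[OF z y] z by (simp add: z_def H.hnorm_sq)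
    also have "\<dots> \<le> hnorm H z * hnorm K y"
      using K.Re_cinner_le[of "T z" y] T' z y by simp
    finally show ?thesis
      using z y H.hnorm_nonneg[OF z] K.hnorm_nonneg[OF y]
      by (cases "hnorm H z = 0") (auto simp: power2_eq_square simp flip: z_def)
  qed
  show "hadjoint H K T (T x) = x" if x: "x \<in> carrier H" for x
    using x T' closed by (intro H.cinner_eqI)
      (auto simp: linear_isometry_cinner[OF H.complex_inner_space_axioms K T] simp flip: adj')
qed

lemma linear_isometry_dense_range:
  assumes H: "complex_hilbert_space H" and K: "complex_inner_space K" and T: "linear_isometry H K T"
    and dense: "\<And>y r. \<lbrakk>y \<in> carrier K; 0 < r\<rbrakk> \<Longrightarrow> \<exists>x\<in>carrier H. hnorm K (y \<ominus>\<^bsub>K\<^esub> T x) < r"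
  shows "unitary_operator H K T"
proof -
  interpret H: complex_hilbert_space H by fact
  interpret K: complex_inner_space K by fact
  note T' = linear_isometryD[OF T] and adj = hadjoint_isometry[OF H K T]
  have "T (hadjoint H K T y) = y" if y: "y \<in> carrier K" for y
  proof -
    define z where "z = T (hadjoint H K T y)"
    have z: "z \<in> carrier K" using y adj T' by (simp add: z_def)
    have orth: "cinner K (y \<ominus>\<^bsub>K\<^esub> z) (T x) = 0" if x: "x \<in> carrier H" for x
      using x y z T'(1)[OF x] adj(1)[OF y] adj(3)[OF x y]
        linear_isometry_cinner[OF H.complex_inner_space_axioms K T adj(1)[OF y] x]
      by (simp add: K.cinner_diff z_def)
    have "hnorm K (y \<ominus>\<^bsub>K\<^esub> z) \<le> 0 + r" if "0 < r" for r
    proof -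
      obtain x where x: "x \<in> carrier H" "hnorm K (y \<ominus>\<^bsub>K\<^esub> T x) < r" using dense[OF y \<open>0 < r\<close>] by blast
      have "cinner K (y \<ominus>\<^bsub>K\<^esub> z) (y \<ominus>\<^bsub>K\<^esub> z) = cinner K (y \<ominus>\<^bsub>K\<^esub> z) (y \<ominus>\<^bsub>K\<^esub> T x)"
        using y z T'(1)[OF x(1)] orth[OF x(1)] orth[OF adj(1)[OF y]]
        by (simp add: K.cinner_diff_right flip: z_def)
      then have "(hnorm K (y \<ominus>\<^bsub>K\<^esub> z))\<^sup>2 \<le> hnorm K (y \<ominus>\<^bsub>K\<^esub> z) * hnorm K (y \<ominus>\<^bsub>K\<^esub> T x)"
        using K.Re_cinner_le[of "y \<ominus>\<^bsub>K\<^esub> z" "y \<ominus>\<^bsub>K\<^esub> T x"] y z x T' by (simp add: K.hnorm_sq)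
      then have "hnorm K (y \<ominus>\<^bsub>K\<^esub> z) \<le> hnorm K (y \<ominus>\<^bsub>K\<^esub> T x)"
        using y z x T' by (cases "hnorm K (y \<ominus>\<^bsub>K\<^esub> z) = 0") (auto simp: power2_eq_square less_le)
      with x show ?thesis by simp
    qed
    then have "hnorm K (y \<ominus>\<^bsub>K\<^esub> z) \<le> 0" by (rule field_le_epsilon)
    then have "hnorm K (y \<ominus>\<^bsub>K\<^esub> z) = 0"
      using y z by (intro antisym) auto
    then have "y = z" using K.hnorm_diff_eq_0[OF y z] by simp
    then show ?thesis by (simp add: z_def)
  qed
  then have "carrier K \<subseteq> T ` carrier H"
    using adj(1) by (metis image_eqI subsetI)
  then have "T ` carrier H = carrier K"
    using T'(1) by auto
  with T show ?thesis by (simp add: unitary_operator_def)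
qed

text \<open>The adjoint of an isometry is a left inverse; surjectivity makes it a right inverse
  too.\<close>

lemma unitary_operator_hadjoint:
  assumes "complex_hilbert_space H" "complex_inner_space K" "unitary_operator H K T" "y \<in> carrier K"
  shows "hadjoint H K T y \<in> carrier H" "T (hadjoint H K T y) = y"
proof -
  have T: "linear_isometry H K T" and "y \<in> T ` carrier H"
    using assms by (auto simp: unitary_operator_def)
  then obtain x where "x \<in> carrier H" "y = T x" by blast
  with hadjoint_isometry[OF assms(1,2) T] assms(4)
  show "hadjoint H K T y \<in> carrier H" "T (hadjoint H K T y) = y" by auto
qed

text \<open>The chosen adjoint is known only through its pairings with vectors of \<open>H\<close>,
  so linearity is tested there.\<close>

lemma hadjoint_linear:
  assumes H: "complex_hilbert_space H" and K: "complex_inner_space K" and T: "linear_isometry H K T"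
    and x: "x \<in> carrier K" and y: "y \<in> carrier K"
  shows "hadjoint H K T (x \<oplus>\<^bsub>K\<^esub> y) = hadjoint H K T x \<oplus>\<^bsub>H\<^esub> hadjoint H K T y"
    and "hadjoint H K T (a \<odot>\<^bsub>K\<^esub> x) = a \<odot>\<^bsub>H\<^esub> hadjoint H K T x"
proof -
  interpret H: complex_hilbert_space H by fact
  interpret K: complex_inner_space K by fact
  note adj = hadjoint_isometry[OF H K T] and T' = linear_isometryD[OF T]
  show "hadjoint H K T (x \<oplus>\<^bsub>K\<^esub> y) = hadjoint H K T x \<oplus>\<^bsub>H\<^esub> hadjoint H K T y"
    by (rule H.cinner_eqI)
      (use x y T' in \<open>simp_all add: adj(1) H.cinner_add K.cinner_add flip: adj(3)\<close>)
  show "hadjoint H K T (a \<odot>\<^bsub>K\<^esub> x) = a \<odot>\<^bsub>H\<^esub> hadjoint H K T x"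
    by (rule H.cinner_eqI)
      (use x y T' in \<open>simp_all add: adj(1) H.cinner_smult K.cinner_smult flip: adj(3)\<close>)
qed

lemma hadjoint_diff:
  assumes H: "complex_hilbert_space H" and K: "complex_inner_space K" and T: "linear_isometry H K T"
    and x: "x \<in> carrier K" and y: "y \<in> carrier K"
  shows "hadjoint H K T (x \<ominus>\<^bsub>K\<^esub> y) = hadjoint H K T x \<ominus>\<^bsub>H\<^esub> hadjoint H K T y"
proof -
  interpret H: complex_hilbert_space H by fact
  interpret K: complex_inner_space K by fact
  show ?thesis
    using hadjoint_linear[OF H K T] hadjoint_isometry(1)[OF H K T] x y
    by (simp add: H.minus_eq_smult K.minus_eq_smult)
qed

lemma unitary_operator_hadjoint_unitary:
  assumes H: "complex_hilbert_space H" and K: "complex_inner_space K" and T: "unitary_operator H K T"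
  shows "unitary_operator K H (hadjoint H K T)"
proof -
  have iso: "linear_isometry H K T" using T by (simp add: unitary_operator_def)
  note adj = hadjoint_isometry[OF H K iso] and inv = unitary_operator_hadjoint[OF H K T]
  have "hnorm H (hadjoint H K T x) = hnorm K x" if "x \<in> carrier K" for x
    using linear_isometryD(4)[OF iso inv(1)[OF that]] inv(2)[OF that] by simp
  then have "linear_isometry K H (hadjoint H K T)"
    unfolding linear_isometry_def using adj(1) hadjoint_linear[OF H K iso] by blast
  moreover have "hadjoint H K T ` carrier K = carrier H"
  proof
    show "carrier H \<subseteq> hadjoint H K T ` carrier K"
      using adj(5) linear_isometryD(1)[OF iso] by (metis image_eqI subsetI)
  qed (use adj(1) in blast)
  ultimately show ?thesis by (simp add: unitary_operator_def)
qed

lemma unitary_operator_compose: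
  assumes "unitary_operator H K T" "unitary_operator K L T'"
  shows "unitary_operator H L (\<lambda>x. T' (T x))"
proof -
  have iso: "linear_isometry H K T" "linear_isometry K L T'"
    and im: "T ` carrier H = carrier K" "T' ` carrier K = carrier L"
    using assms by (auto simp: unitary_operator_def)
  have "linear_isometry H L (\<lambda>x. T' (T x))"
    unfolding linear_isometry_def
    using linear_isometryD[OF iso(1)] linear_isometryD[OF iso(2)] by simp
  moreover have "(\<lambda>x. T' (T x)) ` carrier H = carrier L"
    using im by (metis image_image)
  ultimately show ?thesis by (simp add: unitary_operator_def)
qed


section \<open>Extension of multipliers and coboundaries\<close>

text \<open>\<open>P\<close> stands for the image of \<open>S\<close> in \<open>G\<close>, which
  keeps the embedding out of all computations. Left denominators are the form in which
  \<open>G = S\<^sup>-\<^sup>1 S\<close> enters.\<close>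

locale fraction_group = group G for G :: "('g, 'y) monoid_scheme" (structure) +
  fixes P :: "'g set"
  assumes P_subset: "P \<subseteq> carrier G"
    and P_mult: "\<lbrakk>s \<in> P; t \<in> P\<rbrakk> \<Longrightarrow> s \<otimes> t \<in> P"
    and P_denominator: "g \<in> carrier G \<Longrightarrow> \<exists>s\<in>P. s \<otimes> g \<in> P"
begin

lemma P_carrier [simp]: "s \<in> P \<Longrightarrow> s \<in> carrier G"
  using P_subset by blast

text \<open>A denominator \<open>a\<close> of \<open>s \<otimes> inv t\<close> turns the fraction
  into an element \<open>b\<close> of \<open>P\<close>.\<close>

lemma common_left_multiple:
  assumes "s \<in> P" "t \<in> P"
  obtains a b where "a \<in> P" "b \<in> P" "a \<otimes> s = b \<otimes> t"
proof -
  obtain a where a: "a \<in> P" "a \<otimes> (s \<otimes> inv t) \<in> P"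
    using P_denominator[of "s \<otimes> inv t"] assms by auto
  then have "a \<otimes> s = (a \<otimes> (s \<otimes> inv t)) \<otimes> t"
    using assms by (simp add: m_assoc)
  with a that show thesis by blast
qed

lemma P_denominator2:
  assumes "g \<in> carrier G" "h \<in> carrier G"
  obtains s where "s \<in> P" "s \<otimes> g \<in> P" "s \<otimes> h \<in> P"
proof -
  obtain a where a: "a \<in> P" "a \<otimes> g \<in> P" using P_denominator assms by blast
  obtain b where b: "b \<in> P" "b \<otimes> (a \<otimes> h) \<in> P" using P_denominator[of "a \<otimes> h"] a assms by auto
  show thesis
    by (rule that[of "b \<otimes> a"]) (use a b assms in \<open>auto simp: m_assoc P_mult\<close>)
qed

lemma P_denominator3:
  assumes "g \<in> carrier G" "h \<in> carrier G" "k \<in> carrier G"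
  obtains s where "s \<in> P" "s \<otimes> g \<in> P" "s \<otimes> h \<in> P" "s \<otimes> k \<in> P"
proof -
  obtain a where a: "a \<in> P" "a \<otimes> g \<in> P" "a \<otimes> h \<in> P" using P_denominator2[OF assms(1,2)] .
  obtain b where b: "b \<in> P" "b \<otimes> (a \<otimes> k) \<in> P" using P_denominator[of "a \<otimes> k"] a assms by auto
  show thesis
    by (rule that[of "b \<otimes> a"]) (use a b assms in \<open>auto simp: m_assoc P_mult\<close>)
qed

text \<open>The tool for all independence of denominators: \<open>D\<close> is the set of admissible
  denominators, and both values equal the value of \<open>F\<close> at a common left
  multiple.\<close>

lemma invariant_imp_constant:
  assumes "D \<subseteq> P" and "\<And>s t. \<lbrakk>s \<in> D; t \<in> P\<rbrakk> \<Longrightarrow> F (t \<otimes> s) = F s"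
    and "s \<in> D" "s' \<in> D"
  shows "F s = F s'"
proof -
  obtain a b where "a \<in> P" "b \<in> P" "a \<otimes> s = b \<otimes> s'"
    using common_left_multiple[OF subsetD[OF assms(1,3)] subsetD[OF assms(1,4)]] .
  then show ?thesis using assms(2)[of s a] assms(2)[of s' b] assms by metis
qed

text \<open>Any two elements of \<open>D\<close> have a common left multiple, so the value of \<open>\<phi>\<close> at one point \<open>p\<close>
  determines \<open>\<phi>\<close>: if \<open>a \<otimes> s = b \<otimes> p\<close> then \<open>\<phi> s = c b p / c a s\<close>.\<close>

lemma cocycle_trivialization:
  fixes c :: "'g \<Rightarrow> 'g \<Rightarrow> complex"
  assumes D: "D \<subseteq> P" "\<And>s t. \<lbrakk>s \<in> D; t \<in> P\<rbrakk> \<Longrightarrow> t \<otimes> s \<in> D" "p \<in> D"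
    and unit: "\<And>s t. \<lbrakk>s \<in> D; t \<in> P\<rbrakk> \<Longrightarrow> norm (c t s) = 1"
    and cocycle: "\<And>s t a. \<lbrakk>s \<in> D; t \<in> P; a \<in> P\<rbrakk> \<Longrightarrow> c (a \<otimes> t) s = c a (t \<otimes> s) * c t s"
  obtains \<phi> where "\<And>s. s \<in> D \<Longrightarrow> norm (\<phi> s) = 1"
    "\<And>s t. \<lbrakk>s \<in> D; t \<in> P\<rbrakk> \<Longrightarrow> \<phi> (t \<otimes> s) = c t s * \<phi> s"
proof -
  have nz: "c t s \<noteq> 0" if "s \<in> D" "t \<in> P" for s t
    using unit[OF that] by auto
  have eq: "c b p / c a s = c b' p / c a' s"
    if s: "s \<in> D" and ab: "a \<in> P" "b \<in> P" "a \<otimes> s = b \<otimes> p"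
      and ab': "a' \<in> P" "b' \<in> P" "a' \<otimes> s = b' \<otimes> p" for s a b a' b'
  proof -
    have G: "s \<in> carrier G" "p \<in> carrier G" using D s by auto
    obtain u v where uv: "u \<in> P" "v \<in> P" "u \<otimes> a = v \<otimes> a'"
      using common_left_multiple[OF ab(1) ab'(1)] .
    have closed: "u \<otimes> b \<in> carrier G" "v \<otimes> b' \<in> carrier G"
      using uv ab(2) ab'(2) by simp_all
    have "(u \<otimes> b) \<otimes> p = (u \<otimes> a) \<otimes> s"
      using uv(1) ab G by (simp add: m_assoc)
    also have "\<dots> = (v \<otimes> a') \<otimes> s" using uv by simp
    also have "\<dots> = (v \<otimes> b') \<otimes> p"
      using uv(2) ab' G by (simp add: m_assoc)
    finally have uvb: "u \<otimes> b = v \<otimes> b'"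
      using right_cancel[OF G(2) closed] by simp
    \<comment> \<open>By the cocycle rule numerator and denominator gain the same factor, because
      \<open>a \<otimes> s = b \<otimes> p\<close>.\<close>
    have "c (u \<otimes> b) p / c (u \<otimes> a) s = c b p / c a s"
      using cocycle[OF D(3) ab(2) uv(1)] cocycle[OF s ab(1) uv(1)] ab nz[OF D(2)[OF s ab(1)] uv(1)] by simp
    moreover have "c (v \<otimes> b') p / c (v \<otimes> a') s = c b' p / c a' s"
      using cocycle[OF D(3) ab'(2) uv(2)] cocycle[OF s ab'(1) uv(2)] ab' nz[OF D(2)[OF s ab'(1)] uv(2)] by simp
    ultimately show ?thesis using uv uvb by simp
  qed
  have "\<exists>a b. a \<in> P \<and> b \<in> P \<and> a \<otimes> s = b \<otimes> p" if "s \<in> D" for s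
    using D(1,3) that by (meson common_left_multiple subsetD)
  then obtain \<alpha> \<beta> where \<alpha>\<beta>: "\<And>s. s \<in> D \<Longrightarrow> \<alpha> s \<in> P \<and> \<beta> s \<in> P \<and> \<alpha> s \<otimes> s = \<beta> s \<otimes> p"
    by metis
  show thesis
  proof (rule that[of "\<lambda>s. c (\<beta> s) p / c (\<alpha> s) s"])
    show "norm (c (\<beta> s) p / c (\<alpha> s) s) = 1" if "s \<in> D" for s
      using \<alpha>\<beta>[OF that] unit D that by (simp add: norm_divide)
  next
    fix s t assume s: "s \<in> D" and t: "t \<in> P"
    define a b where "a = \<alpha> (t \<otimes> s)" and "b = \<beta> (t \<otimes> s)"
    have ab: "a \<in> P" "b \<in> P" "a \<otimes> (t \<otimes> s) = b \<otimes> p"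
      using \<alpha>\<beta>[OF D(2)[OF s t]] by (auto simp: a_def b_def)
    have G: "s \<in> carrier G" using D s by auto
    \<comment> \<open>A pair chosen for \<open>t \<otimes> s\<close> also serves \<open>s\<close>,
      with \<open>a \<otimes> t\<close> in place of \<open>a\<close>.\<close>
    have "c (\<beta> s) p / c (\<alpha> s) s = c b p / c (a \<otimes> t) s"
      using \<alpha>\<beta>[OF s] s ab t G by (intro eq) (auto simp: P_mult m_assoc)
    then show "c (\<beta> (t \<otimes> s)) p / c (\<alpha> (t \<otimes> s)) (t \<otimes> s) = c t s * (c (\<beta> s) p / c (\<alpha> s) s)"
      using cocycle[OF s t ab(1)] nz[OF s t] by (simp flip: a_def b_def)
  qed
qed

text \<open>The function \<open>\<phi>\<^sub>g\<close> plays the part of \<open>s \<mapsto> \<mu> (s, g)\<close>; it is only defined for those \<open>s\<close>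
  with \<open>s \<otimes> g \<in> P\<close>.\<close>

lemma multiplier_extension:
  fixes \<omega> :: "'g \<Rightarrow> 'g \<Rightarrow> complex"
  assumes unit: "\<And>s t. \<lbrakk>s \<in> P; t \<in> P\<rbrakk> \<Longrightarrow> norm (\<omega> s t) = 1"
    and cocycle: "\<And>r s t. \<lbrakk>r \<in> P; s \<in> P; t \<in> P\<rbrakk> \<Longrightarrow> \<omega> r s * \<omega> (r \<otimes> s) t = \<omega> r (s \<otimes> t) * \<omega> s t"
  obtains \<mu> where "\<mu> \<in> multipliers G" "\<And>s t. \<lbrakk>s \<in> P; t \<in> P\<rbrakk> \<Longrightarrow> \<mu> (s, t) = \<omega> s t"
proof -
  have nz: "\<omega> s t \<noteq> 0" if "s \<in> P" "t \<in> P" for s t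
    using unit[OF that] by auto
  define D where "D g = {s \<in> P. s \<otimes> g \<in> P}" for g
  have D_P: "D g \<subseteq> P" for g
    by (auto simp: D_def)
  have D_mult: "t \<otimes> s \<in> D g" if "g \<in> carrier G" "s \<in> D g" "t \<in> P" for g s t
    using that by (auto simp: D_def P_mult m_assoc)
  have "\<exists>\<phi>. (\<forall>s\<in>D g. norm (\<phi> s) = 1) \<and>
      (\<forall>s\<in>D g. \<forall>t\<in>P. \<omega> t s * \<phi> (t \<otimes> s) = \<omega> t (s \<otimes> g) * \<phi> s) \<and>
      (g \<in> P \<longrightarrow> (\<forall>s\<in>P. \<phi> s = \<omega> s g))" if g: "g \<in> carrier G" for g
  \<comment> \<open>For \<open>g\<close> in \<open>P\<close> the function is prescribed, not chosen:
    this makes \<open>\<mu>\<close> agree with \<open>\<omega>\<close> on \<open>P\<close>.\<close>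
  proof (cases "g \<in> P")
    case True
    then show ?thesis
      using unit cocycle by (intro exI[of _ "\<lambda>s. \<omega> s g"]) (auto simp: D_def)
  next
    case False
    obtain p where p: "p \<in> D g" using P_denominator[OF g] by (auto simp: D_def)
    define c where "c t s = \<omega> t (s \<otimes> g) / \<omega> t s" for t s
    have "c (a \<otimes> t) s = c a (t \<otimes> s) * c t s" if "s \<in> D g" "t \<in> P" "a \<in> P" for s t a
    proof -
      have "s \<in> P" "s \<otimes> g \<in> P" "t \<otimes> (s \<otimes> g) \<in> P" "t \<otimes> s \<in> P" "a \<otimes> t \<in> P"
        using that P_mult by (auto simp: D_def)
      moreover note nz
      moreover have "\<omega> a t * \<omega> (a \<otimes> t) s = \<omega> a (t \<otimes> s) * \<omega> t s"
        "\<omega> a t * \<omega> (a \<otimes> t) (s \<otimes> g) = \<omega> a (t \<otimes> (s \<otimes> g)) * \<omega> t (s \<otimes> g)"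
        using that cocycle by (auto simp: D_def)
      then have "\<omega> (a \<otimes> t) s = \<omega> a (t \<otimes> s) * \<omega> t s / \<omega> a t"
        "\<omega> (a \<otimes> t) (s \<otimes> g) = \<omega> a (t \<otimes> (s \<otimes> g)) * \<omega> t (s \<otimes> g) / \<omega> a t"
        using nz[of a t] that by (auto simp: field_simps)
      ultimately show ?thesis
        using that g by (simp add: c_def m_assoc)
    qed
    moreover have "norm (c t s) = 1" if "s \<in> D g" "t \<in> P" for s t
      using that unit by (auto simp: c_def D_def norm_divide)
    ultimately obtain \<phi> where "\<And>s. s \<in> D g \<Longrightarrow> norm (\<phi> s) = 1"
      and \<phi>: "\<And>s t. \<lbrakk>s \<in> D g; t \<in> P\<rbrakk> \<Longrightarrow> \<phi> (t \<otimes> s) = c t s * \<phi> s"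
      using cocycle_trivialization[OF D_P D_mult[OF g] p, of c] by blast
    moreover have "\<omega> t s * \<phi> (t \<otimes> s) = \<omega> t (s \<otimes> g) * \<phi> s" if "s \<in> D g" "t \<in> P" for s t
      using \<phi>[OF that] that nz[of t s] by (simp add: c_def D_def)
    ultimately show ?thesis using False by (intro exI[of _ \<phi>]) simp
  qed
  then obtain \<phi> where \<phi>_unit: "\<And>g s. \<lbrakk>g \<in> carrier G; s \<in> D g\<rbrakk> \<Longrightarrow> norm (\<phi> g s) = 1"
    and \<phi>_mult: "\<And>g s t. \<lbrakk>g \<in> carrier G; s \<in> D g; t \<in> P\<rbrakk> \<Longrightarrow>
      \<omega> t s * \<phi> g (t \<otimes> s) = \<omega> t (s \<otimes> g) * \<phi> g s"
    and \<phi>_P: "\<And>g s. \<lbrakk>g \<in> P; s \<in> P\<rbrakk> \<Longrightarrow> \<phi> g s = \<omega> s g"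
    by (metis P_carrier)
  have \<phi>_nz: "\<phi> g s \<noteq> 0" if "g \<in> carrier G" "s \<in> D g" for g s
    using \<phi>_unit[OF that] by auto
  define \<rho> where "\<rho> g h s = \<phi> g s * \<phi> h (s \<otimes> g) / \<phi> (g \<otimes> h) s" for g h s
  \<comment> \<open>The points at which all three factors of \<open>\<rho> g h\<close> are
    controlled.\<close>
  define E where "E g h = {s \<in> P. s \<otimes> g \<in> P \<and> s \<otimes> (g \<otimes> h) \<in> P}" for g h
  define \<mu> where "\<mu> = (\<lambda>(g, h)\<in>carrier G \<times> carrier G. \<rho> g h (SOME s. s \<in> E g h))"
  have E_D: "s \<in> D g" "s \<otimes> g \<in> D h" "s \<in> D (g \<otimes> h)"
    if "s \<in> E g h" "g \<in> carrier G" "h \<in> carrier G" for s g h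
    using that by (auto simp: E_def D_def m_assoc)
  \<comment> \<open>Passing from \<open>s\<close> to \<open>t \<otimes> s\<close> changes the three
    factors by quotients of \<open>\<omega> t s\<close>, \<open>\<omega> t (s \<otimes> g)\<close>
    and \<open>\<omega> t (s \<otimes> (g \<otimes> h))\<close>, which telescope.\<close>
  have \<rho>_mult: "\<rho> g h (t \<otimes> s) = \<rho> g h s"
    if gh: "g \<in> carrier G" "h \<in> carrier G" and s: "s \<in> E g h" and t: "t \<in> P" for g h s t
  proof -
    note D = E_D[OF s gh]
    have sP: "s \<in> P" "s \<otimes> g \<in> P" "s \<otimes> (g \<otimes> h) \<in> P" using s by (auto simp: E_def)
    have "\<phi> g (t \<otimes> s) = \<omega> t (s \<otimes> g) * \<phi> g s / \<omega> t s"
      using \<phi>_mult[OF gh(1) D(1) t] nz[of t s] sP t by (simp add: field_simps)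
    moreover have "\<phi> h (t \<otimes> s \<otimes> g) = \<omega> t (s \<otimes> (g \<otimes> h)) * \<phi> h (s \<otimes> g) / \<omega> t (s \<otimes> g)"
      using \<phi>_mult[OF gh(2) D(2) t] nz[of t "s \<otimes> g"] sP t gh by (simp add: field_simps m_assoc)
    moreover have "\<phi> (g \<otimes> h) (t \<otimes> s) = \<omega> t (s \<otimes> (g \<otimes> h)) * \<phi> (g \<otimes> h) s / \<omega> t s"
      using \<phi>_mult[OF m_closed[OF gh] D(3) t] nz[of t s] sP t by (simp add: field_simps)
    ultimately show ?thesis
      using nz[OF t sP(1)] nz[OF t sP(2)] nz[OF t sP(3)] by (simp add: \<rho>_def)
  qed
  have \<mu>_eq: "\<mu> (g, h) * \<phi> (g \<otimes> h) s = \<phi> g s * \<phi> h (s \<otimes> g)"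
    if gh: "g \<in> carrier G" "h \<in> carrier G" and s: "s \<in> E g h" for g h s
  proof -
    have "\<rho> g h (SOME s. s \<in> E g h) = \<rho> g h s"
      by (rule invariant_imp_constant[of "E g h" "\<rho> g h"])
        (use gh s \<rho>_mult in \<open>auto simp: E_def intro: someI2\<close>)
    then have "\<mu> (g, h) = \<rho> g h s" using gh by (simp add: \<mu>_def)
    then show ?thesis using \<phi>_nz[OF m_closed[OF gh] E_D(3)[OF s gh]] by (simp add: \<rho>_def)
  qed
  have E_ex: "\<exists>s. s \<in> E g h" if gh: "g \<in> carrier G" "h \<in> carrier G" for g h
  proof -
    obtain s where "s \<in> P" "s \<otimes> g \<in> P" "s \<otimes> (g \<otimes> h) \<in> P"
      using P_denominator2[OF gh(1) m_closed[OF gh]] .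
    then show ?thesis by (auto simp: E_def)
  qed
  have \<mu>_unit: "norm (\<mu> (g, h)) = 1" if gh: "g \<in> carrier G" "h \<in> carrier G" for g h
  proof -
    obtain s where s: "s \<in> E g h" using E_ex[OF gh] by blast
    show ?thesis
      using arg_cong[OF \<mu>_eq[OF gh s], of norm] \<phi>_unit E_D[OF s gh] gh
      by (simp add: norm_mult)
  qed
  have "\<mu> \<in> carrier G \<times> carrier G \<rightarrow>\<^sub>E sphere 0 1"
  proof (rule PiE_I)
    fix x assume "x \<in> carrier G \<times> carrier G"
    then show "\<mu> x \<in> sphere 0 1" using \<mu>_unit by (cases x) simp
  next
    fix x assume "x \<notin> carrier G \<times> carrier G"
    then show "\<mu> x = undefined" unfolding \<mu>_def by (rule restrict_apply[THEN trans, OF if_not_P])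
  qed
  moreover have "\<mu> (g, h) * \<mu> (g \<otimes> h, k) = \<mu> (g, h \<otimes> k) * \<mu> (h, k)"
    if ghk: "g \<in> carrier G" "h \<in> carrier G" "k \<in> carrier G" for g h k
  proof -
    \<comment> \<open>One denominator for the whole triple: the four values of \<open>\<mu>\<close>
      can then be compared at \<open>s\<close> and \<open>s \<otimes> g\<close>.\<close>
    obtain s where s: "s \<in> P" "s \<otimes> g \<in> P" "s \<otimes> (g \<otimes> h) \<in> P" "s \<otimes> (g \<otimes> (h \<otimes> k)) \<in> P"
      using P_denominator3[OF ghk(1) m_closed[OF ghk(1,2)] m_closed[OF ghk(1) m_closed[OF ghk(2,3)]]] .
    have "\<mu> (g, h) * \<phi> (g \<otimes> h) s = \<phi> g s * \<phi> h (s \<otimes> g)"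
      using s ghk by (intro \<mu>_eq) (auto simp: E_def)
    moreover have "\<mu> (g \<otimes> h, k) * \<phi> (g \<otimes> (h \<otimes> k)) s = \<phi> (g \<otimes> h) s * \<phi> k (s \<otimes> (g \<otimes> h))"
      using s ghk \<mu>_eq[of "g \<otimes> h" k s] by (auto simp: E_def m_assoc)
    moreover have "\<mu> (g, h \<otimes> k) * \<phi> (g \<otimes> (h \<otimes> k)) s = \<phi> g s * \<phi> (h \<otimes> k) (s \<otimes> g)"
      using s ghk \<mu>_eq[of g "h \<otimes> k" s] by (auto simp: E_def m_assoc)
    moreover have "\<mu> (h, k) * \<phi> (h \<otimes> k) (s \<otimes> g) = \<phi> h (s \<otimes> g) * \<phi> k (s \<otimes> (g \<otimes> h))"
      using s ghk \<mu>_eq[of h k "s \<otimes> g"] by (auto simp: E_def m_assoc)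
    \<comment> \<open>The four relations multiplied together; \<open>p * r * q\<close> collects the
      nonzero values of \<open>\<phi>\<close> that are cancelled afterwards.\<close>
    moreover have "(k * l) * (p * r * q) = (m * n) * (p * r * q)"
      if "k * p = x * y" "l * r = p * z" "m * r = x * q" "n * q = y * z"
      for k l m n p q r x y z :: complex
    proof -
      have "(k * l) * (p * r * q) = (k * p) * (l * r) * q" by (simp add: mult_ac)
      also have "\<dots> = (x * q) * (y * z) * p" by (simp add: that mult_ac)
      also have "\<dots> = (m * r) * (n * q) * p" by (simp only: that)
      finally show ?thesis by (simp add: mult_ac)
    qed
    ultimately have "(\<mu> (g, h) * \<mu> (g \<otimes> h, k)) * (\<phi> (g \<otimes> h) s * \<phi> (g \<otimes> (h \<otimes> k)) s * \<phi> (h \<otimes> k) (s \<otimes> g))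
       = (\<mu> (g, h \<otimes> k) * \<mu> (h, k)) * (\<phi> (g \<otimes> h) s * \<phi> (g \<otimes> (h \<otimes> k)) s * \<phi> (h \<otimes> k) (s \<otimes> g))"
      by blast
    moreover have "\<phi> (g \<otimes> h) s \<noteq> 0" "\<phi> (g \<otimes> (h \<otimes> k)) s \<noteq> 0" "\<phi> (h \<otimes> k) (s \<otimes> g) \<noteq> 0"
      by (rule \<phi>_nz; use s ghk in \<open>simp add: D_def m_assoc\<close>)+
    ultimately show ?thesis by simp
  qed
  ultimately have "\<mu> \<in> multipliers G" unfolding multipliers_def by blast
  moreover have "\<mu> (s, t) = \<omega> s t" if st: "s \<in> P" "t \<in> P" for s t
  proof -
    \<comment> \<open>Every element of \<open>P\<close> is an admissible denominator here;
      \<open>s\<close> itself is taken. All values of \<open>\<phi>\<close> are then prescribed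
      ones.\<close>
    have "\<mu> (s, t) * \<phi> (s \<otimes> t) s = \<phi> s s * \<phi> t (s \<otimes> s)"
      using st by (intro \<mu>_eq) (auto simp: E_def P_mult)
    then have "\<mu> (s, t) * \<omega> s (s \<otimes> t) = \<omega> s t * \<omega> s (s \<otimes> t)"
      using cocycle[OF st(1) st] st by (simp add: \<phi>_P P_mult mult.commute)
    then show ?thesis using nz[OF st(1) P_mult[OF st]] by simp
  qed
  ultimately show thesis by (rule that)
qed

text \<open>The extended cochain is forced by the coboundary equation at \<open>(s, g)\<close> with
  \<open>s\<close> and \<open>s \<otimes> g\<close> in \<open>P\<close>. On cohomology the lemma
  gives injectivity of restriction.\<close>

lemma coboundary_extension:
  assumes \<mu>: "\<mu> \<in> multipliers G" and f: "\<And>s. s \<in> P \<Longrightarrow> norm (f s) = 1"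
    and eq: "\<And>s t. \<lbrakk>s \<in> P; t \<in> P\<rbrakk> \<Longrightarrow> \<mu> (s, t) = f s * f t * cnj (f (s \<otimes> t))"
  shows "\<mu> \<in> coboundaries G"
proof -
  have unit: "norm (\<mu> (g, h)) = 1" if "g \<in> carrier G" "h \<in> carrier G" for g h
    using \<mu> that by (auto simp: multipliers_def PiE_iff)
  have cocycle: "\<mu> (g, h) * \<mu> (g \<otimes> h, k) = \<mu> (g, h \<otimes> k) * \<mu> (h, k)"
    if "g \<in> carrier G" "h \<in> carrier G" "k \<in> carrier G" for g h k
    using \<mu> that by (auto simp: multipliers_def)
  have nz: "\<mu> (g, h) \<noteq> 0" if "g \<in> carrier G" "h \<in> carrier G" for g h
    using unit[OF that] by auto
  have f_nz: "f s \<noteq> 0" if "s \<in> P" for s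
    using f[OF that] by auto
  have eq': "\<mu> (s, t) * f (s \<otimes> t) = f s * f t" if "s \<in> P" "t \<in> P" for s t
    using eq[OF that] cnj_unit[OF f[OF P_mult[OF that]]] by (simp add: mult_ac)
  define D where "D g = {s \<in> P. s \<otimes> g \<in> P}" for g
  define F where "F g s = f (s \<otimes> g) * \<mu> (s, g) / f s" for g s
  define f' where "f' g = F g (SOME s. s \<in> D g)" for g
  \<comment> \<open>The coboundary equations at \<open>(t, s \<otimes> g)\<close> and
    \<open>(t, s)\<close>, together with the cocycle identity at \<open>(t, s, g)\<close>, cancel
    every occurrence of \<open>t\<close>.\<close>
  have F_mult: "F g (t \<otimes> s) = F g s" if g: "g \<in> carrier G" and s: "s \<in> D g" and t: "t \<in> P" for g s t
  proof -
    have sP: "s \<in> P" "s \<otimes> g \<in> P" using s by (auto simp: D_def)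
    have "\<mu> (t, s \<otimes> g) * f (t \<otimes> (s \<otimes> g)) = f t * f (s \<otimes> g)" "\<mu> (t, s) * f (t \<otimes> s) = f t * f s"
      "\<mu> (t, s) * \<mu> (t \<otimes> s, g) = \<mu> (t, s \<otimes> g) * \<mu> (s, g)"
      using eq' sP t cocycle g by auto
    moreover have "x * c * z * (a * b * u) = v * d * y * (a * b * u)"
      if "a * x = u * v" "b * y = u * z" "b * c = a * d" for a b c d x y z u v :: complex
    proof -
      have "x * c * z * (a * b * u) = (a * x) * (b * c) * z * u" by (simp add: mult_ac)
      also have "\<dots> = v * d * a * u * (b * y)" by (simp add: that mult_ac)
      finally show ?thesis by (simp add: mult_ac)
    qed
    ultimately have "f (t \<otimes> (s \<otimes> g)) * \<mu> (t \<otimes> s, g) * f s * (\<mu> (t, s \<otimes> g) * \<mu> (t, s) * f t)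
        = f (s \<otimes> g) * \<mu> (s, g) * f (t \<otimes> s) * (\<mu> (t, s \<otimes> g) * \<mu> (t, s) * f t)"
      by blast
    then have "f (t \<otimes> (s \<otimes> g)) * \<mu> (t \<otimes> s, g) * f s = f (s \<otimes> g) * \<mu> (s, g) * f (t \<otimes> s)"
      using nz[of t "s \<otimes> g"] nz[of t s] f_nz[of t] sP t by simp
    then show ?thesis
      using f_nz[of s] f_nz[of "t \<otimes> s"] sP t g by (simp add: F_def m_assoc P_mult frac_eq_eq)
  qed
  have f'_eq: "f' g * f s = f (s \<otimes> g) * \<mu> (s, g)" if g: "g \<in> carrier G" and s: "s \<in> D g" for g s
  proof -
    have "F g (SOME s. s \<in> D g) = F g s"
      by (rule invariant_imp_constant[of "D g" "F g"])
        (use g s F_mult in \<open>auto simp: D_def intro: someI2\<close>)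
    then show ?thesis using f_nz[of s] s by (simp add: f'_def F_def D_def)
  qed
  have f'_unit: "norm (f' g) = 1" if g: "g \<in> carrier G" for g
  proof -
    obtain s where s: "s \<in> D g" using P_denominator[OF g] by (auto simp: D_def)
    show ?thesis
      using arg_cong[OF f'_eq[OF g s], of norm] f unit g s by (simp add: D_def norm_mult)
  qed
  have "\<mu> (g, h) = f' g * f' h * cnj (f' (g \<otimes> h))" if gh: "g \<in> carrier G" "h \<in> carrier G" for g h
  proof -
    obtain s where s: "s \<in> P" "s \<otimes> g \<in> P" "s \<otimes> (g \<otimes> h) \<in> P"
      using P_denominator2[OF gh(1) m_closed[OF gh]] .
    have "f' g * f s = f (s \<otimes> g) * \<mu> (s, g)"
      "f' h * f (s \<otimes> g) = f (s \<otimes> (g \<otimes> h)) * \<mu> (s \<otimes> g, h)"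
      "f' (g \<otimes> h) * f s = f (s \<otimes> (g \<otimes> h)) * \<mu> (s, g \<otimes> h)"
      "\<mu> (s, g) * \<mu> (s \<otimes> g, h) = \<mu> (s, g \<otimes> h) * \<mu> (g, h)"
      using s gh f'_eq[of g s] f'_eq[of h "s \<otimes> g"] f'_eq[of "g \<otimes> h" s] cocycle
      by (auto simp: D_def m_assoc)
    moreover have "w * r * (n * x * z * y) = p * q * (n * x * z * y)"
      if "p * z = x * k" "q * x = y * l" "r * z = y * n" "k * l = n * w"
      for k l n p q r w x y z :: complex
    proof -
      have "w * r * (n * x * z * y) = (n * w) * (r * z) * x * y" by (simp add: mult_ac)
      also have "\<dots> = (x * k) * (y * l) * n * y" by (simp add: that mult_ac flip: that(4))
      also have "\<dots> = (p * z) * (q * x) * n * y" by (simp add: that mult_ac)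
      finally show ?thesis by (simp add: mult_ac)
    qed
    ultimately have "\<mu> (g, h) * f' (g \<otimes> h) * (\<mu> (s, g \<otimes> h) * f (s \<otimes> g) * f s * f (s \<otimes> (g \<otimes> h)))
        = f' g * f' h * (\<mu> (s, g \<otimes> h) * f (s \<otimes> g) * f s * f (s \<otimes> (g \<otimes> h)))"
      by blast
    then have "\<mu> (g, h) * f' (g \<otimes> h) = f' g * f' h"
      using nz[of s "g \<otimes> h"] f_nz s gh by simp
    then have "\<mu> (g, h) * (f' (g \<otimes> h) * cnj (f' (g \<otimes> h))) = f' g * f' h * cnj (f' (g \<otimes> h))"
      by (simp add: mult.assoc[symmetric])
    then show ?thesis using cnj_unit[OF f'_unit[OF m_closed[OF gh]]] by simp
  qed
  then show ?thesis
    using \<mu> f'_unit by (auto simp: coboundaries_def intro!: bexI[of _ f'])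
qed

end

section \<open>Multipliers and cohomology of \<open>S\<close> itself\<close>

locale ore_envelope = ore_semigroup S + enveloping_group S G \<iota>
  for S :: "('s, 'x) monoid_scheme" and G :: "('g, 'y) monoid_scheme" and \<iota> :: "'s \<Rightarrow> 'g"
begin

lemma \<iota>_carrier [simp]: "s \<in> carrier S \<Longrightarrow> \<iota> s \<in> carrier G"
  using embedding_hom by (auto simp: hom_def)

lemma \<iota>_mult [simp]:
  "\<lbrakk>s \<in> carrier S; t \<in> carrier S\<rbrakk> \<Longrightarrow> \<iota> (s \<otimes>\<^bsub>S\<^esub> t) = \<iota> s \<otimes>\<^bsub>G\<^esub> \<iota> t"
  using embedding_hom by (auto simp: hom_def)

sublocale fraction_group G "\<iota> ` carrier S"
proof
  show "x \<otimes>\<^bsub>G\<^esub> y \<in> \<iota> ` carrier S" if "x \<in> \<iota> ` carrier S" "y \<in> \<iota> ` carrier S" for x y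
    using that ore_semigroup.m_closed[OF ore_semigroup_axioms] by (auto simp flip: \<iota>_mult)
  fix g assume "g \<in> carrier G"
  then obtain s t where st: "s \<in> carrier S" "t \<in> carrier S" "g = inv\<^bsub>G\<^esub> \<iota> s \<otimes>\<^bsub>G\<^esub> \<iota> t"
    using carrier_fractions by auto
  then have "\<iota> s \<otimes>\<^bsub>G\<^esub> g = \<iota> t"
    by (simp add: m_assoc[symmetric])
  with st show "\<exists>x\<in>\<iota> ` carrier S. x \<otimes>\<^bsub>G\<^esub> g \<in> \<iota> ` carrier S" by auto
qed auto

lemma S_closed: "\<lbrakk>s \<in> carrier S; t \<in> carrier S\<rbrakk> \<Longrightarrow> s \<otimes>\<^bsub>S\<^esub> t \<in> carrier S"
  by (rule ore_semigroup.m_closed[OF ore_semigroup_axioms])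

abbreviation res :: "('g \<times> 'g \<Rightarrow> complex) \<Rightarrow> 's \<times> 's \<Rightarrow> complex" where
  "res \<equiv> restrict_multiplier S \<iota>"

lemma res_multiplier: "\<mu> \<in> multipliers G \<Longrightarrow> res \<mu> \<in> multipliers S"
  by (simp add: multipliers_def restrict_multiplier_def PiE_iff S_closed split: prod.splits)

lemma res_surj:
  assumes "w \<in> multipliers S"
  shows "\<exists>\<mu>\<in>multipliers G. res \<mu> = w"
proof -
  define j where "j = inv_into (carrier S) \<iota>"
  have j: "j (\<iota> s) = s" if "s \<in> carrier S" for s
    using that embedding_inj by (simp add: j_def)
  have j_mult: "j (\<iota> s \<otimes>\<^bsub>G\<^esub> \<iota> t) = s \<otimes>\<^bsub>S\<^esub> t" if "s \<in> carrier S" "t \<in> carrier S" for s t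
    using j[OF S_closed[OF that]] that by simp
  obtain \<mu> where \<mu>: "\<mu> \<in> multipliers G"
    "\<And>x y. \<lbrakk>x \<in> \<iota> ` carrier S; y \<in> \<iota> ` carrier S\<rbrakk> \<Longrightarrow> \<mu> (x, y) = w (j x, j y)"
    by (rule multiplier_extension[of "\<lambda>x y. w (j x, j y)"])
      (use assms in \<open>auto simp: multipliers_def PiE_iff j j_mult\<close>)
  have "res \<mu> = w"
  proof (rule extensionalityI)
    show "w \<in> extensional (carrier S \<times> carrier S)" using assms by (auto simp: multipliers_def PiE_iff)
  qed (auto simp: restrict_multiplier_def \<mu>(2) j)
  with \<mu> show ?thesis by blast
qed

text \<open>Right to left, restriction descends to cohomology classes; left to right, the induced
  map is injective.\<close>

lemma res_coboundary_iff:
  assumes \<mu>: "\<mu> \<in> multipliers G"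
  shows "res \<mu> \<in> coboundaries S \<longleftrightarrow> \<mu> \<in> coboundaries G"
proof
  assume "\<mu> \<in> coboundaries G"
  then obtain f where f: "f \<in> carrier G \<rightarrow> sphere 0 1"
    "\<And>g h. \<lbrakk>g \<in> carrier G; h \<in> carrier G\<rbrakk> \<Longrightarrow> \<mu> (g, h) = f g * f h * cnj (f (g \<otimes>\<^bsub>G\<^esub> h))"
    unfolding coboundaries_def by blast
  have "f \<circ> \<iota> \<in> carrier S \<rightarrow> sphere 0 1"
    using f(1) by (simp add: Pi_iff)
  moreover have "res \<mu> (s, t) = (f \<circ> \<iota>) s * (f \<circ> \<iota>) t * cnj ((f \<circ> \<iota>) (s \<otimes>\<^bsub>S\<^esub> t))"
    if "s \<in> carrier S" "t \<in> carrier S" for s t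
    using that by (simp add: restrict_multiplier_def f(2))
  ultimately show "res \<mu> \<in> coboundaries S"
    unfolding coboundaries_def using res_multiplier[OF \<mu>] by blast
next
  assume "res \<mu> \<in> coboundaries S"
  then obtain f where f: "f \<in> carrier S \<rightarrow> sphere 0 1"
    "\<And>s t. \<lbrakk>s \<in> carrier S; t \<in> carrier S\<rbrakk> \<Longrightarrow> res \<mu> (s, t) = f s * f t * cnj (f (s \<otimes>\<^bsub>S\<^esub> t))"
    unfolding coboundaries_def by blast
  define j where "j = inv_into (carrier S) \<iota>"
  have j: "j (\<iota> s) = s" if "s \<in> carrier S" for s
    using that embedding_inj by (simp add: j_def)
  have j_mult: "j (\<iota> s \<otimes>\<^bsub>G\<^esub> \<iota> t) = s \<otimes>\<^bsub>S\<^esub> t" if "s \<in> carrier S" "t \<in> carrier S" for s t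
    using j[OF S_closed[OF that]] that by simp
  show "\<mu> \<in> coboundaries G"
  proof (rule coboundary_extension[OF \<mu>, of "f \<circ> j"])
    fix x y assume "x \<in> \<iota> ` carrier S" "y \<in> \<iota> ` carrier S"
    then obtain s t where "s \<in> carrier S" "x = \<iota> s" "t \<in> carrier S" "y = \<iota> t" by blast
    then show "\<mu> (x, y) = (f \<circ> j) x * (f \<circ> j) y * cnj ((f \<circ> j) (x \<otimes>\<^bsub>G\<^esub> y))"
      using f(2)[of s t] by (simp add: j j_mult restrict_multiplier_def)
  qed (use f(1) j in auto)
qed

text \<open>First isomorphism theorem for \<open>h\<close>, restriction followed by the quotient
  map: it is onto because multipliers extend, and its kernel is
  \<open>coboundaries G\<close>.\<close>

lemma H2_iso:
  "\<exists>\<Phi>\<in>iso (H2 G) (H2 S). \<forall>\<mu>\<in>multipliers G.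
     res \<mu> \<in> multipliers S \<and> \<Phi> (H2_class G \<mu>) = H2_class S (res \<mu>)"
proof -
  let ?MG = "multiplier_group G" and ?MS = "multiplier_group S"
  interpret MG: comm_group ?MG by (rule multiplier_group_comm_group) simp
  interpret MS: comm_group ?MS by (rule multiplier_group_comm_group) (rule S_closed)
  have subG: "subgroup (coboundaries G) ?MG" by (rule coboundaries_subgroup) simp
  have subS: "subgroup (coboundaries S) ?MS" by (rule coboundaries_subgroup) (rule S_closed)
  interpret NS: normal "coboundaries S" ?MS by (rule MS.subgroup_imp_normal[OF subS])
  have carr: "carrier (multiplier_group T) = multipliers T" for T :: "('a, 'b) monoid_scheme"
    by (simp add: multiplier_group_def)
  define h where "h \<mu> = H2_class S (res \<mu>)" for \<mu>
  have res_hom: "res \<in> hom ?MG ?MS"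
    by (rule homI) (simp_all add: carr res_multiplier,
      auto simp: multiplier_group_def restrict_multiplier_def fun_eq_iff)
  have "(\<lambda>w. coboundaries S #>\<^bsub>?MS\<^esub> w) \<circ> res \<in> hom ?MG (H2 S)"
    unfolding H2_def by (rule Group.hom_compose[OF res_hom NS.r_coset_hom_Mod])
  then have hom: "h \<in> hom ?MG (H2 S)"
    by (simp add: h_def[abs_def] H2_class_def comp_def)
  have "group (H2 S)" unfolding H2_def by (rule NS.factorgroup_is_group)
  then interpret h: group_hom ?MG "H2 S" h
    using hom by (simp add: group_hom_def group_hom_axioms_def MG.is_group)
  have one: "\<one>\<^bsub>H2 S\<^esub> = coboundaries S" by (simp add: H2_def)
  have kernel: "kernel ?MG (H2 S) h = coboundaries G"
  proof -
    have "h \<mu> = coboundaries S \<longleftrightarrow> \<mu> \<in> coboundaries G" if \<mu>: "\<mu> \<in> multipliers G" for \<mu>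
      using MS.coset_join1[OF _ _ subS, of "res \<mu>"] MS.coset_join2[OF _ subS, of "res \<mu>"]
        res_multiplier[OF \<mu>] res_coboundary_iff[OF \<mu>]
      by (auto simp: h_def H2_class_def carr)
    then show ?thesis
      using subgroup.subset[OF subG] by (auto simp: kernel_def one carr)
  qed
  have surj: "h ` carrier ?MG = carrier (H2 S)"
  proof
    show "carrier (H2 S) \<subseteq> h ` carrier ?MG"
    proof
      fix C assume "C \<in> carrier (H2 S)"
      then obtain w where w: "w \<in> multipliers S" "C = H2_class S w"
        by (auto simp: H2_def FactGroup_def RCOSETS_def H2_class_def carr)
      then obtain \<mu> where "\<mu> \<in> multipliers G" "res \<mu> = w" using res_surj by blast
      with w show "C \<in> h ` carrier ?MG" by (auto simp: h_def carr)
    qed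
  qed (use h.hom_closed in auto)
  have "(\<lambda>C. the_elem (h ` C)) \<in> iso (H2 G) (H2 S)"
    using h.FactGroup_iso_set[OF surj] unfolding kernel H2_def[of G] .
  moreover have "the_elem (h ` H2_class G \<mu>) = H2_class S (res \<mu>)" if \<mu>: "\<mu> \<in> multipliers G" for \<mu>
  proof -
    \<comment> \<open>The isomorphism sends a class to the sole element of its image under
      \<open>h\<close>; evaluating it needs \<open>h\<close> constant on the class.\<close>
    have "h \<nu> = h \<mu>" if \<nu>: "\<nu> \<in> H2_class G \<mu>" for \<nu>
    proof -
      obtain b where b: "b \<in> coboundaries G" "\<nu> = b \<otimes>\<^bsub>?MG\<^esub> \<mu>"
        using \<nu> by (auto simp: H2_class_def r_coset_def)
      then have "b \<in> kernel ?MG (H2 S) h" by (simp add: kernel)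
      then have "b \<in> carrier ?MG" "h b = \<one>\<^bsub>H2 S\<^esub>" by (auto simp: kernel_def)
      then show ?thesis using b \<mu> by (simp add: carr)
    qed
    moreover have "\<mu> \<in> H2_class G \<mu>"
      unfolding H2_class_def using \<mu> by (intro MG.rcos_self subG) (simp add: carr)
    ultimately have "h ` H2_class G \<mu> = {h \<mu>}" by blast
    then show ?thesis by (simp add: h_def)
  qed
  ultimately show ?thesis
    using res_multiplier by (intro bexI[of _ "\<lambda>C. the_elem (h ` C)"]) simp_all
qed

end


section \<open>The model of the minimal dilation\<close>

text \<open>\<open>V\<close> is indexed by \<open>P\<close>, so that products such as
  \<open>t \<otimes> g\<close> can be fed to it directly; the multiplier of \<open>V\<close> is the
  restriction of \<open>\<mu>\<close>.\<close>

locale isometric_system = G: fraction_group G P + H: complex_hilbert_space H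
  for G :: "('g, 'y) monoid_scheme" (structure) and P and H :: "('h, 'z) hilbert_scheme" +
  fixes \<mu> :: "'g \<times> 'g \<Rightarrow> complex" and V :: "'g \<Rightarrow> 'h \<Rightarrow> 'h"
  assumes \<mu>: "\<mu> \<in> multipliers G"
    and V_isometry: "s \<in> P \<Longrightarrow> linear_isometry H H (V s)"
    and V_mult: "\<lbrakk>s \<in> P; t \<in> P; x \<in> carrier H\<rbrakk> \<Longrightarrow> V s (V t x) = \<mu> (s, t) \<odot>\<^bsub>H\<^esub> V (s \<otimes> t) x"
begin

lemma \<mu>_unit [simp]: "\<lbrakk>g \<in> carrier G; h \<in> carrier G\<rbrakk> \<Longrightarrow> norm (\<mu> (g, h)) = 1"
proof -
  assume gh: "g \<in> carrier G" "h \<in> carrier G"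
  have "\<mu> \<in> carrier G \<times> carrier G \<rightarrow>\<^sub>E sphere 0 1" using \<mu> unfolding multipliers_def by blast
  then have "\<mu> (g, h) \<in> sphere 0 1" by (rule PiE_mem) (use gh in simp)
  then show "norm (\<mu> (g, h)) = 1" by simp
qed

lemma \<mu>_cnj:
  assumes "g \<in> carrier G" "h \<in> carrier G"
  shows "\<mu> (g, h) * cnj (\<mu> (g, h)) = 1"
  by (rule cnj_unit[OF \<mu>_unit[OF assms]])

lemma \<mu>_cocycle:
  assumes "g \<in> carrier G" "h \<in> carrier G" "k \<in> carrier G"
  shows "\<mu> (g, h) * \<mu> (g \<otimes> h, k) = \<mu> (g, h \<otimes> k) * \<mu> (h, k)"
  using \<mu> assms unfolding multipliers_def mem_Collect_eq by (elim conjE) (drule (1) bspec)+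

lemma V_closed [simp]: "\<lbrakk>s \<in> P; x \<in> carrier H\<rbrakk> \<Longrightarrow> V s x \<in> carrier H"
  by (rule linear_isometryD(1)[OF V_isometry])

lemma V_add: "\<lbrakk>s \<in> P; x \<in> carrier H; y \<in> carrier H\<rbrakk> \<Longrightarrow> V s (x \<oplus>\<^bsub>H\<^esub> y) = V s x \<oplus>\<^bsub>H\<^esub> V s y"
  by (rule linear_isometryD(2)[OF V_isometry])

lemma V_smult: "\<lbrakk>s \<in> P; x \<in> carrier H\<rbrakk> \<Longrightarrow> V s (a \<odot>\<^bsub>H\<^esub> x) = a \<odot>\<^bsub>H\<^esub> V s x"
  by (rule linear_isometryD(3)[OF V_isometry])

lemma V_hnorm [simp]: "\<lbrakk>s \<in> P; x \<in> carrier H\<rbrakk> \<Longrightarrow> hnorm H (V s x) = hnorm H x"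
  by (rule linear_isometryD(4)[OF V_isometry])

lemma V_cinner: "\<lbrakk>s \<in> P; x \<in> carrier H; y \<in> carrier H\<rbrakk> \<Longrightarrow> cinner H (V s x) (V s y) = cinner H x y"
  by (rule linear_isometry_cinner[OF H.complex_inner_space_axioms H.complex_inner_space_axioms V_isometry])

text \<open>A vector \<open>\<xi>\<close> of the dilation space is encoded by the function \<open>g \<mapsto> J\<^sup>* U\<^sub>g \<xi>\<close>; the condition
  below is what \<open>J\<^sup>* U\<^sub>g = \<mu> (t, g) V\<^sub>t\<^sup>* J\<^sup>* U\<^bsub>t g\<^esub>\<close> says weakly.\<close>

definition compatible :: "('g \<Rightarrow> 'h) \<Rightarrow> bool" where
  "compatible f \<longleftrightarrow> (\<forall>g\<in>carrier G. \<forall>t\<in>P. \<forall>y\<in>carrier H.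
     cinner H (f g) y = \<mu> (t, g) * cinner H (f (t \<otimes> g)) (V t y))"

text \<open>Extensionality makes agreement on \<open>G\<close> equality of vectors, and boundedness
  makes the supremum that serves as norm finite.\<close>

definition model_carrier :: "('g \<Rightarrow> 'h) set" where
  "model_carrier = {f \<in> carrier G \<rightarrow>\<^sub>E carrier H. compatible f \<and>
     (\<exists>C. \<forall>g\<in>carrier G. hnorm H (f g) \<le> C)}"

lemma model_carrierI:
  assumes "\<And>g. g \<in> carrier G \<Longrightarrow> f g \<in> carrier H" "f \<in> extensional (carrier G)"
    and "\<And>g t y. \<lbrakk>g \<in> carrier G; t \<in> P; y \<in> carrier H\<rbrakk> \<Longrightarrow>
      cinner H (f g) y = \<mu> (t, g) * cinner H (f (t \<otimes> g)) (V t y)"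
    and "\<And>g. g \<in> carrier G \<Longrightarrow> hnorm H (f g) \<le> C"
  shows "f \<in> model_carrier"
  unfolding model_carrier_def compatible_def PiE_iff using assms by blast

lemma model_closed [simp]: "\<lbrakk>f \<in> model_carrier; g \<in> carrier G\<rbrakk> \<Longrightarrow> f g \<in> carrier H"
  unfolding model_carrier_def by blast

lemma model_extensional: "f \<in> model_carrier \<Longrightarrow> f \<in> extensional (carrier G)"
  unfolding model_carrier_def PiE_def by blast

lemma model_compatible:
  "\<lbrakk>f \<in> model_carrier; g \<in> carrier G; t \<in> P; y \<in> carrier H\<rbrakk> \<Longrightarrow>
    cinner H (f g) y = \<mu> (t, g) * cinner H (f (t \<otimes> g)) (V t y)"
  unfolding model_carrier_def compatible_def by blast

lemma model_bounded: "f \<in> model_carrier \<Longrightarrow> \<exists>C. \<forall>g\<in>carrier G. hnorm H (f g) \<le> C"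
  unfolding model_carrier_def by blast

lemma model_eqI:
  "\<lbrakk>f \<in> model_carrier; f' \<in> model_carrier; \<And>g. g \<in> carrier G \<Longrightarrow> f g = f' g\<rbrakk> \<Longrightarrow> f = f'"
  by (rule extensionalityI[OF model_extensional model_extensional])

text \<open>Up to a unit scalar \<open>f g\<close> is the adjoint of \<open>V t\<close> applied to
  \<open>f (t \<otimes> g)\<close>, and that adjoint is a contraction. The proof tests compatibility
  at \<open>y = f g\<close>.\<close>

lemma model_hnorm_mono:
  assumes f: "f \<in> model_carrier" and g: "g \<in> carrier G" and t: "t \<in> P"
  shows "hnorm H (f g) \<le> hnorm H (f (t \<otimes> g))"
proof -
  have fg: "f g \<in> carrier H" "f (t \<otimes> g) \<in> carrier H" using f g t by simp_all
  have "(hnorm H (f g))\<^sup>2 = norm (cinner H (f g) (f g))"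
    using fg by (simp add: H.cinner_self norm_power)
  also have "\<dots> = norm (cinner H (f (t \<otimes> g)) (V t (f g)))"
    using model_compatible[OF f g t fg(1)] g t by (simp add: norm_mult)
  also have "\<dots> \<le> hnorm H (f (t \<otimes> g)) * hnorm H (f g)"
    using H.norm_cinner_le[OF fg(2) V_closed[OF t fg(1)]] t fg by simp
  finally show ?thesis
    using H.hnorm_nonneg[OF fg(1)] H.hnorm_nonneg[OF fg(2)]
    by (cases "hnorm H (f g) = 0") (auto simp: power2_eq_square)
qed

text \<open>\<open>tail\<close> is the filter of the order \<open>g \<le> t \<otimes> g\<close> on \<open>G\<close>.\<close>

definition tail :: "'g filter" where
  "tail = (INF a\<in>carrier G. principal ((\<lambda>s. s \<otimes> a) ` P))"

text \<open>The sets \<open>P a\<close> form a filter base: with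
  \<open>u \<otimes> a = v \<otimes> b\<close> for \<open>u\<close> and \<open>v\<close> in
  \<open>P\<close>, the set belonging to \<open>u \<otimes> a\<close> lies in those of
  \<open>a\<close> and \<open>b\<close>.\<close>

lemma eventually_tail: "eventually Q tail \<longleftrightarrow> (\<exists>a\<in>carrier G. \<forall>s\<in>P. Q (s \<otimes> a))"
proof -
  have "eventually Q tail \<longleftrightarrow> (\<exists>a\<in>carrier G. eventually Q (principal ((\<lambda>s. s \<otimes> a) ` P)))"
    unfolding tail_def
  proof (rule eventually_INF_base)
    show "carrier G \<noteq> {}" using G.one_closed by blast
    fix a b assume ab: "a \<in> carrier G" "b \<in> carrier G"
    obtain u where u: "u \<in> P" "u \<otimes> (a \<otimes> inv b) \<in> P"
      using G.P_denominator[of "a \<otimes> inv b"] ab by auto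
    define v where "v = u \<otimes> (a \<otimes> inv b)"
    have "v \<otimes> b = u \<otimes> a" using u ab by (simp add: v_def G.m_assoc)
    have "(\<lambda>s. s \<otimes> (u \<otimes> a)) ` P \<subseteq> (\<lambda>s. s \<otimes> c) ` P"
      if c: "c \<in> carrier G" "w \<in> P" "u \<otimes> a = w \<otimes> c" for c w
    proof (rule image_subsetI)
      fix s assume s: "s \<in> P"
      have "s \<otimes> (u \<otimes> a) = (s \<otimes> w) \<otimes> c"
        using G.m_assoc[OF G.P_carrier[OF s] G.P_carrier[OF c(2)] c(1)] c(3) by simp
      then show "s \<otimes> (u \<otimes> a) \<in> (\<lambda>s. s \<otimes> c) ` P"
        by (rule image_eqI) (rule G.P_mult[OF s c(2)])
    qed
    from this[OF ab(1) u(1) refl] this[OF ab(2) _ \<open>v \<otimes> b = u \<otimes> a\<close>[symmetric]] u(2)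
    have "(\<lambda>s. s \<otimes> (u \<otimes> a)) ` P \<subseteq> (\<lambda>s. s \<otimes> a) ` P"
      "(\<lambda>s. s \<otimes> (u \<otimes> a)) ` P \<subseteq> (\<lambda>s. s \<otimes> b) ` P"
      by (simp_all add: v_def)
    moreover have "u \<otimes> a \<in> carrier G" using u ab by simp
    ultimately show "\<exists>c\<in>carrier G. principal ((\<lambda>s. s \<otimes> c) ` P) \<le>
        inf (principal ((\<lambda>s. s \<otimes> a) ` P)) (principal ((\<lambda>s. s \<otimes> b) ` P))"
      by (intro bexI[of _ "u \<otimes> a"]) simp_all
  qed
  then show ?thesis by (simp add: eventually_principal)
qed

lemma P_nonempty: obtains s where "s \<in> P"
  using G.P_denominator[OF G.one_closed] by blast

lemma tail_neq_bot: "tail \<noteq> bot"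
proof -
  obtain s where "s \<in> P" by (rule P_nonempty)
  then have "\<not> eventually (\<lambda>_. False) tail" by (auto simp: eventually_tail)
  then show ?thesis by auto
qed

lemma eventually_tail_carrier: "eventually (\<lambda>g. g \<in> carrier G) tail"
  unfolding eventually_tail by (rule bexI[OF _ G.one_closed]) simp

text \<open>The set at the unit of \<open>G\<close> is \<open>P\<close>, so limits along
  \<open>tail\<close> see only values on \<open>P\<close>.\<close>

lemma eventually_tail_P: "eventually (\<lambda>g. g \<in> P) tail"
  unfolding eventually_tail by (rule bexI[OF _ G.one_closed]) simp

section \<open>Norm, inner product and completeness of the model\<close>

definition sup_norm :: "('g \<Rightarrow> 'h) \<Rightarrow> real" where
  "sup_norm f = (SUP g\<in>carrier G. hnorm H (f g))"

lemma bdd_above_model: "f \<in> model_carrier \<Longrightarrow> bdd_above ((\<lambda>g. hnorm H (f g)) ` carrier G)"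
  using model_bounded[of f] by (auto simp: bdd_above_def)

lemma hnorm_le_sup_norm: "\<lbrakk>f \<in> model_carrier; g \<in> carrier G\<rbrakk> \<Longrightarrow> hnorm H (f g) \<le> sup_norm f"
  unfolding sup_norm_def by (rule cSUP_upper[OF _ bdd_above_model])

lemma sup_norm_le: "(\<And>g. g \<in> carrier G \<Longrightarrow> hnorm H (f g) \<le> C) \<Longrightarrow> sup_norm f \<le> C"
  unfolding sup_norm_def using G.one_closed by (intro cSUP_least) blast+

text \<open>Monotone convergence: a value above \<open>C\<close> at \<open>a\<close> persists on all
  of \<open>P a\<close>.\<close>

lemma tendsto_sup_norm:
  assumes f: "f \<in> model_carrier"
  shows "((\<lambda>g. hnorm H (f g)) \<longlongrightarrow> sup_norm f) tail"
proof (rule order_tendstoI)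
  fix C assume "C < sup_norm f"
  then obtain a where a: "a \<in> carrier G" "C < hnorm H (f a)"
    using sup_norm_le[of f C] by (meson not_le)
  have "C < hnorm H (f (s \<otimes> a))" if "s \<in> P" for s
    using model_hnorm_mono[OF f a(1) that] a(2) by linarith
  then show "\<forall>\<^sub>F g in tail. C < hnorm H (f g)"
    using a(1) unfolding eventually_tail by blast
next
  fix C assume "sup_norm f < C"
  then show "\<forall>\<^sub>F g in tail. hnorm H (f g) < C"
    using hnorm_le_sup_norm[OF f] by (intro eventually_mono[OF eventually_tail_carrier]) fastforce
qed

text \<open>The inner product is a limit because \<open>U g \<xi>\<close> approaches the copy of
  \<open>H\<close> along \<open>tail\<close>, where the adjoint of \<open>J\<close> loses no length.
  Its convergence is established in \<open>tendsto_model_cinner\<close>.\<close>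

definition model :: "('g \<Rightarrow> 'h) hilbert" where
  "model = \<lparr>carrier = model_carrier, mult = undefined, one = undefined,
     zero = (\<lambda>g\<in>carrier G. \<zero>\<^bsub>H\<^esub>), add = (\<lambda>f f'. \<lambda>g\<in>carrier G. f g \<oplus>\<^bsub>H\<^esub> f' g),
     smult = (\<lambda>a f. \<lambda>g\<in>carrier G. a \<odot>\<^bsub>H\<^esub> f g),
     cinner = (\<lambda>f f'. Lim tail (\<lambda>g. cinner H (f g) (f' g)))\<rparr>"

lemma model_simps:
  "carrier model = model_carrier"
  "\<zero>\<^bsub>model\<^esub> = (\<lambda>g\<in>carrier G. \<zero>\<^bsub>H\<^esub>)"
  "f \<oplus>\<^bsub>model\<^esub> f' = (\<lambda>g\<in>carrier G. f g \<oplus>\<^bsub>H\<^esub> f' g)"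
  "a \<odot>\<^bsub>model\<^esub> f = (\<lambda>g\<in>carrier G. a \<odot>\<^bsub>H\<^esub> f g)"
  "cinner model f f' = Lim tail (\<lambda>g. cinner H (f g) (f' g))"
  by (simp_all add: model_def)

lemma model_zero_closed: "\<zero>\<^bsub>model\<^esub> \<in> model_carrier"
  by (rule model_carrierI[of _ 0]) (simp_all add: model_simps)

lemma model_smult_closed:
  assumes f: "f \<in> model_carrier" shows "a \<odot>\<^bsub>model\<^esub> f \<in> model_carrier"
proof (rule model_carrierI)
  fix g t y assume *: "g \<in> carrier G" "t \<in> P" "y \<in> carrier H"
  show "cinner H ((a \<odot>\<^bsub>model\<^esub> f) g) y = \<mu> (t, g) * cinner H ((a \<odot>\<^bsub>model\<^esub> f) (t \<otimes> g)) (V t y)"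
    using * f by (simp add: model_simps H.cinner_smult model_compatible[OF f *])
next
  fix g assume "g \<in> carrier G"
  then show "hnorm H ((a \<odot>\<^bsub>model\<^esub> f) g) \<le> norm a * sup_norm f"
    using f by (simp add: model_simps H.hnorm_smult mult_left_mono hnorm_le_sup_norm)
qed (use f in \<open>simp_all add: model_simps\<close>)

lemma model_add_closed:
  assumes f: "f \<in> model_carrier" and f': "f' \<in> model_carrier"
  shows "f \<oplus>\<^bsub>model\<^esub> f' \<in> model_carrier"
proof (rule model_carrierI)
  fix g t y assume *: "g \<in> carrier G" "t \<in> P" "y \<in> carrier H"
  show "cinner H ((f \<oplus>\<^bsub>model\<^esub> f') g) y = \<mu> (t, g) * cinner H ((f \<oplus>\<^bsub>model\<^esub> f') (t \<otimes> g)) (V t y)"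
    using * f f'
    by (simp add: model_simps H.cinner_add model_compatible[OF f *] model_compatible[OF f' *]
        distrib_left)
next
  fix g assume g: "g \<in> carrier G"
  then have "hnorm H (f g \<oplus>\<^bsub>H\<^esub> f' g) \<le> hnorm H (f g) + hnorm H (f' g)"
    using f f' by (intro H.hnorm_triangle) simp_all
  then show "hnorm H ((f \<oplus>\<^bsub>model\<^esub> f') g) \<le> sup_norm f + sup_norm f'"
    using hnorm_le_sup_norm[OF f g] hnorm_le_sup_norm[OF f' g] g by (simp add: model_simps)
qed (use f f' in \<open>simp_all add: model_simps\<close>)

text \<open>Polarization writes the real part through the norms of the sum and difference, both
  vectors of the model, whose norms converge.\<close>

lemma tendsto_Re_cinner:
  assumes f: "f \<in> model_carrier" and f': "f' \<in> model_carrier"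
  shows "\<exists>l. ((\<lambda>g. Re (cinner H (f g) (f' g))) \<longlongrightarrow> l) tail"
proof -
  define p where "p = f \<oplus>\<^bsub>model\<^esub> f'"
  define m where "m = f \<oplus>\<^bsub>model\<^esub> ((-1) \<odot>\<^bsub>model\<^esub> f')"
  have "p \<in> model_carrier" "m \<in> model_carrier"
    using f f' by (simp_all add: p_def m_def model_add_closed model_smult_closed)
  then have "((\<lambda>g. ((hnorm H (p g))\<^sup>2 - (hnorm H (m g))\<^sup>2) / 4)
      \<longlongrightarrow> ((sup_norm p)\<^sup>2 - (sup_norm m)\<^sup>2) / 4) tail"
    by (intro tendsto_intros tendsto_sup_norm) simp_all
  moreover have "\<forall>\<^sub>F g in tail. ((hnorm H (p g))\<^sup>2 - (hnorm H (m g))\<^sup>2) / 4 = Re (cinner H (f g) (f' g))"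
    using f f' by (intro eventually_mono[OF eventually_tail_carrier])
      (simp add: p_def m_def model_simps H.polarization_Re H.minus_eq_smult)
  ultimately show ?thesis by (blast intro: Lim_transform_eventually)
qed

lemma tendsto_model_cinner:
  assumes f: "f \<in> model_carrier" and f': "f' \<in> model_carrier"
  shows "((\<lambda>g. cinner H (f g) (f' g)) \<longlongrightarrow> cinner model f f') tail"
proof -
  obtain l where l: "((\<lambda>g. Re (cinner H (f g) (f' g))) \<longlongrightarrow> l) tail"
    using tendsto_Re_cinner[OF f f'] by blast
  obtain k where "((\<lambda>g. Re (cinner H (f g) ((\<i> \<odot>\<^bsub>model\<^esub> f') g))) \<longlongrightarrow> k) tail"
    using tendsto_Re_cinner[OF f model_smult_closed[OF f']] by blast
  moreover have "\<forall>\<^sub>F g in tail. Re (cinner H (f g) ((\<i> \<odot>\<^bsub>model\<^esub> f') g)) = Im (cinner H (f g) (f' g))"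
    using f f' by (intro eventually_mono[OF eventually_tail_carrier])
      (simp add: model_simps H.polarization_Im)
  ultimately have "((\<lambda>g. Im (cinner H (f g) (f' g))) \<longlongrightarrow> k) tail"
    by (rule Lim_transform_eventually)
  with l have "((\<lambda>g. cinner H (f g) (f' g)) \<longlongrightarrow> Complex l k) tail"
    by (simp add: tendsto_complex_iff)
  then show ?thesis
    unfolding model_simps using tendsto_Lim[OF tail_neq_bot] by metis
qed

lemma model_cinner_eqI:
  assumes "f \<in> model_carrier" "f' \<in> model_carrier"
    and "((\<lambda>g. cinner H (f g) (f' g)) \<longlongrightarrow> l) tail"
  shows "cinner model f f' = l"
  by (rule tendsto_unique[OF tail_neq_bot tendsto_model_cinner[OF assms(1,2)] assms(3)])

lemma model_inner_space: "complex_inner_space model"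
proof -
  have ab: "abelian_group model"
  proof (rule abelian_groupI)
    fix f assume f: "f \<in> carrier model"
    show "\<exists>f'\<in>carrier model. f' \<oplus>\<^bsub>model\<^esub> f = \<zero>\<^bsub>model\<^esub>"
    proof
      show "(-1) \<odot>\<^bsub>model\<^esub> f \<in> carrier model" using f by (simp add: model_simps(1) model_smult_closed)
      show "(-1) \<odot>\<^bsub>model\<^esub> f \<oplus>\<^bsub>model\<^esub> f = \<zero>\<^bsub>model\<^esub>"
        using f by (auto simp: model_simps H.smult_minus_one H.M.l_neg intro!: restrict_ext)
    qed
    show "\<zero>\<^bsub>model\<^esub> \<oplus>\<^bsub>model\<^esub> f = f"
      using f model_extensional[of f]
      by (intro extensionalityI[of _ "carrier G"]) (simp_all add: model_simps)
  qed (auto simp: model_simps(1) model_zero_closed model_add_closed,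
      auto simp: model_simps H.M.a_ac intro!: restrict_ext)
  have mod: "Module.module (ring_of_type_algebra :: complex ring) model"
    by (rule moduleI[OF H.R.is_cring ab])
      (auto simp: ring_of_type_algebra_def model_simps(1) model_smult_closed,
       auto simp: model_simps H.smult_add_left H.smult_add_right H.smult_smult
         intro!: restrict_ext extensionalityI[of _ "carrier G", OF _ model_extensional])
  show ?thesis
  proof (rule complex_inner_space.intro[OF mod], unfold_locales)
    fix f1 f2 f3 assume "f1 \<in> carrier model" "f2 \<in> carrier model" "f3 \<in> carrier model"
    then have f: "f1 \<in> model_carrier" "f2 \<in> model_carrier" "f3 \<in> model_carrier"
      by (simp_all add: model_simps)
    show "cinner model (f1 \<oplus>\<^bsub>model\<^esub> f2) f3 = cinner model f1 f3 + cinner model f2 f3"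
    proof (rule model_cinner_eqI)
      show "((\<lambda>g. cinner H ((f1 \<oplus>\<^bsub>model\<^esub> f2) g) (f3 g)) \<longlongrightarrow> cinner model f1 f3 + cinner model f2 f3) tail"
        by (rule Lim_transform_eventually[OF tendsto_add[OF tendsto_model_cinner[OF f(1,3)] tendsto_model_cinner[OF f(2,3)]]])
          (rule eventually_mono[OF eventually_tail_carrier], use f in \<open>simp add: model_simps(3) H.cinner_add\<close>)
    qed (use f model_add_closed in simp_all)
  next
    fix a f1 f2 assume "f1 \<in> carrier model" "f2 \<in> carrier model"
    then have f: "f1 \<in> model_carrier" "f2 \<in> model_carrier" by (simp_all add: model_simps)
    show "cinner model (a \<odot>\<^bsub>model\<^esub> f1) f2 = a * cinner model f1 f2"
    proof (rule model_cinner_eqI)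
      show "((\<lambda>g. cinner H ((a \<odot>\<^bsub>model\<^esub> f1) g) (f2 g)) \<longlongrightarrow> a * cinner model f1 f2) tail"
        by (rule Lim_transform_eventually[OF tendsto_mult_left[OF tendsto_model_cinner[OF f]]])
          (rule eventually_mono[OF eventually_tail_carrier], use f in \<open>simp add: model_simps(4) H.cinner_smult\<close>)
    qed (use f model_smult_closed in simp_all)
    show "cinner model f2 f1 = cnj (cinner model f1 f2)"
    proof (rule model_cinner_eqI)
      show "((\<lambda>g. cinner H (f2 g) (f1 g)) \<longlongrightarrow> cnj (cinner model f1 f2)) tail"
        by (rule Lim_transform_eventually[OF tendsto_cnj[OF tendsto_model_cinner[OF f]]])
          (rule eventually_mono[OF eventually_tail_carrier],
            rule H.cinner_commute[symmetric, OF model_closed[OF f(1)] model_closed[OF f(2)]])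
    qed (use f in simp_all)
  next
    fix f assume "f \<in> carrier model"
    then have f: "f \<in> model_carrier" by (simp add: model_simps)
    have cinner: "cinner model f f = of_real ((sup_norm f)\<^sup>2)"
    proof (rule model_cinner_eqI[OF f f])
      show "((\<lambda>g. cinner H (f g) (f g)) \<longlongrightarrow> of_real ((sup_norm f)\<^sup>2)) tail"
        by (rule Lim_transform_eventually[OF tendsto_of_real[OF tendsto_power[OF tendsto_sup_norm[OF f], of 2]]])
          (rule eventually_mono[OF eventually_tail_carrier], use f in \<open>simp add: H.cinner_self\<close>)
    qed
    show "0 \<le> Re (cinner model f f)" by (simp add: cinner)
    assume "cinner model f f = 0"
    then have "sup_norm f = 0" by (simp add: cinner)
    then have "hnorm H (f g) = 0" if "g \<in> carrier G" for g
      using hnorm_le_sup_norm[OF f that] H.hnorm_nonneg[OF model_closed[OF f that]] by simp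
    then have "f g = \<zero>\<^bsub>H\<^esub>" if "g \<in> carrier G" for g
      using H.hnorm_eq_0_iff[OF model_closed[OF f that]] that by simp
    then show "f = \<zero>\<^bsub>model\<^esub>"
      by (intro model_eqI[OF f model_zero_closed]) (simp add: model_simps)
  qed
qed

sublocale model: complex_inner_space model
  by (rule model_inner_space)

lemma model_hnorm: "f \<in> model_carrier \<Longrightarrow> hnorm model f = sup_norm f"
proof (rule tendsto_unique[OF tail_neq_bot _ tendsto_sup_norm])
  assume f: "f \<in> model_carrier"
  have "((\<lambda>g. sqrt (Re (cinner H (f g) (f g)))) \<longlongrightarrow> sqrt (Re (cinner model f f))) tail"
    by (intro tendsto_intros tendsto_model_cinner f)
  then show "((\<lambda>g. hnorm H (f g)) \<longlongrightarrow> hnorm model f) tail"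
    by (simp add: hnorm_def)
qed

lemma model_diff:
  assumes "f \<in> model_carrier" "f' \<in> model_carrier" "g \<in> carrier G"
  shows "(f \<ominus>\<^bsub>model\<^esub> f') g = f g \<ominus>\<^bsub>H\<^esub> f' g"
  using assms by (simp add: model.minus_eq_smult H.minus_eq_smult model_simps)

text \<open>The supremum norm dominates every evaluation, so a Cauchy sequence converges pointwise
  in \<open>H\<close>, and uniformly in \<open>g\<close>. Compatibility is an equation between inner
  products and passes to the limit.\<close>

lemma model_complete: "model.mcomplete"
  unfolding model.mcomplete_def
proof (intro allI impI)
  fix w assume "model.MCauchy w"
  then have *: "range w \<subseteq> carrier model \<and>
      (\<forall>\<epsilon>>0. \<exists>N. \<forall>n\<ge>N. \<forall>m\<ge>N. hnorm model (w n \<ominus>\<^bsub>model\<^esub> w m) < \<epsilon>)"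
    by (rule iffD1[OF model.MCauchy_hnorm])
  then have w: "w n \<in> model_carrier" for n
    by (auto simp: model_simps(1))
  have cauchy: "\<exists>N. \<forall>n\<ge>N. \<forall>m\<ge>N. hnorm model (w n \<ominus>\<^bsub>model\<^esub> w m) < \<epsilon>" if "0 < \<epsilon>" for \<epsilon>
    using * that by blast
  have diff: "w n \<ominus>\<^bsub>model\<^esub> w m \<in> model_carrier" for n m
    using model.M.minus_closed[of "w n" "w m"] w by (simp add: model_simps(1))
  have pointwise: "hnorm H (w n g \<ominus>\<^bsub>H\<^esub> w m g) \<le> hnorm model (w n \<ominus>\<^bsub>model\<^esub> w m)"
    if "g \<in> carrier G" for n m g
    using hnorm_le_sup_norm[OF diff that] by (simp add: model_hnorm[OF diff] model_diff[OF w w that])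
  have "\<exists>l. limitin H.mtopology (\<lambda>n. w n g) l sequentially" if g: "g \<in> carrier G" for g
  proof -
    have "H.MCauchy (\<lambda>n. w n g)"
      unfolding H.MCauchy_hnorm
    proof (intro conjI allI impI)
      show "range (\<lambda>n. w n g) \<subseteq> carrier H" using model_closed[OF w g] by blast
      fix \<epsilon> :: real assume "0 < \<epsilon>"
      then obtain N where "\<forall>n\<ge>N. \<forall>m\<ge>N. hnorm model (w n \<ominus>\<^bsub>model\<^esub> w m) < \<epsilon>"
        using cauchy by blast
      then show "\<exists>N. \<forall>n\<ge>N. \<forall>m\<ge>N. hnorm H (w n g \<ominus>\<^bsub>H\<^esub> w m g) < \<epsilon>"
        using pointwise[OF g] by (meson le_less_trans)
    qed
    then show ?thesis using H.complete unfolding H.mcomplete_def by blast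
  qed
  then obtain l where l: "\<And>g. g \<in> carrier G \<Longrightarrow> limitin H.mtopology (\<lambda>n. w n g) (l g) sequentially"
    by metis
  define f where "f = restrict l (carrier G)"
  have lim: "limitin H.mtopology (\<lambda>n. w n g) (f g) sequentially" if "g \<in> carrier G" for g
    using l[OF that] that by (simp add: f_def)
  have fc: "f g \<in> carrier H" if "g \<in> carrier G" for g
    using lim[OF that] by (simp add: H.limitin_hnorm)
  \<comment> \<open>Limit in \<open>m\<close> of the Cauchy estimate, with \<open>N\<close>
    independent of \<open>g\<close>. Strictness is lost, which is why \<open>r / 2\<close> is used
    for the final convergence.\<close>
  have dist_le: "hnorm H (w n g \<ominus>\<^bsub>H\<^esub> f g) \<le> \<epsilon>"
    if N: "\<forall>n\<ge>N. \<forall>m\<ge>N. hnorm model (w n \<ominus>\<^bsub>model\<^esub> w m) < \<epsilon>" and n: "n \<ge> N" and g: "g \<in> carrier G"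
    for \<epsilon> N n g
  proof (rule LIMSEQ_le_const)
    have "(\<lambda>m. hnorm H (w m g \<ominus>\<^bsub>H\<^esub> f g)) \<longlonglongrightarrow> 0"
      using lim[OF g] by (simp add: H.limitin_hnorm)
    then have "(\<lambda>m. \<epsilon> + hnorm H (w m g \<ominus>\<^bsub>H\<^esub> f g)) \<longlonglongrightarrow> \<epsilon> + 0"
      by (intro tendsto_intros)
    then show "(\<lambda>m. \<epsilon> + hnorm H (w m g \<ominus>\<^bsub>H\<^esub> f g)) \<longlonglongrightarrow> \<epsilon>" by simp
    have "hnorm H (w n g \<ominus>\<^bsub>H\<^esub> f g) \<le> \<epsilon> + hnorm H (w m g \<ominus>\<^bsub>H\<^esub> f g)" if "m \<ge> N" for m
      using H.hnorm_diff_triangle[OF model_closed[OF w g] model_closed[OF w g] fc[OF g], of n m]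
        pointwise[OF g, of n m] N n that by force
    then show "\<exists>N. \<forall>m\<ge>N. hnorm H (w n g \<ominus>\<^bsub>H\<^esub> f g) \<le> \<epsilon> + hnorm H (w m g \<ominus>\<^bsub>H\<^esub> f g)" by blast
  qed
  have f: "f \<in> model_carrier"
  proof -
    obtain N where N: "\<forall>n\<ge>N. \<forall>m\<ge>N. hnorm model (w n \<ominus>\<^bsub>model\<^esub> w m) < 1"
      using cauchy[of 1] by auto
    show ?thesis
    proof (rule model_carrierI)
      fix g t y assume *: "g \<in> carrier G" "t \<in> P" "y \<in> carrier H"
      have tg: "t \<otimes> g \<in> carrier G" using * by simp
      have "(\<lambda>n. \<mu> (t, g) * cinner H (w n (t \<otimes> g)) (V t y)) \<longlonglongrightarrow> \<mu> (t, g) * cinner H (f (t \<otimes> g)) (V t y)"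
        by (intro tendsto_intros H.tendsto_cinner lim tg V_closed *)
      then have "(\<lambda>n. cinner H (w n g) y) \<longlonglongrightarrow> \<mu> (t, g) * cinner H (f (t \<otimes> g)) (V t y)"
        by (simp only: model_compatible[OF w *])
      then show "cinner H (f g) y = \<mu> (t, g) * cinner H (f (t \<otimes> g)) (V t y)"
        by (rule LIMSEQ_unique[OF H.tendsto_cinner[OF lim[OF *(1)] *(3)]])
    next
      fix g assume g: "g \<in> carrier G"
      have "hnorm H (w N g) \<le> sup_norm (w N)" by (rule hnorm_le_sup_norm[OF w g])
      then show "hnorm H (f g) \<le> sup_norm (w N) + 1"
        using H.hnorm_reverse_triangle[OF model_closed[OF w g] fc[OF g], of N]
          dist_le[OF N order_refl g] by linarith
    qed (use fc in \<open>simp_all add: f_def\<close>)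
  qed
  have diff': "w n \<ominus>\<^bsub>model\<^esub> f \<in> model_carrier" for n
    using model.M.minus_closed[of "w n" f] w f by (simp add: model_simps(1))
  have "limitin model.mtopology w f sequentially"
    unfolding model.limitin_hnorm
  proof (intro conjI)
    show "(\<lambda>n. hnorm model (w n \<ominus>\<^bsub>model\<^esub> f)) \<longlonglongrightarrow> 0"
    proof (rule LIMSEQ_I)
      fix r :: real assume "0 < r"
      then obtain N where N: "\<forall>n\<ge>N. \<forall>m\<ge>N. hnorm model (w n \<ominus>\<^bsub>model\<^esub> w m) < r / 2"
        using cauchy[of "r / 2"] by auto
      have "norm (hnorm model (w n \<ominus>\<^bsub>model\<^esub> f) - 0) < r" if "n \<ge> N" for n
      proof -
        have "sup_norm (w n \<ominus>\<^bsub>model\<^esub> f) \<le> r / 2"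
          using dist_le[OF N that] by (intro sup_norm_le) (simp add: model_diff[OF w f])
        moreover have "0 \<le> hnorm model (w n \<ominus>\<^bsub>model\<^esub> f)"
          using model.hnorm_nonneg[of "w n \<ominus>\<^bsub>model\<^esub> f"] diff' by (simp add: model_simps(1))
        ultimately show ?thesis using \<open>0 < r\<close> by (simp add: model_hnorm[OF diff'])
      qed
      then show "\<exists>N. \<forall>n\<ge>N. norm (hnorm model (w n \<ominus>\<^bsub>model\<^esub> f) - 0) < r" by blast
    qed
  qed (use w f in \<open>simp_all add: model_simps(1)\<close>)
  then show "\<exists>f. limitin model.mtopology w f sequentially" by blast
qed

lemma model_hilbert_space: "complex_hilbert_space model"
  by (rule complex_hilbert_space.intro[OF model_inner_space])
    (rule complex_hilbert_space_axioms.intro[OF model_complete])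

section \<open>The projective action of \<open>G\<close> on the model\<close>

definition model_U :: "'g \<Rightarrow> ('g \<Rightarrow> 'h) \<Rightarrow> 'g \<Rightarrow> 'h" where
  "model_U x f = (\<lambda>g\<in>carrier G. \<mu> (g, x) \<odot>\<^bsub>H\<^esub> f (g \<otimes> x))"

text \<open>Compatibility survives the twisted translation exactly by the cocycle identity at
  \<open>(t, g, x)\<close>.\<close>

lemma model_U_closed:
  assumes x: "x \<in> carrier G" and f: "f \<in> model_carrier"
  shows "model_U x f \<in> model_carrier"
proof (rule model_carrierI)
  fix g t y assume *: "g \<in> carrier G" "t \<in> P" "y \<in> carrier H"
  have "cinner H (model_U x f g) y = \<mu> (g, x) * cinner H (f (g \<otimes> x)) y"
    using * x f by (simp add: model_U_def H.cinner_smult)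
  also have "\<dots> = (\<mu> (t, g \<otimes> x) * \<mu> (g, x)) * cinner H (f (t \<otimes> (g \<otimes> x))) (V t y)"
    using model_compatible[OF f G.m_closed[OF *(1) x] *(2,3)] by simp
  also have "\<mu> (t, g \<otimes> x) * \<mu> (g, x) = \<mu> (t, g) * \<mu> (t \<otimes> g, x)"
    using \<mu>_cocycle[of t g x] * x by simp
  also have "\<dots> * cinner H (f (t \<otimes> (g \<otimes> x))) (V t y) = \<mu> (t, g) * cinner H (model_U x f (t \<otimes> g)) (V t y)"
    using * x f by (simp add: model_U_def H.cinner_smult G.m_assoc)
  finally show "cinner H (model_U x f g) y = \<mu> (t, g) * cinner H (model_U x f (t \<otimes> g)) (V t y)" .
next
  fix g assume "g \<in> carrier G"
  then show "hnorm H (model_U x f g) \<le> sup_norm f"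
    using x f by (simp add: model_U_def H.hnorm_smult hnorm_le_sup_norm)
qed (use x f in \<open>simp_all add: model_U_def\<close>)

lemma model_U_mult:
  assumes x: "x \<in> carrier G" and y: "y \<in> carrier G" and f: "f \<in> model_carrier"
  shows "model_U x (model_U y f) = \<mu> (x, y) \<odot>\<^bsub>model\<^esub> model_U (x \<otimes> y) f"
proof (rule model_eqI)
  fix g assume g: "g \<in> carrier G"
  have "\<mu> (g, x) * \<mu> (g \<otimes> x, y) = \<mu> (x, y) * \<mu> (g, x \<otimes> y)"
    using \<mu>_cocycle[OF g x y] by simp
  then show "model_U x (model_U y f) g = (\<mu> (x, y) \<odot>\<^bsub>model\<^esub> model_U (x \<otimes> y) f) g"
    using g x y f by (simp add: model_U_def model_simps H.smult_smult G.m_assoc)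
qed (use x y f in \<open>simp_all add: model_U_closed model_smult_closed\<close>)

lemma model_U_isometry:
  assumes x: "x \<in> carrier G"
  shows "linear_isometry model model (model_U x)"
proof -
  have sup_le: "sup_norm (model_U z f) \<le> sup_norm f" if "z \<in> carrier G" "f \<in> model_carrier" for z f
    using that by (intro sup_norm_le) (simp add: model_U_def H.hnorm_smult hnorm_le_sup_norm)
  have "sup_norm (model_U x f) = sup_norm f" if f: "f \<in> model_carrier" for f
  proof (rule antisym[OF sup_le[OF x f]])
    show "sup_norm f \<le> sup_norm (model_U x f)"
    proof (rule sup_norm_le)
      fix g assume g: "g \<in> carrier G"
      \<comment> \<open>Right translation by \<open>x\<close> permutes \<open>G\<close>, so no value
        of \<open>f\<close> is lost.\<close>
      then have "hnorm H (f g) = hnorm H (model_U x f (g \<otimes> inv x))"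
        using x f by (simp add: model_U_def H.hnorm_smult G.m_assoc)
      also have "\<dots> \<le> sup_norm (model_U x f)"
        using g x f by (intro hnorm_le_sup_norm model_U_closed) simp_all
      finally show "hnorm H (f g) \<le> sup_norm (model_U x f)" .
    qed
  qed
  moreover have "model_U x (f \<oplus>\<^bsub>model\<^esub> f') = model_U x f \<oplus>\<^bsub>model\<^esub> model_U x f'"
    if f: "f \<in> model_carrier" "f' \<in> model_carrier" for f f'
    by (rule model_eqI)
      (use f x in \<open>simp_all add: model_U_closed model_add_closed\<close>,
       use f x in \<open>simp add: model_U_def model_simps H.smult_add_right\<close>)
  moreover have "model_U x (a \<odot>\<^bsub>model\<^esub> f) = a \<odot>\<^bsub>model\<^esub> model_U x f" if f: "f \<in> model_carrier" for a f
    by (rule model_eqI)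
      (use f x in \<open>simp_all add: model_U_closed model_smult_closed\<close>,
       use f x in \<open>simp add: model_U_def model_simps H.smult_smult mult.commute\<close>)
  ultimately show ?thesis
    unfolding linear_isometry_def
    using x by (simp add: model_simps(1) model_U_closed model_hnorm)
qed

lemma model_U_surj:
  assumes x: "x \<in> carrier G" and f: "f \<in> model_carrier"
  shows "\<exists>f'\<in>model_carrier. model_U x f' = f"
proof
  define f' where "f' = model_U (inv x) f"
  \<comment> \<open>The scalar by which \<open>model_U x\<close> after
    \<open>model_U (inv x)\<close> acts; the second factor is the action of the unit of
    \<open>G\<close>.\<close>
  define a where "a = \<mu> (x, inv x) * \<mu> (\<one>, \<one>)"
  have a: "a * cnj a = 1" by (rule cnj_unit) (use x in \<open>simp add: a_def norm_mult\<close>)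
  have f': "f' \<in> model_carrier" using x f by (simp add: f'_def model_U_closed)
  then show "cnj a \<odot>\<^bsub>model\<^esub> f' \<in> model_carrier" by (rule model_smult_closed)
  \<comment> \<open>Cocycle identity at \<open>(g, \<one>, \<one>)\<close>, after cancelling
    \<open>\<mu> (g, \<one>)\<close>.\<close>
  have \<mu>_one: "\<mu> (g, \<one>) = \<mu> (\<one>, \<one>)" if "g \<in> carrier G" for g
  proof -
    have "\<mu> (g, \<one>) \<noteq> 0" using \<mu>_unit[OF that G.one_closed] by auto
    then show ?thesis using \<mu>_cocycle[OF that G.one_closed G.one_closed] that by simp
  qed
  have U_one: "model_U \<one> f = \<mu> (\<one>, \<one>) \<odot>\<^bsub>model\<^esub> f"
  proof (rule model_eqI)
    fix g assume g: "g \<in> carrier G"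
    show "model_U \<one> f g = (\<mu> (\<one>, \<one>) \<odot>\<^bsub>model\<^esub> f) g"
      using g by (simp add: model_U_def model_simps \<mu>_one[OF g])
  qed (use f in \<open>simp_all add: model_U_closed model_smult_closed\<close>)
  have "model_U x f' = \<mu> (x, inv x) \<odot>\<^bsub>model\<^esub> model_U \<one> f"
    unfolding f'_def using model_U_mult[OF x G.inv_closed[OF x] f] x by simp
  then have "model_U x f' = a \<odot>\<^bsub>model\<^esub> f"
    unfolding U_one a_def using f by (simp add: model.smult_smult model_simps(1))
  then show "model_U x (cnj a \<odot>\<^bsub>model\<^esub> f') = f"
    using linear_isometryD(3)[OF model_U_isometry[OF x], of f' "cnj a"] f' f a model.smult_1[of f]
    by (simp add: model_simps(1) model.smult_smult mult.commute)
qed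

lemma model_unitary_rep: "unitary_rep G \<mu> model model_U"
proof -
  have "unitary_operator model model (model_U x)" if x: "x \<in> carrier G" for x
  proof -
    have "model_U x ` model_carrier = model_carrier"
      using model_U_closed[OF x] model_U_surj[OF x] by blast
    then show ?thesis
      using model_U_isometry[OF x] by (simp add: unitary_operator_def model_simps(1))
  qed
  then show ?thesis
    using model_U_mult by (simp add: unitary_rep_def model_simps(1))
qed

section \<open>The copy of \<open>H\<close> in the model\<close>

text \<open>\<open>J x\<close> is encoded by \<open>g \<mapsto> J\<^sup>* U\<^sub>g J x\<close>, and \<open>U\<^bsub>t g\<^esub> J x = J V\<^bsub>t g\<^esub> x\<close> whenever \<open>t \<otimes> g \<in> P\<close>.\<close>

definition matrix_entry :: "'h \<Rightarrow> 'g \<Rightarrow> 'h \<Rightarrow> bool" where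
  "matrix_entry x g y \<longleftrightarrow> y \<in> carrier H \<and> (\<forall>t\<in>P. t \<otimes> g \<in> P \<longrightarrow>
     (\<forall>z\<in>carrier H. cinner H y z = \<mu> (t, g) * cinner H (V (t \<otimes> g) x) (V t z)))"

lemma matrix_entryD:
  assumes "matrix_entry x g y"
  shows "y \<in> carrier H"
    and "\<lbrakk>t \<in> P; t \<otimes> g \<in> P; z \<in> carrier H\<rbrakk> \<Longrightarrow> cinner H y z = \<mu> (t, g) * cinner H (V (t \<otimes> g) x) (V t z)"
proof -
  show "y \<in> carrier H"
    using assms unfolding matrix_entry_def by (rule conjunct1)
  have "\<forall>t\<in>P. t \<otimes> g \<in> P \<longrightarrow>
     (\<forall>z\<in>carrier H. cinner H y z = \<mu> (t, g) * cinner H (V (t \<otimes> g) x) (V t z))"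
    using assms unfolding matrix_entry_def by (rule conjunct2)
  then show "cinner H y z = \<mu> (t, g) * cinner H (V (t \<otimes> g) x) (V t z)"
    if "t \<in> P" "t \<otimes> g \<in> P" "z \<in> carrier H"
    using that by (auto dest: bspec)
qed

text \<open>Insert the isometry \<open>V a\<close> on both sides of the inner product and multiply
  out: the cocycle identity at \<open>(a, t, g)\<close> absorbs the scalars.\<close>

lemma matrix_entry_shift:
  assumes x: "x \<in> carrier H" and z: "z \<in> carrier H" and g: "g \<in> carrier G"
    and t: "t \<in> P" "t \<otimes> g \<in> P" and a: "a \<in> P"
  shows "\<mu> (a \<otimes> t, g) * cinner H (V (a \<otimes> t \<otimes> g) x) (V (a \<otimes> t) z) =
    \<mu> (t, g) * cinner H (V (t \<otimes> g) x) (V t z)"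
proof -
  have G: "a \<in> carrier G" "t \<in> carrier G" "t \<otimes> g \<in> carrier G" "a \<otimes> t \<in> P" "a \<otimes> (t \<otimes> g) \<in> P"
    using a t g by (simp_all add: G.P_mult)
  have "cinner H (V (t \<otimes> g) x) (V t z) = cinner H (V a (V (t \<otimes> g) x)) (V a (V t z))"
    using x z t a by (simp add: V_cinner)
  also have "\<dots> = \<mu> (a, t \<otimes> g) * cnj (\<mu> (a, t)) * cinner H (V (a \<otimes> (t \<otimes> g)) x) (V (a \<otimes> t) z)"
    using x z t a G by (simp add: V_mult H.cinner_smult H.cinner_smult_right)
  finally have "\<mu> (t, g) * cinner H (V (t \<otimes> g) x) (V t z) =
      (\<mu> (a, t \<otimes> g) * \<mu> (t, g)) * cnj (\<mu> (a, t)) * cinner H (V (a \<otimes> (t \<otimes> g)) x) (V (a \<otimes> t) z)"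
    by simp
  also have "\<mu> (a, t \<otimes> g) * \<mu> (t, g) = \<mu> (a \<otimes> t, g) * \<mu> (a, t)"
    using \<mu>_cocycle[OF G(1,2) g] by (simp add: mult.commute)
  also have "\<mu> (a \<otimes> t, g) * \<mu> (a, t) * cnj (\<mu> (a, t)) = \<mu> (a \<otimes> t, g)"
    using \<mu>_cnj[OF G(1,2)] by (simp add: mult.assoc)
  finally show ?thesis using G g by (simp add: G.m_assoc)
qed

text \<open>One denominator suffices, since by the shift rule the right-hand side does not depend on
  it.\<close>

lemma matrix_entryI:
  assumes x: "x \<in> carrier H" and g: "g \<in> carrier G" and y: "y \<in> carrier H"
    and t: "t \<in> P" "t \<otimes> g \<in> P"
    and eq: "\<And>z. z \<in> carrier H \<Longrightarrow> cinner H y z = \<mu> (t, g) * cinner H (V (t \<otimes> g) x) (V t z)"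
  shows "matrix_entry x g y"
  unfolding matrix_entry_def
proof (intro conjI ballI impI y)
  fix s z assume s: "s \<in> P" "s \<otimes> g \<in> P" and z: "z \<in> carrier H"
  have "\<mu> (t, g) * cinner H (V (t \<otimes> g) x) (V t z) = \<mu> (s, g) * cinner H (V (s \<otimes> g) x) (V s z)"
  proof (rule G.invariant_imp_constant[of "{s \<in> P. s \<otimes> g \<in> P}"
        "\<lambda>s. \<mu> (s, g) * cinner H (V (s \<otimes> g) x) (V s z)"])
    fix s a assume "s \<in> {s \<in> P. s \<otimes> g \<in> P}" "a \<in> P"
    then show "\<mu> (a \<otimes> s, g) * cinner H (V (a \<otimes> s \<otimes> g) x) (V (a \<otimes> s) z) =
        \<mu> (s, g) * cinner H (V (s \<otimes> g) x) (V s z)"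
      by (intro matrix_entry_shift x z g) simp_all
  qed (use s t in simp_all)
  with eq[OF z] show "cinner H y z = \<mu> (s, g) * cinner H (V (s \<otimes> g) x) (V s z)" by simp
qed

lemma matrix_entry_ex:
  assumes x: "x \<in> carrier H" and g: "g \<in> carrier G"
  shows "\<exists>y. matrix_entry x g y"
proof -
  obtain t where t: "t \<in> P" "t \<otimes> g \<in> P" using G.P_denominator[OF g] by blast
  note adj = hadjoint_isometry[OF H.complex_hilbert_space_axioms H.complex_inner_space_axioms
      V_isometry[OF t(1)]]
  have Vx: "V (t \<otimes> g) x \<in> carrier H" by (rule V_closed[OF t(2) x])
  \<comment> \<open>The defining equation solved for \<open>y\<close> at a single denominator
    \<open>t\<close>.\<close>
  have "matrix_entry x g (\<mu> (t, g) \<odot>\<^bsub>H\<^esub> hadjoint H H (V t) (V (t \<otimes> g) x))"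
    by (rule matrix_entryI[OF x g _ t])
      (use adj(1)[OF Vx] adj(3)[OF _ Vx] in \<open>simp_all add: H.cinner_smult\<close>)
  then show ?thesis by blast
qed

lemma matrix_entry_unique:
  assumes g: "g \<in> carrier G" and y: "matrix_entry x g y" and y': "matrix_entry x g y'"
  shows "y = y'"
proof -
  obtain t where t: "t \<in> P" "t \<otimes> g \<in> P" using G.P_denominator[OF g] by blast
  show ?thesis
    by (rule H.cinner_eqI[OF matrix_entryD(1)[OF y] matrix_entryD(1)[OF y']])
      (simp only: matrix_entryD(2)[OF y t] matrix_entryD(2)[OF y' t])
qed

definition model_J :: "'h \<Rightarrow> 'g \<Rightarrow> 'h" where
  "model_J x = (\<lambda>g\<in>carrier G. SOME y. matrix_entry x g y)"

lemma model_J_entry: "\<lbrakk>x \<in> carrier H; g \<in> carrier G\<rbrakk> \<Longrightarrow> matrix_entry x g (model_J x g)"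
  unfolding model_J_def using someI_ex[OF matrix_entry_ex] by simp

lemma model_J_eqI:
  "\<lbrakk>x \<in> carrier H; g \<in> carrier G; matrix_entry x g y\<rbrakk> \<Longrightarrow> model_J x g = y"
  by (rule matrix_entry_unique[OF _ model_J_entry])

lemma model_J_value_closed [simp]: "\<lbrakk>x \<in> carrier H; g \<in> carrier G\<rbrakk> \<Longrightarrow> model_J x g \<in> carrier H"
  by (rule matrix_entryD(1)[OF model_J_entry])

lemma model_J_hnorm_le:
  assumes x: "x \<in> carrier H" and g: "g \<in> carrier G"
  shows "hnorm H (model_J x g) \<le> hnorm H x"
proof -
  define y where "y = model_J x g"
  have y: "matrix_entry x g y" "y \<in> carrier H" using x g by (simp_all add: y_def model_J_entry)
  obtain t where t: "t \<in> P" "t \<otimes> g \<in> P" using G.P_denominator[OF g] by blast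
  have "(hnorm H y)\<^sup>2 = norm (cinner H y y)"
    using y by (simp add: H.cinner_self norm_power)
  also have "\<dots> = norm (cinner H (V (t \<otimes> g) x) (V t y))"
    using matrix_entryD(2)[OF y(1) t y(2)] t g by (simp add: norm_mult)
  also have "\<dots> \<le> hnorm H x * hnorm H y"
    using H.norm_cinner_le[of "V (t \<otimes> g) x" "V t y"] t x y by simp
  finally have "hnorm H y \<le> hnorm H x"
    using H.hnorm_nonneg[OF y(2)] H.hnorm_nonneg[OF x]
    by (cases "hnorm H y = 0") (auto simp: power2_eq_square)
  then show ?thesis by (simp add: y_def)
qed

text \<open>If \<open>t\<close> is a denominator of \<open>a \<otimes> g\<close>, then
  \<open>t \<otimes> a\<close> is one of \<open>g\<close>; the entries at \<open>g\<close> and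
  \<open>a \<otimes> g\<close> are compared through these two, using \<open>V t\<close> after
  \<open>V a\<close>.\<close>

lemma model_J_closed:
  assumes x: "x \<in> carrier H"
  shows "model_J x \<in> model_carrier"
proof (rule model_carrierI)
  fix g a z assume *: "g \<in> carrier G" "a \<in> P" "z \<in> carrier H"
  have ag: "a \<otimes> g \<in> carrier G" using * by simp
  obtain t where t: "t \<in> P" "t \<otimes> (a \<otimes> g) \<in> P" using G.P_denominator[OF ag] by blast
  have G: "t \<in> carrier G" "a \<in> carrier G" "t \<otimes> a \<in> P" "t \<otimes> a \<otimes> g \<in> P"
    using t * by (simp_all add: G.P_mult G.m_assoc)
  have "cinner H (model_J x g) z = \<mu> (t \<otimes> a, g) * cinner H (V (t \<otimes> a \<otimes> g) x) (V (t \<otimes> a) z)"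
    by (rule matrix_entryD(2)[OF model_J_entry[OF x *(1)] G(3,4) *(3)])
  also have "\<mu> (t \<otimes> a, g) = (\<mu> (t, a) * \<mu> (t \<otimes> a, g)) * cnj (\<mu> (t, a))"
    using \<mu>_cnj[OF G(1,2)] by (simp add: mult_ac)
  also have "\<mu> (t, a) * \<mu> (t \<otimes> a, g) = \<mu> (t, a \<otimes> g) * \<mu> (a, g)"
    by (rule \<mu>_cocycle[OF G(1,2) *(1)])
  also have "\<mu> (t, a \<otimes> g) * \<mu> (a, g) * cnj (\<mu> (t, a)) * cinner H (V (t \<otimes> a \<otimes> g) x) (V (t \<otimes> a) z) =
      \<mu> (a, g) * (\<mu> (t, a \<otimes> g) * cinner H (V (t \<otimes> (a \<otimes> g)) x) (V t (V a z)))"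
    using t * G x by (simp add: V_mult H.cinner_smult_right G.m_assoc mult_ac)
  also have "\<mu> (t, a \<otimes> g) * cinner H (V (t \<otimes> (a \<otimes> g)) x) (V t (V a z)) = cinner H (model_J x (a \<otimes> g)) (V a z)"
    by (rule matrix_entryD(2)[OF model_J_entry[OF x ag] t V_closed[OF *(2,3)], symmetric])
  finally show "cinner H (model_J x g) z = \<mu> (a, g) * cinner H (model_J x (a \<otimes> g)) (V a z)" .
next
  show "hnorm H (model_J x g) \<le> hnorm H x" if "g \<in> carrier G" for g
    by (rule model_J_hnorm_le[OF x that])
qed (rule model_J_value_closed[OF x], assumption, simp add: model_J_def)

text \<open>On \<open>P\<close> the entries are explicit. Since \<open>V s\<close> is isometric, the
  supremum defining the norm of \<open>model_J x\<close> is attained at every point of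
  \<open>P\<close>.\<close>

lemma model_J_P:
  assumes x: "x \<in> carrier H" and s: "s \<in> P"
  shows "model_J x s = V s x"
proof (rule model_J_eqI[OF x])
  obtain t where t: "t \<in> P" by (rule P_nonempty)
  show "matrix_entry x s (V s x)"
  proof (rule matrix_entryI[OF x _ _ t G.P_mult[OF t s]])
    fix z assume z: "z \<in> carrier H"
    have "cinner H (V s x) z = cinner H (V t (V s x)) (V t z)"
      using x s t z by (simp add: V_cinner)
    also have "\<dots> = \<mu> (t, s) * cinner H (V (t \<otimes> s) x) (V t z)"
      using x s t z by (simp add: V_mult H.cinner_smult G.P_mult)
    finally show "cinner H (V s x) z = \<mu> (t, s) * cinner H (V (t \<otimes> s) x) (V t z)" .
  qed (use s x in simp_all)
qed (use s in simp)

lemma model_J_isometry: "linear_isometry H model model_J"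
  unfolding linear_isometry_def
proof (intro conjI ballI allI funcsetI)
  fix x assume x: "x \<in> carrier H"
  show "model_J x \<in> carrier model" using x by (simp add: model_simps(1) model_J_closed)
  obtain s where s: "s \<in> P" by (rule P_nonempty)
  show "hnorm model (model_J x) = hnorm H x"
  proof (rule antisym)
    show "hnorm model (model_J x) \<le> hnorm H x"
      using model_J_hnorm_le[OF x] by (simp add: model_hnorm model_J_closed x sup_norm_le)
    show "hnorm H x \<le> hnorm model (model_J x)"
      using hnorm_le_sup_norm[OF model_J_closed[OF x] G.P_carrier[OF s]] s x
      by (simp add: model_hnorm model_J_closed model_J_P)
  qed
  show "model_J (a \<odot>\<^bsub>H\<^esub> x) = a \<odot>\<^bsub>model\<^esub> model_J x" for a
  proof (rule model_eqI)
    fix g assume g: "g \<in> carrier G"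
    obtain t where t: "t \<in> P" "t \<otimes> g \<in> P" using G.P_denominator[OF g] by blast
    have "matrix_entry (a \<odot>\<^bsub>H\<^esub> x) g (a \<odot>\<^bsub>H\<^esub> model_J x g)"
      by (rule matrix_entryI[OF _ g _ t])
        (use x g t in \<open>simp_all add: H.cinner_smult V_smult matrix_entryD(2)[OF model_J_entry[OF x g] t]\<close>)
    then show "model_J (a \<odot>\<^bsub>H\<^esub> x) g = (a \<odot>\<^bsub>model\<^esub> model_J x) g"
      using x g by (simp add: model_J_eqI model_simps)
  qed (use x in \<open>simp_all add: model_J_closed model_smult_closed\<close>)
  fix x' assume x': "x' \<in> carrier H"
  show "model_J (x \<oplus>\<^bsub>H\<^esub> x') = model_J x \<oplus>\<^bsub>model\<^esub> model_J x'"
  proof (rule model_eqI)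
    fix g assume g: "g \<in> carrier G"
    obtain t where t: "t \<in> P" "t \<otimes> g \<in> P" using G.P_denominator[OF g] by blast
    have "matrix_entry (x \<oplus>\<^bsub>H\<^esub> x') g (model_J x g \<oplus>\<^bsub>H\<^esub> model_J x' g)"
      by (rule matrix_entryI[OF _ g _ t])
        (use x x' g t in \<open>simp_all add: H.cinner_add V_add distrib_left
            matrix_entryD(2)[OF model_J_entry[OF x g] t] matrix_entryD(2)[OF model_J_entry[OF x' g] t]\<close>)
    then show "model_J (x \<oplus>\<^bsub>H\<^esub> x') g = (model_J x \<oplus>\<^bsub>model\<^esub> model_J x') g"
      using x x' g by (simp add: model_J_eqI model_simps)
  qed (use x x' in \<open>simp_all add: model_J_closed model_add_closed\<close>)
qed

lemma model_U_J:
  assumes s: "s \<in> P" and x: "x \<in> carrier H"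
  shows "model_U s (model_J x) = model_J (V s x)"
proof (rule model_eqI)
  fix g assume g: "g \<in> carrier G"
  have sG: "s \<in> carrier G" and gs: "g \<otimes> s \<in> carrier G" using s g by simp_all
  obtain t where t: "t \<in> P" "t \<otimes> g \<in> P" using G.P_denominator[OF g] by blast
  \<comment> \<open>A denominator of \<open>g\<close> also serves \<open>g \<otimes> s\<close>, as
    \<open>s\<close> lies in \<open>P\<close>.\<close>
  have tgs: "t \<otimes> (g \<otimes> s) \<in> P" using G.P_mult[OF t(2) s] t g sG by (simp add: G.m_assoc)
  have "matrix_entry (V s x) g (\<mu> (g, s) \<odot>\<^bsub>H\<^esub> model_J x (g \<otimes> s))"
  proof (rule matrix_entryI[OF _ g _ t])
    fix z assume z: "z \<in> carrier H"
    have "cinner H (\<mu> (g, s) \<odot>\<^bsub>H\<^esub> model_J x (g \<otimes> s)) z = \<mu> (g, s) * cinner H (model_J x (g \<otimes> s)) z"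
      using x gs z by (simp add: H.cinner_smult)
    also have "cinner H (model_J x (g \<otimes> s)) z = \<mu> (t, g \<otimes> s) * cinner H (V (t \<otimes> (g \<otimes> s)) x) (V t z)"
      by (rule matrix_entryD(2)[OF model_J_entry[OF x gs] t(1) tgs z])
    also have "\<mu> (g, s) * \<dots> = (\<mu> (t, g) * \<mu> (t \<otimes> g, s)) * cinner H (V (t \<otimes> (g \<otimes> s)) x) (V t z)"
      using \<mu>_cocycle[OF G.P_carrier[OF t(1)] g sG] by simp
    also have "\<dots> = \<mu> (t, g) * cinner H (V (t \<otimes> g) (V s x)) (V t z)"
      using t g s x z tgs by (simp add: V_mult H.cinner_smult G.m_assoc)
    finally show "cinner H (\<mu> (g, s) \<odot>\<^bsub>H\<^esub> model_J x (g \<otimes> s)) z =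
      \<mu> (t, g) * cinner H (V (t \<otimes> g) (V s x)) (V t z)" .
  qed (use s x gs in simp_all)
  then show "model_U s (model_J x) g = model_J (V s x) g"
    using s x g by (simp add: model_J_eqI model_U_def)
qed (use s x in \<open>simp_all add: model_U_closed model_J_closed\<close>)

text \<open>Pythagoras: \<open>model_J (f s)\<close> is the projection of \<open>model_U s f\<close>
  onto the copy of \<open>H\<close>. By compatibility their pointwise inner products are constant on
  \<open>P\<close>, equal to that of \<open>f s\<close> with itself.\<close>

lemma model_U_J_dist:
  assumes s: "s \<in> P" and f: "f \<in> model_carrier"
  shows "(hnorm model (model_U s f \<ominus>\<^bsub>model\<^esub> model_J (f s)))\<^sup>2 = (sup_norm f)\<^sup>2 - (hnorm H (f s))\<^sup>2"
proof -
  have sG: "s \<in> carrier G" and y: "f s \<in> carrier H" using s f by simp_all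
  have Uf: "model_U s f \<in> model_carrier" and J: "model_J (f s) \<in> model_carrier"
    using sG f y by (simp_all add: model_U_closed model_J_closed)
  have "cinner model (model_U s f) (model_J (f s)) = cinner H (f s) (f s)"
  proof (rule model_cinner_eqI[OF Uf J])
    have "cinner H (f s) (f s) = cinner H (model_U s f t) (model_J (f s) t)" if t: "t \<in> P" for t
      using model_compatible[OF f sG t y] t s f y by (simp add: model_U_def model_J_P H.cinner_smult)
    then show "((\<lambda>g. cinner H (model_U s f g) (model_J (f s) g)) \<longlongrightarrow> cinner H (f s) (f s)) tail"
      by (intro Lim_transform_eventually[OF tendsto_const] eventually_mono[OF eventually_tail_P]) simp
  qed
  moreover have "hnorm model (model_U s f) = sup_norm f"
    using linear_isometryD(4)[OF model_U_isometry[OF sG], of f] f by (simp add: model_simps(1) model_hnorm)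
  moreover have "hnorm model (model_J (f s)) = hnorm H (f s)"
    by (rule linear_isometryD(4)[OF model_J_isometry y])
  ultimately show ?thesis
    using model.hnorm_diff_sq[of "model_U s f" "model_J (f s)"] Uf J y
    by (simp add: model_simps(1) H.cinner_self)
qed

text \<open>Choose \<open>s\<close> in \<open>P\<close> with the norm of \<open>f s\<close> close to
  its supremum; then \<open>model_U s f\<close> is close to \<open>model_J (f s)\<close>, and the
  unitary can be undone.\<close>

lemma model_dense:
  assumes f: "f \<in> model_carrier" and r: "0 < r"
  shows "\<exists>s\<in>P. \<exists>x\<in>carrier H. hnorm model (f \<ominus>\<^bsub>model\<^esub> hadjoint model model (model_U s) (model_J x)) < r"
proof -
  have "((\<lambda>g. (sup_norm f)\<^sup>2 - (hnorm H (f g))\<^sup>2) \<longlongrightarrow> (sup_norm f)\<^sup>2 - (sup_norm f)\<^sup>2) tail"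
    by (intro tendsto_intros tendsto_sup_norm f)
  then have "\<forall>\<^sub>F g in tail. (sup_norm f)\<^sup>2 - (hnorm H (f g))\<^sup>2 < r\<^sup>2"
    by (rule order_tendstoD) (use r in simp)
  then have "\<forall>\<^sub>F g in tail. g \<in> P \<and> (sup_norm f)\<^sup>2 - (hnorm H (f g))\<^sup>2 < r\<^sup>2"
    using eventually_tail_P by (rule eventually_conj[rotated])
  then obtain s where s: "s \<in> P" "(sup_norm f)\<^sup>2 - (hnorm H (f s))\<^sup>2 < r\<^sup>2"
    using eventually_happens'[OF tail_neq_bot] by blast
  have sG: "s \<in> carrier G" and y: "f s \<in> carrier H" using s f by simp_all
  define J where "J = model_J (f s)"
  have J: "J \<in> carrier model" using y by (simp add: J_def model_simps(1) model_J_closed)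
  have fc: "f \<in> carrier model" using f by (simp add: model_simps(1))
  have unitary: "unitary_operator model model (model_U s)"
    using model_unitary_rep sG by (simp add: unitary_rep_def)
  note inv = unitary_operator_hadjoint[OF model_hilbert_space model_inner_space unitary J]
  note iso = model_U_isometry[OF sG]
  have "hnorm model (f \<ominus>\<^bsub>model\<^esub> hadjoint model model (model_U s) J) = hnorm model (model_U s f \<ominus>\<^bsub>model\<^esub> J)"
    using linear_isometryD(4)[OF iso model.M.minus_closed[OF fc inv(1)]]
    by (simp add: linear_isometry_diff[OF model_inner_space model_inner_space iso fc inv(1)] inv(2))
  also have "\<dots> < r"
  proof (rule power2_less_imp_less)
    show "(hnorm model (model_U s f \<ominus>\<^bsub>model\<^esub> J))\<^sup>2 < r\<^sup>2"
      unfolding J_def model_U_J_dist[OF s(1) f] by (rule s(2))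
  qed (use r in simp)
  finally show ?thesis using s(1) y unfolding J_def by blast
qed

end


section \<open>Uniqueness of the minimal dilation\<close>

text \<open>Minimality in metric form, over \<open>P\<close>; \<open>minimal_dilation_iff\<close>
  relates it to the topological closure over \<open>S\<close>.\<close>

locale minimal_dilation = isometric_system G P H \<mu> V
  for G :: "('g, 'y) monoid_scheme" (structure) and P and H :: "('h, 'z) hilbert_scheme" and \<mu> V +
  fixes K :: "('k, 'w) hilbert_scheme" and U :: "'g \<Rightarrow> 'k \<Rightarrow> 'k" and J :: "'h \<Rightarrow> 'k"
  assumes K: "complex_hilbert_space K"
    and rep: "unitary_rep G \<mu> K U"
    and J_isometry: "linear_isometry H K J"
    and U_J: "\<lbrakk>s \<in> P; x \<in> carrier H\<rbrakk> \<Longrightarrow> U s (J x) = J (V s x)"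
    and dense: "\<lbrakk>\<xi> \<in> carrier K; 0 < r\<rbrakk> \<Longrightarrow>
      \<exists>s\<in>P. \<exists>x\<in>carrier H. hnorm K (\<xi> \<ominus>\<^bsub>K\<^esub> hadjoint K K (U s) (J x)) < r"
begin

sublocale K: complex_hilbert_space K
  by (rule K)

lemma U_unitary: "g \<in> carrier G \<Longrightarrow> unitary_operator K K (U g)"
  using rep by (simp add: unitary_rep_def)

lemma U_isometry: "g \<in> carrier G \<Longrightarrow> linear_isometry K K (U g)"
  using U_unitary by (simp add: unitary_operator_def)

lemma U_closed [simp]: "\<lbrakk>g \<in> carrier G; \<xi> \<in> carrier K\<rbrakk> \<Longrightarrow> U g \<xi> \<in> carrier K"
  by (rule linear_isometryD(1)[OF U_isometry])

lemma U_mult: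
  "\<lbrakk>g \<in> carrier G; h \<in> carrier G; \<xi> \<in> carrier K\<rbrakk> \<Longrightarrow> U g (U h \<xi>) = \<mu> (g, h) \<odot>\<^bsub>K\<^esub> U (g \<otimes> h) \<xi>"
  using rep unfolding unitary_rep_def by blast

lemma J_closed [simp]: "x \<in> carrier H \<Longrightarrow> J x \<in> carrier K"
  by (rule linear_isometryD(1)[OF J_isometry])

abbreviation J_adj :: "'k \<Rightarrow> 'h" where
  "J_adj \<equiv> hadjoint H K J"

lemmas J_adj = hadjoint_isometry[OF H.complex_hilbert_space_axioms K.complex_inner_space_axioms J_isometry]

lemmas J_adj_linear = hadjoint_linear[OF H.complex_hilbert_space_axioms K.complex_inner_space_axioms J_isometry]

lemmas J_adj_diff = hadjoint_diff[OF H.complex_hilbert_space_axioms K.complex_inner_space_axioms J_isometry]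

text \<open>Apply the isometry \<open>U t\<close> to both \<open>U g \<xi>\<close> and
  \<open>J y\<close>, and use that \<open>U t\<close> takes \<open>J y\<close> to
  \<open>J (V t y)\<close>.\<close>

lemma J_adj_compatible:
  assumes \<xi>: "\<xi> \<in> carrier K" and g: "g \<in> carrier G" and t: "t \<in> P" and y: "y \<in> carrier H"
  shows "cinner H (J_adj (U g \<xi>)) y = \<mu> (t, g) * cinner H (J_adj (U (t \<otimes> g) \<xi>)) (V t y)"
proof -
  have tG: "t \<in> carrier G" using t by simp
  have tg: "U (t \<otimes> g) \<xi> \<in> carrier K" using tG g \<xi> by simp
  have "cinner H (J_adj (U g \<xi>)) y = cinner K (U g \<xi>) (J y)"
    by (rule J_adj(3)[symmetric, OF y U_closed[OF g \<xi>]])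
  also have "\<dots> = cinner K (U t (U g \<xi>)) (U t (J y))"
    by (rule linear_isometry_cinner[symmetric, OF K.complex_inner_space_axioms K.complex_inner_space_axioms
          U_isometry[OF tG] U_closed[OF g \<xi>] J_closed[OF y]])
  also have "\<dots> = \<mu> (t, g) * cinner K (U (t \<otimes> g) \<xi>) (J (V t y))"
    using t y tG tg by (simp add: U_mult[OF tG g \<xi>] U_J K.cinner_smult)
  also have "cinner K (U (t \<otimes> g) \<xi>) (J (V t y)) = cinner H (J_adj (U (t \<otimes> g) \<xi>)) (V t y)"
    by (rule J_adj(3)[OF V_closed[OF t y] tg])
  finally show ?thesis .
qed

definition to_model :: "'k \<Rightarrow> 'g \<Rightarrow> 'h" where
  "to_model \<xi> = (\<lambda>g\<in>carrier G. J_adj (U g \<xi>))"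

lemma to_model_hnorm_le:
  assumes "\<xi> \<in> carrier K" "g \<in> carrier G"
  shows "hnorm H (to_model \<xi> g) \<le> hnorm K \<xi>"
  using J_adj(4)[of "U g \<xi>"] linear_isometryD(4)[OF U_isometry, of g \<xi>] assms
  by (simp add: to_model_def)

lemma to_model_closed:
  assumes \<xi>: "\<xi> \<in> carrier K"
  shows "to_model \<xi> \<in> model_carrier"
proof (rule model_carrierI)
  fix g t y assume *: "g \<in> carrier G" "t \<in> P" "y \<in> carrier H"
  then show "cinner H (to_model \<xi> g) y = \<mu> (t, g) * cinner H (to_model \<xi> (t \<otimes> g)) (V t y)"
    using J_adj_compatible[OF \<xi> *] by (simp add: to_model_def)
qed (use to_model_hnorm_le[OF \<xi>] J_adj(1) \<xi> in \<open>simp_all add: to_model_def\<close>)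

lemma to_model_U:
  assumes x: "x \<in> carrier G" and \<xi>: "\<xi> \<in> carrier K"
  shows "to_model (U x \<xi>) = model_U x (to_model \<xi>)"
proof (rule model_eqI)
  show "to_model (U x \<xi>) g = model_U x (to_model \<xi>) g" if "g \<in> carrier G" for g
    using that x \<xi> by (simp add: to_model_def model_U_def U_mult J_adj_linear)
qed (use x \<xi> in \<open>simp_all add: to_model_closed model_U_closed\<close>)

text \<open>At a denominator \<open>t\<close> of \<open>g\<close>, \<open>U (t \<otimes> g)\<close>
  acts on \<open>J x\<close> as \<open>V (t \<otimes> g)\<close>, and the adjoint of
  \<open>J\<close> undoes \<open>J\<close>; one denominator fixes the entry.\<close>

lemma to_model_J:
  assumes x: "x \<in> carrier H"
  shows "to_model (J x) = model_J x"
proof (rule model_eqI)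
  fix g assume g: "g \<in> carrier G"
  obtain t where t: "t \<in> P" "t \<otimes> g \<in> P" using G.P_denominator[OF g] by blast
  have "matrix_entry x g (J_adj (U g (J x)))"
    by (rule matrix_entryI[OF x g _ t])
      (use x g t J_adj(1,5) J_adj_compatible[OF J_closed[OF x] g t(1)] in \<open>simp_all add: U_J\<close>)
  then show "to_model (J x) g = model_J x g"
    using x g by (simp add: to_model_def model_J_eqI)
qed (use x in \<open>simp_all add: to_model_closed model_J_closed\<close>)

text \<open>Density supplies \<open>s\<close> with \<open>U s \<xi>\<close> near the range of
  \<open>J\<close>, where the adjoint of \<open>J\<close> is almost isometric; the single value at
  \<open>s\<close> then has nearly full norm.\<close>

lemma to_model_hnorm:
  assumes \<xi>: "\<xi> \<in> carrier K"
  shows "hnorm model (to_model \<xi>) = hnorm K \<xi>"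
proof (rule antisym)
  have closed: "to_model \<xi> \<in> model_carrier" by (rule to_model_closed[OF \<xi>])
  show "hnorm model (to_model \<xi>) \<le> hnorm K \<xi>"
    using to_model_hnorm_le[OF \<xi>] by (simp add: model_hnorm[OF closed] sup_norm_le)
  show "hnorm K \<xi> \<le> hnorm model (to_model \<xi>)"
  proof (rule field_le_epsilon)
    fix e :: real assume "0 < e"
    \<comment> \<open>The error \<open>e / 2\<close> is spent twice: from \<open>\<xi>\<close> to
      \<open>x\<close>, and from \<open>x\<close> to the value at \<open>s\<close>.\<close>
    then obtain s x where s: "s \<in> P" and x: "x \<in> carrier H"
      and close: "hnorm K (\<xi> \<ominus>\<^bsub>K\<^esub> hadjoint K K (U s) (J x)) < e / 2"
      using dense[OF \<xi>, of "e / 2"] by auto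
    have sG: "s \<in> carrier G" using s by simp
    note inv = unitary_operator_hadjoint[OF K K.complex_inner_space_axioms U_unitary[OF sG] J_closed[OF x]]
    have "hnorm K (U s \<xi> \<ominus>\<^bsub>K\<^esub> J x) = hnorm K (\<xi> \<ominus>\<^bsub>K\<^esub> hadjoint K K (U s) (J x))"
      using linear_isometryD(4)[OF U_isometry[OF sG] K.M.minus_closed[OF \<xi> inv(1)]]
      by (simp add: inv(2) linear_isometry_diff[OF K.complex_inner_space_axioms K.complex_inner_space_axioms
            U_isometry[OF sG] \<xi> inv(1)])
    then have small: "hnorm K (U s \<xi> \<ominus>\<^bsub>K\<^esub> J x) < e / 2" using close by simp
    have Us: "U s \<xi> \<in> carrier K" using sG \<xi> by simp
    have "hnorm K \<xi> = hnorm K (U s \<xi>)" by (rule linear_isometryD(4)[symmetric, OF U_isometry[OF sG] \<xi>])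
    also have "\<dots> \<le> hnorm H x + hnorm K (U s \<xi> \<ominus>\<^bsub>K\<^esub> J x)"
      using K.hnorm_reverse_triangle[OF Us J_closed[OF x]] linear_isometryD(4)[OF J_isometry x] by simp
    also have "hnorm H x \<le> hnorm H (J_adj (U s \<xi>)) + hnorm H (J_adj (U s \<xi>) \<ominus>\<^bsub>H\<^esub> x)"
      using H.hnorm_reverse_triangle[OF J_adj(1)[OF Us] x] by simp
    also have "hnorm H (J_adj (U s \<xi>) \<ominus>\<^bsub>H\<^esub> x) \<le> hnorm K (U s \<xi> \<ominus>\<^bsub>K\<^esub> J x)"
      using J_adj(4)[of "U s \<xi> \<ominus>\<^bsub>K\<^esub> J x"] Us x by (simp add: J_adj_diff J_adj(5))
    also have "hnorm H (J_adj (U s \<xi>)) \<le> hnorm model (to_model \<xi>)"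
      using hnorm_le_sup_norm[OF closed sG] sG unfolding model_hnorm[OF closed] by (simp add: to_model_def)
    finally show "hnorm K \<xi> \<le> hnorm model (to_model \<xi>) + e" using small by linarith
  qed
qed

lemma to_model_isometry: "linear_isometry K model to_model"
  unfolding linear_isometry_def
proof (intro conjI ballI allI funcsetI)
  fix \<xi> assume \<xi>: "\<xi> \<in> carrier K"
  show "to_model \<xi> \<in> carrier model" using \<xi> by (simp add: model_simps(1) to_model_closed)
  show "hnorm model (to_model \<xi>) = hnorm K \<xi>" by (rule to_model_hnorm[OF \<xi>])
  show "to_model (a \<odot>\<^bsub>K\<^esub> \<xi>) = a \<odot>\<^bsub>model\<^esub> to_model \<xi>" for a
  proof (rule model_eqI)
    show "to_model (a \<odot>\<^bsub>K\<^esub> \<xi>) g = (a \<odot>\<^bsub>model\<^esub> to_model \<xi>) g" if g: "g \<in> carrier G" for g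
      using g \<xi> by (simp add: to_model_def model_simps linear_isometryD(3)[OF U_isometry[OF g]] J_adj_linear)
  qed (use \<xi> in \<open>simp_all add: to_model_closed model_smult_closed\<close>)
  fix \<eta> assume \<eta>: "\<eta> \<in> carrier K"
  show "to_model (\<xi> \<oplus>\<^bsub>K\<^esub> \<eta>) = to_model \<xi> \<oplus>\<^bsub>model\<^esub> to_model \<eta>"
  proof (rule model_eqI)
    show "to_model (\<xi> \<oplus>\<^bsub>K\<^esub> \<eta>) g = (to_model \<xi> \<oplus>\<^bsub>model\<^esub> to_model \<eta>) g" if g: "g \<in> carrier G" for g
      using g \<xi> \<eta> by (simp add: to_model_def model_simps linear_isometryD(2)[OF U_isometry[OF g]] J_adj_linear)
  qed (use \<xi> \<eta> in \<open>simp_all add: to_model_closed model_add_closed\<close>)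
qed

text \<open>The range contains the dense vectors of \<open>model_dense\<close>, because
  \<open>to_model\<close> intertwines the actions and the embeddings of \<open>H\<close>.\<close>

lemma to_model_unitary: "unitary_operator K model to_model"
proof (rule linear_isometry_dense_range[OF K model_inner_space to_model_isometry])
  fix f and r :: real assume "f \<in> carrier model" "0 < r"
  then obtain s x where s: "s \<in> P" and x: "x \<in> carrier H"
    and close: "hnorm model (f \<ominus>\<^bsub>model\<^esub> hadjoint model model (model_U s) (model_J x)) < r"
    using model_dense[of f r] by (auto simp: model_simps(1))
  have sG: "s \<in> carrier G" using s by simp
  define \<xi> where "\<xi> = hadjoint K K (U s) (J x)"
  have \<xi>: "\<xi> \<in> carrier K" "U s \<xi> = J x"
    using unitary_operator_hadjoint[OF K K.complex_inner_space_axioms U_unitary[OF sG] J_closed[OF x]]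
    by (simp_all add: \<xi>_def)
  have "model_U s (to_model \<xi>) = model_J x"
    using to_model_U[OF sG \<xi>(1)] \<xi>(2) to_model_J[OF x] by simp
  moreover have "hadjoint model model (model_U s) (model_U s (to_model \<xi>)) = to_model \<xi>"
    using \<xi>(1) by (intro hadjoint_isometry(5)[OF model_hilbert_space model_inner_space model_U_isometry[OF sG]])
      (simp add: model_simps(1) to_model_closed)
  ultimately show "\<exists>\<xi>\<in>carrier K. hnorm model (f \<ominus>\<^bsub>model\<^esub> to_model \<xi>) < r"
    using close \<xi>(1) by auto
qed

end

context isometric_system
begin

lemma model_minimal_dilation: "minimal_dilation G P H \<mu> V model model_U model_J"
proof (rule minimal_dilation.intro[OF isometric_system_axioms], rule minimal_dilation_axioms.intro)
  show "\<exists>s\<in>P. \<exists>x\<in>carrier H. hnorm model (f \<ominus>\<^bsub>model\<^esub> hadjoint model model (model_U s) (model_J x)) < r"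
    if "f \<in> carrier model" "0 < r" for f r
    using model_dense[of f r] that by (simp only: model_simps(1))
qed (fact model_hilbert_space model_unitary_rep model_J_isometry model_U_J)+

text \<open>Both dilations are unitarily equivalent to the model, so \<open>W\<close> is the first
  equivalence followed by the adjoint of the second.\<close>

lemma minimal_dilation_unique:
  assumes "minimal_dilation G P H \<mu> V K U J" "minimal_dilation G P H \<mu> V K' U' J'"
  shows "\<exists>W. unitary_operator K K' W \<and>
    (\<forall>s\<in>P. \<forall>x\<in>carrier H. W (hadjoint K K (U s) (J x)) = hadjoint K' K' (U' s) (J' x)) \<and>
    (\<forall>g\<in>carrier G. \<forall>\<xi>\<in>carrier K. W (U g \<xi>) = U' g (W \<xi>))"
proof -
  interpret D: minimal_dilation G P H \<mu> V K U J by fact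
  interpret D': minimal_dilation G P H \<mu> V K' U' J' by fact
  define R where "R = hadjoint K' model D'.to_model"
  define W where "W \<xi> = R (D.to_model \<xi>)" for \<xi>
  have "unitary_operator model K' R"
    unfolding R_def by (rule unitary_operator_hadjoint_unitary[OF D'.K model_inner_space D'.to_model_unitary])
  then have W: "unitary_operator K K' W"
    unfolding W_def using D.to_model_unitary by (rule unitary_operator_compose[rotated])
  have R: "R (D'.to_model \<eta>) = \<eta>" if "\<eta> \<in> carrier K'" for \<eta>
    unfolding R_def by (rule hadjoint_isometry(5)[OF D'.K model_inner_space D'.to_model_isometry that])
  have Wc: "W \<xi> \<in> carrier K'" and \<Psi>W: "D'.to_model (W \<xi>) = D.to_model \<xi>" if "\<xi> \<in> carrier K" for \<xi>
    using unitary_operator_hadjoint[OF D'.K model_inner_space D'.to_model_unitary, of "D.to_model \<xi>"] that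
    by (simp_all add: W_def R_def model_simps(1) D.to_model_closed)
  \<comment> \<open>Statements about \<open>W\<close> are thereby checked inside the model, where
    both sides are known.\<close>
  have W_eqI: "W \<xi> = \<eta>" if "\<eta> \<in> carrier K'" "D.to_model \<xi> = D'.to_model \<eta>" for \<xi> \<eta>
    using R[OF that(1)] that(2) by (simp add: W_def)
  have WU: "W (U g \<xi>) = U' g (W \<xi>)" if g: "g \<in> carrier G" and \<xi>: "\<xi> \<in> carrier K" for g \<xi>
    by (rule W_eqI) (simp_all add: g \<xi> Wc D.to_model_U D'.to_model_U \<Psi>W)
  have WJ: "W (J x) = J' x" if "x \<in> carrier H" for x
    by (rule W_eqI) (simp_all add: that D.to_model_J D'.to_model_J)
  have "W (hadjoint K K (U s) (J x)) = hadjoint K' K' (U' s) (J' x)" if s: "s \<in> P" and x: "x \<in> carrier H" for s x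
  proof -
    have sG: "s \<in> carrier G" using s by simp
    define \<xi> where "\<xi> = hadjoint K K (U s) (J x)"
    have \<xi>: "\<xi> \<in> carrier K" "U s \<xi> = J x"
      using unitary_operator_hadjoint[OF D.K D.K.complex_inner_space_axioms D.U_unitary[OF sG] D.J_closed[OF x]]
      by (simp_all add: \<xi>_def)
    have "U' s (W \<xi>) = J' x" using WU[OF sG \<xi>(1)] \<xi>(2) WJ[OF x] by simp
    then have "hadjoint K' K' (U' s) (J' x) = W \<xi>"
      using hadjoint_isometry(5)[OF D'.K D'.K.complex_inner_space_axioms D'.U_isometry[OF sG] Wc[OF \<xi>(1)]] by simp
    then show ?thesis by (simp add: \<xi>_def)
  qed
  with W WU show ?thesis by blast
qed

end

section \<open>Dilations of representations of \<open>S\<close>\<close>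

context ore_envelope
begin

context
  fixes H :: "('h, 'z) hilbert_scheme" and \<mu> V
  assumes H: "complex_hilbert_space H" and \<mu>: "\<mu> \<in> multipliers G" and V: "isometric_rep S (res \<mu>) H V"
begin

lemma isometric_system:
  "isometric_system G (\<iota> ` carrier S) H \<mu> (\<lambda>p. V (inv_into (carrier S) \<iota> p))"
proof (intro isometric_system.intro isometric_system_axioms.intro fraction_group_axioms H \<mu>)
  have j: "inv_into (carrier S) \<iota> (\<iota> s) = s" if "s \<in> carrier S" for s
    using that embedding_inj by simp
  show "linear_isometry H H (V (inv_into (carrier S) \<iota> p))" if p: "p \<in> \<iota> ` carrier S" for p
    using V inv_into_into[OF p] unfolding isometric_rep_def by blast
  fix p q x assume "p \<in> \<iota> ` carrier S" "q \<in> \<iota> ` carrier S" and x: "x \<in> carrier H"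
  then obtain s t where st: "s \<in> carrier S" "t \<in> carrier S" "p = \<iota> s" "q = \<iota> t" by blast
  have "V s (V t x) = res \<mu> (s, t) \<odot>\<^bsub>H\<^esub> V (s \<otimes>\<^bsub>S\<^esub> t) x"
    using V st x unfolding isometric_rep_def by blast
  then show "V (inv_into (carrier S) \<iota> p) (V (inv_into (carrier S) \<iota> q) x) =
      \<mu> (p, q) \<odot>\<^bsub>H\<^esub> V (inv_into (carrier S) \<iota> (p \<otimes>\<^bsub>G\<^esub> q)) x"
    using j[OF S_closed[OF st(1,2)]] st by (simp add: j restrict_multiplier_def)
qed

lemma minimal_dilation_iff:
  "minimal_dilation G (\<iota> ` carrier S) H \<mu> (\<lambda>p. V (inv_into (carrier S) \<iota> p)) K U J \<longleftrightarrow>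
    minimal_unitary_dilation S G \<iota> \<mu> H V K U J"
proof -
  have j: "inv_into (carrier S) \<iota> (\<iota> s) = s" if "s \<in> carrier S" for s
    using that embedding_inj by simp
  \<comment> \<open>The metric description of closures requires the translates of \<open>H\<close>
    to lie in \<open>K\<close>; the unitarity of \<open>U\<close> and the isometry \<open>J\<close>
    ensure this.\<close>
  have dense_iff: "htopology K closure_of (\<Union>s\<in>carrier S. hadjoint K K (U (\<iota> s)) ` J ` carrier H) = carrier K \<longleftrightarrow>
      (\<forall>\<xi>\<in>carrier K. \<forall>r>0. \<exists>s\<in>carrier S. \<exists>x\<in>carrier H. hnorm K (\<xi> \<ominus>\<^bsub>K\<^esub> hadjoint K K (U (\<iota> s)) (J x)) < r)"
    if K: "complex_hilbert_space K" and U: "unitary_rep G \<mu> K U" and J: "linear_isometry H K J"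
  proof -
    interpret K: complex_hilbert_space K by fact
    have "hadjoint K K (U (\<iota> s)) (J x) \<in> carrier K" if "s \<in> carrier S" "x \<in> carrier H" for s x
    proof (rule unitary_operator_hadjoint(1)[OF K K.complex_inner_space_axioms _ linear_isometryD(1)[OF J that(2)]])
      show "unitary_operator K K (U (\<iota> s))" using U that by (simp add: unitary_rep_def)
    qed
    then have sub: "(\<Union>s\<in>carrier S. hadjoint K K (U (\<iota> s)) ` J ` carrier H) \<subseteq> carrier K"
      by (intro UN_least image_subsetI) (elim imageE, simp only:)
    have "(\<exists>\<eta>\<in>(\<Union>s\<in>carrier S. hadjoint K K (U (\<iota> s)) ` J ` carrier H). Q \<eta>) \<longleftrightarrow>
        (\<exists>s\<in>carrier S. \<exists>x\<in>carrier H. Q (hadjoint K K (U (\<iota> s)) (J x)))" for Q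
      by blast
    then show ?thesis unfolding K.hnorm_closure_of[OF sub] by (simp only:)
  qed
  show ?thesis
  proof
    assume "minimal_dilation G (\<iota> ` carrier S) H \<mu> (\<lambda>p. V (inv_into (carrier S) \<iota> p)) K U J"
    then interpret D: minimal_dilation G "\<iota> ` carrier S" H \<mu> "\<lambda>p. V (inv_into (carrier S) \<iota> p)" K U J .
    have UJ: "U (\<iota> s) (J x) = J (V s x)" if "s \<in> carrier S" "x \<in> carrier H" for s x
      using D.U_J[OF imageI[OF that(1)] that(2)] by (simp only: j[OF that(1)])
    have "\<exists>s\<in>carrier S. \<exists>x\<in>carrier H. hnorm K (\<xi> \<ominus>\<^bsub>K\<^esub> hadjoint K K (U (\<iota> s)) (J x)) < r"
      if "\<xi> \<in> carrier K" "0 < r" for \<xi> r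
      using D.dense[OF that] by blast
    then show "minimal_unitary_dilation S G \<iota> \<mu> H V K U J"
      unfolding minimal_unitary_dilation_def dense_iff[OF D.K D.rep D.J_isometry]
      using D.K D.rep D.J_isometry UJ by blast
  next
    assume "minimal_unitary_dilation S G \<iota> \<mu> H V K U J"
    then have K: "complex_hilbert_space K" and U: "unitary_rep G \<mu> K U" and J: "linear_isometry H K J"
      and UJ: "\<forall>s\<in>carrier S. \<forall>x\<in>carrier H. U (\<iota> s) (J x) = J (V s x)"
      and dense: "htopology K closure_of (\<Union>s\<in>carrier S. hadjoint K K (U (\<iota> s)) ` J ` carrier H) = carrier K"
      unfolding minimal_unitary_dilation_def by blast+
    show "minimal_dilation G (\<iota> ` carrier S) H \<mu> (\<lambda>p. V (inv_into (carrier S) \<iota> p)) K U J"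
    proof (rule minimal_dilation.intro[OF isometric_system], rule minimal_dilation_axioms.intro)
      show "\<exists>p\<in>\<iota> ` carrier S. \<exists>x\<in>carrier H. hnorm K (\<xi> \<ominus>\<^bsub>K\<^esub> hadjoint K K (U p) (J x)) < r"
        if "\<xi> \<in> carrier K" "0 < r" for \<xi> r
        using dense that unfolding dense_iff[OF K U J] by blast
      fix p x assume "p \<in> \<iota> ` carrier S" and x: "x \<in> carrier H"
      then obtain s where s: "s \<in> carrier S" "p = \<iota> s" by blast
      have "U (\<iota> s) (J x) = J (V s x)" using UJ s(1) x by blast
      then show "U p (J x) = J (V (inv_into (carrier S) \<iota> p) x)" by (simp only: s(2) j[OF s(1)])
    qed (fact K U J)+
  qed
qed

end

end

text \<open>Existence is witnessed on the explicit type of functions from \<open>G\<close> to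
  \<open>H\<close>, while uniqueness compares dilations carried by two arbitrary types.\<close>

theorem theorem1p2p2:
  fixes S :: "('s, 'x) monoid_scheme" and G :: "('g, 'y) monoid_scheme" and \<iota> :: "'s \<Rightarrow> 'g"
  assumes "ore_semigroup S" and "enveloping_group S G \<iota>"
  shows
    "(\<forall>\<sigma>\<in>multipliers S. \<exists>\<mu>\<in>multipliers G. restrict_multiplier S \<iota> \<mu> = \<sigma>) \<and>
     (\<exists>\<Phi>\<in>iso (H2 G) (H2 S). \<forall>\<mu>\<in>multipliers G.
        restrict_multiplier S \<iota> \<mu> \<in> multipliers S \<and>
        \<Phi> (H2_class G \<mu>) = H2_class S (restrict_multiplier S \<iota> \<mu>)) \<and>
     (\<forall>\<sigma>\<in>multipliers S. \<forall>\<mu>\<in>multipliers G. \<forall>(H :: 'h hilbert) V.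
        restrict_multiplier S \<iota> \<mu> = \<sigma> \<and> complex_hilbert_space H \<and> isometric_rep S \<sigma> H V \<longrightarrow>
        (\<exists>(K :: ('g \<Rightarrow> 'h) hilbert) U J. minimal_unitary_dilation S G \<iota> \<mu> H V K U J) \<and>
        (\<forall>(K :: 'k hilbert) U J (K' :: 'l hilbert) U' J'.
           minimal_unitary_dilation S G \<iota> \<mu> H V K U J \<and>
           minimal_unitary_dilation S G \<iota> \<mu> H V K' U' J' \<longrightarrow>
           (\<exists>W. unitary_operator K K' W \<and>
             (\<forall>s\<in>carrier S. \<forall>x\<in>carrier H.
               W (hadjoint K K (U (\<iota> s)) (J x)) = hadjoint K' K' (U' (\<iota> s)) (J' x)) \<and>
             (\<forall>g\<in>carrier G. \<forall>x\<in>carrier K. W (U g x) = U' g (W x)))))"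
proof -
  interpret ore_envelope S G \<iota>
    using assms by (rule ore_envelope.intro)
  show ?thesis
  proof (intro conjI ballI allI impI)
    show "\<exists>\<mu>\<in>multipliers G. res \<mu> = w" if "w \<in> multipliers S" for w
      by (rule res_surj[OF that])
    show "\<exists>\<Phi>\<in>iso (H2 G) (H2 S). \<forall>\<mu>\<in>multipliers G.
        res \<mu> \<in> multipliers S \<and> \<Phi> (H2_class G \<mu>) = H2_class S (res \<mu>)"
      by (rule H2_iso)
  next
    fix w \<mu> and H :: "'h hilbert" and V
    assume \<mu>: "\<mu> \<in> multipliers G" and "res \<mu> = w \<and> complex_hilbert_space H \<and> isometric_rep S w H V"
    then have H: "complex_hilbert_space H" and V: "isometric_rep S (res \<mu>) H V" by simp_all
    interpret D: isometric_system G "\<iota> ` carrier S" H \<mu> "\<lambda>p. V (inv_into (carrier S) \<iota> p)"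
      by (rule isometric_system[OF H \<mu> V])
    show "\<exists>(K :: ('g \<Rightarrow> 'h) hilbert) U J. minimal_unitary_dilation S G \<iota> \<mu> H V K U J"
      using D.model_minimal_dilation unfolding minimal_dilation_iff[OF H \<mu> V] by blast
    fix K :: "'k hilbert" and U J and K' :: "'l hilbert" and U' J'
    assume "minimal_unitary_dilation S G \<iota> \<mu> H V K U J \<and> minimal_unitary_dilation S G \<iota> \<mu> H V K' U' J'"
    then have dil: "minimal_unitary_dilation S G \<iota> \<mu> H V K U J" "minimal_unitary_dilation S G \<iota> \<mu> H V K' U' J'"
      by blast+
    show "\<exists>W. unitary_operator K K' W \<and>
        (\<forall>s\<in>carrier S. \<forall>x\<in>carrier H.
          W (hadjoint K K (U (\<iota> s)) (J x)) = hadjoint K' K' (U' (\<iota> s)) (J' x)) \<and>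
        (\<forall>g\<in>carrier G. \<forall>x\<in>carrier K. W (U g x) = U' g (W x))"
      using D.minimal_dilation_unique[OF dil[folded minimal_dilation_iff[OF H \<mu> V]]]
      \<comment> \<open>Quantification over the image of \<open>S\<close> becomes quantification
        over \<open>S\<close>.\<close>
      unfolding ball_simps .
  qed
qed

end
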